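(* Let $\mathfrak D=(X,U,\mathbb K,\mathsf T)$ be a cdt-MP and let $S,G\in\mathcal B(X)$ be disjoint. If $m:=m(S)<\infty$, then the operators $({}_S\mathsf R^* )^m$ and $({}_S\mathsf R_* )^m$ are contractions with modulus $\beta:=\beta_m(S)$ on the spaces $\mathrm b\mathcal A^*(S)$ and $\mathrm b\mathcal A_*(S)$ respectively. In particular, each of them has a unique fixpoint, and for any $n\in\mathbb N_0$ $$\rho(W_\infty,W_{mn})\le\beta^n,\qquad \rho(w_\infty,w_{mn})\le\beta^n.$$ Finally, as a special case, $({}_S\mathsf T^* )^m$ and $({}_S\mathsf T_* )^m$ are contractions (on $\mathrm b\mathcal A^*(S)$ and $\mathrm b\mathcal A_*(S)$ respectively) and $V_\infty=v_\infty=0$.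
   Context: A Borel space is a topological space homeomorphic to a Borel subset of a complete separable metric space; $\mathcal B(Y)$ is its Borel $\sigma$-algebra. A cdt-MP is a tuple $\mathfrak D=(X,U,\mathbb K,\mathsf T)$ with $X,U$ non-empty Borel spaces, $\mathbb K\subseteq X\times U$ an analytic set such that $\mathbb K_x:=\{u\in U:(x,u)\in\mathbb K\}\neq\emptyset$ for all $x\in X$, and $\mathsf T(\cdot|x,u)$ a Borel measurable stochastic kernel on $X$ given $X\times U$. The path space is $H=(X\times U)^{\mathbb N_0}$ and $H_n=(X\times U)^n\times X$ is the space of histories $h_n=(x_0,u_0,\dots,u_{n-1},x_n)$. A policy is a sequence $\pi=(\pi_n)_{n\ge0}$ of universally measurable stochastic kernels $\pi_n$ on $U$ given $H_n$ with $\pi_n(\mathbb K_{x_n}|h_n)=1$ for all $h_n$; $\Pi$ is the set of all policies. $\mathsf P^\pi_x$ is the unique probability measure on $H$ under which $x_0=x$, the conditional law of $u_n$ given $h_n$ is $\pi_n(\cdot|h_n)$, and the conditional law of $x_{n+1}$ given $(h_n,u_n)$ is $\mathsf T(\cdot|x_n,u_n)$. For an event $A$: $\mathsf M^\pi(x;A)=\mathsf P^\pi_x(A)$, $\mathsf M^*(x;A)=\sup_{\pi\in\Pi}\mathsf M^\pi(x;A)$, $\mathsf M_*(x;A)=\inf_{\pi\in\Pi}\mathsf M^\pi(x;A)$. For $n\in\bar{\mathbb N}_0=\mathbb N_0\cup\{\infty\}$: $S\,\mathsf U^nG$ is the event that there is a finite $i\le n$ with $x_i\in G$ and $x_j\in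 S$ for all $0\le j<i$; $\square^nS$ is the event that $x_k\in S$ for all finite $k\le n$. Define functions on $S$ by restriction: $W_n=\mathsf M^*(\cdot;S\,\mathsf U^nG)|_S$, $w_n=\mathsf M_*(\cdot;S\,\mathsf U^nG)|_S$, $V_n=\mathsf M^*(\cdot;\square^nS)|_S$, $v_n=\mathsf M_*(\cdot;\square^nS)|_S$. For $n\in\mathbb N_0$ set $\beta_n(S)=\sup_{x\in X}\mathsf M^*(x;\square^nS)\in[0,1]$ (equivalently $\sup_{x\in S}V_n(x)$), and $m(S)=\inf\{n\in\mathbb N_0:\beta_n(S)<1\}\in\bar{\mathbb N}_0$. $\mathrm b\mathcal A_*(S)$ is the set of bounded lower semi-analytic functions on $S$ ($\{f<c\}$ is analytic for every $c\in\mathbb R$), $\mathrm b\mathcal A^*(S)=\{f:-f\in\mathrm b\mathcal A_*(S)\}$, both with the sup-metric $\rho(f,g)=\sup_{x\in S}|f(x)-g(x)|$. For $x\in S$: ${}_S\mathsf T^uf(x)=\int_Sf(x')\mathsf T(dx'|x,u)$, ${}_S\mathsf T^*f(x)=\sup_{u\in\mathbb K_x}{}_S\mathsf T^uf(x)$, ${}_S\mathsf T_*f(x)=\inf_{u\in\mathbb K_x}{}_S\mathsf T^uf(x)$, $${}_S\mathsf R^*f(x)=\sup_{u\in\mathbb K_x}[\mathsf T(G|x,u)+{}_S\mathsf T^uf(x)],\qquad {}_S\mathsf R_*f(x)=\inf_{u\in\mathbb K_x}[\mathsf T(G|x,u)+{}_S\mathsf T^uf(x)],$$ where the starred-above operators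 act on $\mathrm b\mathcal A^*(S)$ and the starred-below ones on $\mathrm b\mathcal A_*(S)$. A contraction with modulus $\beta\in[0,1)$ is a map $F$ with $\rho(Ff,Fg)\le\beta\rho(f,g)$ for all $f,g$. *)

theory Defs
  imports "HOL-Probability.Probability"
begin

text \<open>A complete separable metric space has at most continuum many points, so realising its
  topology \<open>Y\<close> on a subset of the reals (unrelated to the usual topology) loses no generality;
  see \<open>borel_space_topologyI\<close>.\<close>

definition borel_space_topology :: "'a topology \<Rightarrow> bool" where
  "borel_space_topology X \<longleftrightarrow>
     (\<exists>(Y :: real topology) B. completely_metrizable_space Y \<and> separable_space Y \<and>
        B \<in> sigma_sets (topspace Y) {V. openin Y V} \<and> X homeomorphic_space subtopology Y B)"

class borel_space = topological_space +
  assumes borel_space: "borel_space_topology (topology open)"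

lemma inj_polish_real: "\<exists>f :: 'a::polish_space \<Rightarrow> real. inj f"
proof -
  obtain \<B> :: "'a set set" where \<B>: "countable \<B>" "topological_basis \<B>"
    using ex_countable_basis by blast
  define f where "f x = to_nat_on \<B> ` {b\<in>\<B>. x \<in> b}" for x
  have "inj f"
  proof (rule injI, rule ccontr)
    fix x y assume fxy: "f x = f y" and "x \<noteq> y"
    then obtain U where U: "open U" "x \<in> U" "y \<notin> U"
      by (metis t1_space)
    then obtain b where b: "b \<in> \<B>" "x \<in> b" "b \<subseteq> U"
      using \<B>(2) topological_basisE by blast
    then have "to_nat_on \<B> b \<in> f y"
      using fxy by (auto simp: f_def)
    then obtain b' where "b' \<in> \<B>" "y \<in> b'" "to_nat_on \<B> b' = to_nat_on \<B> b"
      by (auto simp: f_def)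
    then have "y \<in> b"
      using \<B>(1) b(1) by (metis inj_on_to_nat_on inj_onD)
    then show False using b U by blast
  qed
  moreover obtain g :: "nat set \<Rightarrow> real" where "inj g"
    using nat_sets_eqpoll_reals unfolding eqpoll_def by (auto simp: bij_betw_def)
  ultimately show ?thesis
    by (metis inj_compose)
qed

lemma borel_space_topologyI:
  fixes B :: "'y::polish_space set"
  assumes B: "B \<in> sets borel" and X: "X homeomorphic_space top_of_set B"
  shows "borel_space_topology X"
proof -
  obtain f :: "'y \<Rightarrow> real" where f: "inj f" using inj_polish_real by blast
  define Y where "Y = pullback_topology (range f) (inv f) (euclidean :: 'y topology)"
  have openY: "openin Y V \<longleftrightarrow> (\<exists>U. open U \<and> V = f ` U)" for V
  proof -
    have "inv f -` U \<inter> range f = f ` U" for U using f by auto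
    then show ?thesis unfolding Y_def openin_pullback_topology by simp
  qed
  have topY: "topspace Y = range f"
    unfolding Y_def topspace_pullback_topology by auto
  have hom: "homeomorphic_map euclidean Y f"
  proof (rule bijective_open_imp_homeomorphic_map)
    show "continuous_map euclidean Y f"
      using f by (auto simp: continuous_map_def topY openY inj_image_mem_iff)
    show "open_map euclidean Y f"
      by (auto simp: open_map_def openY)
  qed (use f in \<open>auto simp: topY\<close>)
  have homY: "(euclidean :: 'y topology) homeomorphic_space Y"
    using hom homeomorphic_map_imp_homeomorphic_space by blast
  have "second_countable (euclidean :: 'y topology)"
    using univ_second_countable unfolding second_countable_def
    by (metis ex_countable_basis open_openin topological_basis_def topological_basisE)
  then have "separable_space (euclidean :: 'y topology)"
    by (rule second_countable_imp_separable_space)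
  then have sep: "separable_space Y"
    using homY homeomorphic_separable_space by blast
  have comp: "completely_metrizable_space Y"
    using homY homeomorphic_completely_metrizable_space completely_metrizable_space_euclidean
    by blast
  have "B \<in> sigma_sets UNIV {S. open S}"
    using B by (simp add: borel_def)
  then have "f ` B \<in> sigma_sets (topspace Y) {V. openin Y V}"
  proof (induction rule: sigma_sets.induct)
    case (Basic a)
    then show ?case using openY by (intro sigma_sets.Basic) auto
  next
    case Empty
    then show ?case by (simp add: sigma_sets.Empty)
  next
    case (Compl a)
    have "f ` (UNIV - a) = topspace Y - f ` a"
      using f by (simp add: topY image_set_diff)
    then show ?case using Compl by (simp add: sigma_sets.Compl)
  next
    case (Union a)
    then show ?case by (simp add: image_UN sigma_sets.Union)
  qed
  moreover have "homeomorphic_map (top_of_set B) (subtopology Y (f ` B)) f"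
    using hom by (rule homeomorphic_map_subtopologies) (simp add: topY image_mono Int_absorb1)
  then have "X homeomorphic_space subtopology Y (f ` B)"
    using X homeomorphic_map_imp_homeomorphic_space homeomorphic_space_trans by blast
  ultimately show ?thesis
    unfolding borel_space_topology_def using comp sep by blast
qed

instance polish_space \<subseteq> borel_space
proof
  show "borel_space_topology (euclidean :: 'a topology)"
    by (rule borel_space_topologyI[where B = UNIV]) (auto simp: homeomorphic_space_refl)
qed

lemma separable_metrizable_imp_second_countable:
  assumes "metrizable_space Y" "separable_space Y"
  shows "second_countable Y"
proof -
  obtain M d where "Metric_space M d" and Y: "Y = Metric_space.mtopology M d"
    using assms(1) by (auto simp: metrizable_space_def)
  interpret Metric_space M d by fact
  obtain C where C: "countable C" "C \<subseteq> M" "mtopology closure_of C = M"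
    using assms(2) by (auto simp: separable_space_def Y)
  define \<B> where "\<B> = (\<lambda>(c, n). mball c (1 / Suc n)) ` (C \<times> (UNIV :: nat set))"
  have "\<exists>V\<in>\<B>. x \<in> V \<and> V \<subseteq> U" if U: "openin mtopology U" "x \<in> U" for U x
  proof -
    obtain r where r: "r > 0" "mball x r \<subseteq> U" and x: "x \<in> M"
      using U by (metis openin_mtopology subsetD)
    obtain n where n: "1 / Suc n < r / 2"
      using r(1) nat_approx_posE[of "r / 2"] by auto
    obtain c where c: "c \<in> C" "c \<in> mball x (1 / Suc n)"
    proof -
      have "x \<in> mtopology closure_of C" using x C(3) by simp
      moreover have "1 / real (Suc n) > 0" by simp
      ultimately show thesis using that unfolding metric_closure_of by blast
    qed
    have "mball c (1 / Suc n) \<subseteq> mball x r"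
    proof
      fix y assume "y \<in> mball c (1 / Suc n)"
      then show "y \<in> mball x r"
        using c n triangle[of x c y] by auto
    qed
    moreover have "x \<in> mball c (1 / Suc n)"
      using c x by (auto simp: commute)
    ultimately show ?thesis
      using c r unfolding \<B>_def by (intro bexI[of _ "mball c (1 / Suc n)"]) auto
  qed
  moreover have "countable \<B>" using C(1) by (simp add: \<B>_def)
  moreover have "\<forall>V\<in>\<B>. openin mtopology V" by (auto simp: \<B>_def)
  ultimately show ?thesis unfolding second_countable_def Y by blast
qed

lemma borel_space_metrizable_second_countable:
  "metrizable_space (euclidean :: 'a::borel_space topology)"
  "second_countable (euclidean :: 'a topology)"
proof -
  obtain Y :: "real topology" and B where Y: "completely_metrizable_space Y" "separable_space Y"
    and hom: "(euclidean :: 'a topology) homeomorphic_space subtopology Y B"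
    using borel_space[where 'a = 'a] by (auto simp: borel_space_topology_def)
  have m: "metrizable_space Y"
    using Y(1) by (rule completely_metrizable_imp_metrizable_space)
  then show "metrizable_space (euclidean :: 'a topology)"
    using hom homeomorphic_metrizable_space metrizable_space_subtopology by blast
  show "second_countable (euclidean :: 'a topology)"
    using hom separable_metrizable_imp_second_countable[OF m Y(2)]
      homeomorphic_space_second_countability second_countable_subtopology by blast
qed

instance borel_space \<subseteq> second_countable_topology
proof
  obtain \<B> :: "'a set set" where \<B>: "countable \<B>" "\<And>V. V \<in> \<B> \<Longrightarrow> open V"
    "\<And>U x. open U \<Longrightarrow> x \<in> U \<Longrightarrow> \<exists>V\<in>\<B>. x \<in> V \<and> V \<subseteq> U"
    using borel_space_metrizable_second_countable(2)[where 'a = 'a]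
    by (auto simp: second_countable_def)
  then have "topological_basis \<B>"
    by (metis topological_basisI)
  then show "\<exists>B :: 'a set set. countable B \<and> open = generate_topology B"
    using \<B>(1) topological_basis_imp_subbasis by blast
qed

instance borel_space \<subseteq> t2_space
proof
  fix x y :: 'a assume "x \<noteq> y"
  then show "\<exists>U V. open U \<and> open V \<and> x \<in> U \<and> y \<in> V \<and> U \<inter> V = {}"
    using metrizable_imp_Hausdorff_space[OF borel_space_metrizable_second_countable(1)]
    unfolding Hausdorff_space_def disjnt_def by auto
qed

definition analytic_set :: "'a::topological_space set \<Rightarrow> bool" where
  "analytic_set A \<longleftrightarrow> A = {} \<or> (\<exists>f :: (nat \<Rightarrow> nat) \<Rightarrow> 'a. continuous_on UNIV f \<and> range f = A)"

definition univ_completion :: "'a measure \<Rightarrow> 'a measure" where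
  "univ_completion M =
     sigma (space M) (\<Inter>\<mu>\<in>{\<mu>. sets \<mu> = sets M \<and> finite_measure \<mu>}. sets (completion \<mu>))"

definition cdt_MP ::
  "('x::borel_space \<times> 'u::borel_space) set \<Rightarrow> ('x \<times> 'u \<Rightarrow> 'x measure) \<Rightarrow> bool" where
  "cdt_MP K T \<longleftrightarrow>
     analytic_set K \<and> (\<forall>x. \<exists>u. (x, u) \<in> K) \<and> T \<in> borel \<rightarrow>\<^sub>M prob_algebra borel"

type_synonym ('x, 'u) history = "(nat \<Rightarrow> 'x \<times> 'u) \<times> 'x"
type_synonym ('x, 'u) policy = "nat \<Rightarrow> ('x, 'u) history \<Rightarrow> 'u measure"

definition history_space :: "nat \<Rightarrow> ('x::borel_space, 'u::borel_space) history measure" where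
  "history_space n = (\<Pi>\<^sub>M i\<in>{..<n}. borel) \<Otimes>\<^sub>M borel"

definition path_space :: "(nat \<Rightarrow> 'x::borel_space \<times> 'u::borel_space) measure" where
  "path_space = (\<Pi>\<^sub>M i\<in>UNIV. borel)"

definition history :: "nat \<Rightarrow> (nat \<Rightarrow> 'x \<times> 'u) \<Rightarrow> ('x, 'u) history" where
  "history n \<omega> = (restrict \<omega> {..<n}, fst (\<omega> n))"

text \<open>The sections of \<open>K\<close> are analytic and need not be Borel, so the Borel measures
  \<open>\<pi> n h\<close> are evaluated on them through their completions (likewise the integrals of
  semi-analytic and of universally measurable functions below).\<close>

definition policies ::
  "('x::borel_space \<times> 'u::borel_space) set \<Rightarrow> ('x, 'u) policy set" where
  "policies K = {\<pi>. \<forall>n. \<pi> n \<in> univ_completion (history_space n) \<rightarrow>\<^sub>M prob_algebra borel \<and>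
     (\<forall>h\<in>space (history_space n). emeasure (completion (\<pi> n h)) {u. (snd h, u) \<in> K} = 1)}"

definition path_law ::
  "('x::borel_space \<times> 'u::borel_space \<Rightarrow> 'x measure) \<Rightarrow> ('x, 'u) policy \<Rightarrow> 'x \<Rightarrow>
    (nat \<Rightarrow> 'x \<times> 'u) measure \<Rightarrow> bool" where
  "path_law T \<pi> x P \<longleftrightarrow>
     prob_space P \<and> sets P = sets path_space \<and>
     (AE \<omega> in P. fst (\<omega> 0) = x) \<and>
     (\<forall>n. \<forall>A\<in>sets (history_space n). \<forall>B\<in>sets borel.
        emeasure P {\<omega>. history n \<omega> \<in> A \<and> snd (\<omega> n) \<in> B} =
        (\<integral>\<^sup>+\<omega>. indicator A (history n \<omega>) * emeasure (\<pi> n (history n \<omega>)) B \<partial>completion P)) \<and>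
     (\<forall>n. \<forall>A\<in>sets (history_space n \<Otimes>\<^sub>M borel). \<forall>B\<in>sets borel.
        emeasure P {\<omega>. (history n \<omega>, snd (\<omega> n)) \<in> A \<and> fst (\<omega> (Suc n)) \<in> B} =
        (\<integral>\<^sup>+\<omega>. indicator A (history n \<omega>, snd (\<omega> n)) * emeasure (T (\<omega> n)) B \<partial>P))"

definition path_measure ::
  "('x::borel_space \<times> 'u::borel_space \<Rightarrow> 'x measure) \<Rightarrow> ('x, 'u) policy \<Rightarrow> 'x \<Rightarrow>
    (nat \<Rightarrow> 'x \<times> 'u) measure" where
  "path_measure T \<pi> x = (THE P. path_law T \<pi> x P)"

definition max_prob ::
  "('x::borel_space \<times> 'u::borel_space) set \<Rightarrow> ('x \<times> 'u \<Rightarrow> 'x measure) \<Rightarrow> 'x \<Rightarrow>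
    (nat \<Rightarrow> 'x \<times> 'u) set \<Rightarrow> real" where
  "max_prob K T x A = (SUP \<pi>\<in>policies K. measure (path_measure T \<pi> x) A)"

definition min_prob ::
  "('x::borel_space \<times> 'u::borel_space) set \<Rightarrow> ('x \<times> 'u \<Rightarrow> 'x measure) \<Rightarrow> 'x \<Rightarrow>
    (nat \<Rightarrow> 'x \<times> 'u) set \<Rightarrow> real" where
  "min_prob K T x A = (INF \<pi>\<in>policies K. measure (path_measure T \<pi> x) A)"

definition event_until :: "'x set \<Rightarrow> enat \<Rightarrow> 'x set \<Rightarrow> (nat \<Rightarrow> 'x \<times> 'u) set" where
  "event_until S n G = {\<omega>. \<exists>i. enat i \<le> n \<and> fst (\<omega> i) \<in> G \<and> (\<forall>j<i. fst (\<omega> j) \<in> S)}"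

definition event_always :: "enat \<Rightarrow> 'x set \<Rightarrow> (nat \<Rightarrow> 'x \<times> 'u) set" where
  "event_always n S = {\<omega>. \<forall>k. enat k \<le> n \<longrightarrow> fst (\<omega> k) \<in> S}"

text \<open>A function on \<open>S\<close> is represented by its extensional extension (\<open>undefined\<close> off \<open>S\<close>).\<close>

definition W_up ::
  "('x::borel_space \<times> 'u::borel_space) set \<Rightarrow> ('x \<times> 'u \<Rightarrow> 'x measure) \<Rightarrow> 'x set \<Rightarrow>
    'x set \<Rightarrow> enat \<Rightarrow> 'x \<Rightarrow> real" where
  "W_up K T S G n = (\<lambda>x\<in>S. max_prob K T x (event_until S n G))"

definition W_low ::
  "('x::borel_space \<times> 'u::borel_space) set \<Rightarrow> ('x \<times> 'u \<Rightarrow> 'x measure) \<Rightarrow> 'x set \<Rightarrow>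
    'x set \<Rightarrow> enat \<Rightarrow> 'x \<Rightarrow> real" where
  "W_low K T S G n = (\<lambda>x\<in>S. min_prob K T x (event_until S n G))"

definition V_up ::
  "('x::borel_space \<times> 'u::borel_space) set \<Rightarrow> ('x \<times> 'u \<Rightarrow> 'x measure) \<Rightarrow> 'x set \<Rightarrow>
    enat \<Rightarrow> 'x \<Rightarrow> real" where
  "V_up K T S n = (\<lambda>x\<in>S. max_prob K T x (event_always n S))"

definition V_low ::
  "('x::borel_space \<times> 'u::borel_space) set \<Rightarrow> ('x \<times> 'u \<Rightarrow> 'x measure) \<Rightarrow> 'x set \<Rightarrow>
    enat \<Rightarrow> 'x \<Rightarrow> real" where
  "V_low K T S n = (\<lambda>x\<in>S. min_prob K T x (event_always n S))"

definition beta ::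
  "('x::borel_space \<times> 'u::borel_space) set \<Rightarrow> ('x \<times> 'u \<Rightarrow> 'x measure) \<Rightarrow> 'x set \<Rightarrow> nat \<Rightarrow> real" where
  "beta K T S n = (SUP x. max_prob K T x (event_always (enat n) S))"

definition contraction_index ::
  "('x::borel_space \<times> 'u::borel_space) set \<Rightarrow> ('x \<times> 'u \<Rightarrow> 'x measure) \<Rightarrow> 'x set \<Rightarrow> enat" where
  "contraction_index K T S = Inf {enat n |n. beta K T S n < 1}"

definition bA_low :: "'x::borel_space set \<Rightarrow> ('x \<Rightarrow> real) set" where
  "bA_low S = {f \<in> extensional S. bounded (f ` S) \<and> (\<forall>c. analytic_set {x \<in> S. f x < c})}"

definition bA_up :: "'x::borel_space set \<Rightarrow> ('x \<Rightarrow> real) set" where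
  "bA_up S = {f \<in> extensional S. (\<lambda>x\<in>S. - f x) \<in> bA_low S}"

text \<open>The supremum over the empty set is read as \<open>0\<close>.\<close>

definition sup_dist :: "'x set \<Rightarrow> ('x \<Rightarrow> real) \<Rightarrow> ('x \<Rightarrow> real) \<Rightarrow> real" where
  "sup_dist S f g = (if S = {} then 0 else (SUP x\<in>S. \<bar>f x - g x\<bar>))"

definition contraction_on :: "('x \<Rightarrow> real) set \<Rightarrow> 'x set \<Rightarrow> real \<Rightarrow>
    (('x \<Rightarrow> real) \<Rightarrow> ('x \<Rightarrow> real)) \<Rightarrow> bool" where
  "contraction_on A S \<beta> F \<longleftrightarrow> 0 \<le> \<beta> \<and> \<beta> < 1 \<and> F \<in> A \<rightarrow> A \<and>
     (\<forall>f\<in>A. \<forall>g\<in>A. sup_dist S (F f) (F g) \<le> \<beta> * sup_dist S f g)"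

definition T_int :: "('x \<times> 'u \<Rightarrow> 'x measure) \<Rightarrow> 'x set \<Rightarrow> 'u \<Rightarrow> ('x \<Rightarrow> real) \<Rightarrow> 'x \<Rightarrow> real" where
  "T_int T S u f x = (LINT y:S|completion (T (x, u)). f y)"

definition T_up :: "('x \<times> 'u) set \<Rightarrow> ('x \<times> 'u \<Rightarrow> 'x measure) \<Rightarrow> 'x set \<Rightarrow>
    ('x \<Rightarrow> real) \<Rightarrow> 'x \<Rightarrow> real" where
  "T_up K T S f = (\<lambda>x\<in>S. SUP u\<in>{u. (x, u) \<in> K}. T_int T S u f x)"

definition T_low :: "('x \<times> 'u) set \<Rightarrow> ('x \<times> 'u \<Rightarrow> 'x measure) \<Rightarrow> 'x set \<Rightarrow>
    ('x \<Rightarrow> real) \<Rightarrow> 'x \<Rightarrow> real" where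
  "T_low K T S f = (\<lambda>x\<in>S. INF u\<in>{u. (x, u) \<in> K}. T_int T S u f x)"

definition R_up :: "('x \<times> 'u) set \<Rightarrow> ('x \<times> 'u \<Rightarrow> 'x measure) \<Rightarrow> 'x set \<Rightarrow> 'x set \<Rightarrow>
    ('x \<Rightarrow> real) \<Rightarrow> 'x \<Rightarrow> real" where
  "R_up K T S G f = (\<lambda>x\<in>S. SUP u\<in>{u. (x, u) \<in> K}. measure (T (x, u)) G + T_int T S u f x)"

definition R_low :: "('x \<times> 'u) set \<Rightarrow> ('x \<times> 'u \<Rightarrow> 'x measure) \<Rightarrow> 'x set \<Rightarrow> 'x set \<Rightarrow>
    ('x \<Rightarrow> real) \<Rightarrow> 'x \<Rightarrow> real" where
  "R_low K T S G f = (\<lambda>x\<in>S. INF u\<in>{u. (x, u) \<in> K}. measure (T (x, u)) G + T_int T S u f x)"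

end

theory Submission
  imports Defs
begin

text \<open>
  All four operators are instances, up to the sign change \<open>f \<mapsto> - f\<close>, of
  \<open>L f x = sup\<^sub>u (c (x, u) + \<integral>\<^sub>S f dT (x, u))\<close> on the bounded upper semi-analytic functions.
  Since \<open>f \<le> g + r\<close> implies \<open>L f \<le> L g + r * T\<^sup>* 1\<close>, iteration gives
  \<open>\<bar>L\<^sup>m f - L\<^sup>m g\<bar> \<le> \<rho> f g * (T\<^sup>*)\<^sup>m 1\<close>. The function \<open>(T\<^sup>*)\<^sup>m 1\<close> is the maximal probability of
  staying in \<open>S\<close> for \<open>m\<close> steps: it bounds that probability for every policy, because the control
  at each step can only do worse than the supremum, and it is attained up to \<open>\<epsilon>\<close> by a Markov
  policy made of universally measurable \<open>\<epsilon>\<close>-optimal selectors. Hence it is at most \<open>\<beta>\<close>, and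
  \<open>(T\<^sup>*)\<^sup>m\<^sup>n 1 \<le> \<beta>\<^sup>n\<close>. For each policy, the events of reaching \<open>G\<close> with and without the horizon
  \<open>mn\<close> differ by paths that stay in \<open>S\<close> for \<open>mn\<close> steps, which gives the bounds for \<open>W\<close> and \<open>w\<close>
  without the dynamic programming equation.

  That \<open>L\<close> preserves semi-analyticity rests on Choquet's argument: for a continuous \<open>f\<close> on the
  Baire space, \<open>\<mu> (range f) > c\<close> holds iff, for some \<open>q > c\<close> and some \<open>\<sigma>\<close>, all the closed sets
  \<open>closure (f ` {\<tau>. \<forall>i<k. \<tau> i \<le> \<sigma> i})\<close> have measure at least \<open>q\<close>. For \<open>\<mu> = T (x, u)\<close> this is a
  Souslin operation on Borel sets of pairs \<open>(x, u)\<close>. The path law of a universally measurable policy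
  comes from the Ionescu-Tulcea theorem for Borel kernels, which agree with the policy almost surely
  with respect to the law of the history and are chosen one time step after the other.
\<close>

section \<open>Analytic sets\<close>

text \<open>Two descriptions of staying in \<open>S\<close> have to meet: \<open>\<beta>\<close> is
  a supremum over policies and path measures, whereas the operators see one transition at a time.
  The contraction needs \<open>stay m \<le> \<beta>\<close>, that is, the existence of near-optimal
  policies; the bounds for the value functions need the opposite inequality for every policy. The
  recurring remedy is to fix the law at hand and to pass to a Borel version outside a null set. The
  case \<open>m = 0\<close> is not separated: it occurs only for empty \<open>S\<close>, where all
  distances are \<open>0\<close>. A Borel space comes with no more than a homeomorphism to a Borel
  subset of a Polish topology carried by some set of reals. Therefore analytic sets are first
  studied for topologies as values and then transferred to the type.\<close>

definition analytic_in :: "'a topology \<Rightarrow> 'a set \<Rightarrow> bool" where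
  "analytic_in X A \<longleftrightarrow>
     A = {} \<or> (\<exists>f :: (nat \<Rightarrow> nat) \<Rightarrow> 'a. continuous_map euclidean X f \<and> range f = A)"

lemma analytic_set_iff_analytic_in: "analytic_set A \<longleftrightarrow> analytic_in euclidean A"
  by (auto simp: analytic_set_def analytic_in_def)

lemma analytic_inI:
  fixes f :: "(nat \<Rightarrow> nat) \<Rightarrow> 'a"
  shows "continuous_map euclidean X f \<Longrightarrow> range f = A \<Longrightarrow> analytic_in X A"
  by (auto simp: analytic_in_def)

lemma analytic_in_empty [simp]: "analytic_in X {}"
  by (simp add: analytic_in_def)

lemma analytic_in_continuous_image:
  assumes "analytic_in X A" "continuous_map X Y g"
  shows "analytic_in Y (g ` A)"
  using assms continuous_map_compose[of euclidean X _ Y g]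
  unfolding analytic_in_def by (metis image_comp image_is_empty)

lemma analytic_in_subtopology: "analytic_in (subtopology X C) A \<Longrightarrow> analytic_in X A"
  by (auto simp: analytic_in_def continuous_map_in_subtopology)

lemma continuous_on_reindex:
  "continuous_on UNIV (\<lambda>\<tau> :: 'i \<Rightarrow> 'a::topological_space. \<lambda>j. \<tau> (h j))"
  by (intro continuous_on_coordinatewise_then_product continuous_on_product_coordinates)

lemma open_coordinate_eq: "open {\<tau> :: 'i \<Rightarrow> 'a::discrete_topology. \<tau> i = a}"
proof -
  have "open ((\<lambda>\<tau> :: 'i \<Rightarrow> 'a. \<tau> i) -` {a})"
    by (rule open_vimage) (simp_all add: discrete_topology_class.open_discrete)
  then show ?thesis by (simp add: vimage_def)
qed

text \<open>Cylinders are indexed by lists, of which there are countably many over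
  \<open>nat\<close>. A list of the wrong length describes the empty cylinder.\<close>

lemma open_prefix: "open {\<sigma> :: nat \<Rightarrow> 'a::discrete_topology. map \<sigma> [0..<k] = s}"
proof (cases "length s = k")
  case True
  then have "{\<sigma>. map \<sigma> [0..<k] = s} = (\<Inter>i\<in>{..<k}. {\<sigma>. \<sigma> i = s ! i})"
    by (auto simp: list_eq_iff_nth_eq)
  moreover have "open (\<Inter>i\<in>{..<k}. {\<sigma> :: nat \<Rightarrow> 'a. \<sigma> i = s ! i})"
    using open_coordinate_eq by (intro open_INT) auto
  ultimately show ?thesis by simp
next
  case False
  then have "{\<sigma>. map \<sigma> [0..<k] = s} = {}" by auto
  then show ?thesis by simp
qed

lemma analytic_in_UN:
  fixes A :: "'i \<Rightarrow> 'a set"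
  assumes "countable I" "\<And>i. i \<in> I \<Longrightarrow> analytic_in X (A i)"
  shows "analytic_in X (\<Union>i\<in>I. A i)"
proof -
  \<comment> \<open>Only nonempty members are ranges of maps on the Baire space. The first
    coordinate of \<open>\<tau>\<close> then selects the member and the others the point in
    it.\<close>
  define J where "J = {i \<in> I. A i \<noteq> {}}"
  have J: "(\<Union>i\<in>I. A i) = (\<Union>i\<in>J. A i)" "countable J"
    using assms(1) by (auto simp: J_def)
  show ?thesis
  proof (cases "J = {}")
    case True
    then show ?thesis by (simp add: J)
  next
    case False
    define e where "e = from_nat_into J"
    have e: "range e = J" unfolding e_def using False J(2) by (rule range_from_nat_into)
    have "\<exists>f :: (nat \<Rightarrow> nat) \<Rightarrow> 'a. continuous_map euclidean X f \<and> range f = A i" if "i \<in> J" for i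
      using that assms(2)[of i] by (auto simp: J_def analytic_in_def)
    then obtain f :: "'i \<Rightarrow> (nat \<Rightarrow> nat) \<Rightarrow> 'a"
      where f: "continuous_map euclidean X (f i)" "range (f i) = A i" if "i \<in> J" for i
      by metis
    define g where "g \<tau> = f (e (\<tau> 0)) (\<lambda>n. \<tau> (Suc n))" for \<tau>
    have eJ: "e n \<in> J" for n using e by auto
    have "open {\<tau>. g \<tau> \<in> U}" if U: "openin X U" for U
    proof -
      have "{\<tau>. g \<tau> \<in> U} =
          (\<Union>n. {\<tau>. \<tau> 0 = n} \<inter> (\<lambda>\<tau> k. \<tau> (Suc k)) -` {\<tau>. f (e n) \<tau> \<in> U})"
        by (auto simp: g_def)
      moreover have "open {\<tau>. f (e n) \<tau> \<in> U}" for n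
        using f(1)[OF eJ] U by (auto simp: continuous_map_def)
      ultimately show ?thesis
        using open_vimage[OF _ continuous_on_reindex[of Suc]]
        by (simp only:) (intro open_UN open_Int open_coordinate_eq ballI, blast)
    qed
    moreover have "g \<tau> \<in> topspace X" for \<tau>
      using f(1)[OF eJ] by (auto simp: continuous_map_def g_def)
    ultimately have "continuous_map euclidean X g"
      by (auto simp: continuous_map_def)
    moreover have "range g = (\<Union>i\<in>J. A i)"
    proof
      show "range g \<subseteq> (\<Union>i\<in>J. A i)"
        using f(2) eJ by (fastforce simp: g_def)
      show "(\<Union>i\<in>J. A i) \<subseteq> range g"
      proof
        fix x assume "x \<in> (\<Union>i\<in>J. A i)"
        then obtain n where "x \<in> A (e n)" using e by force
        then obtain \<tau> where "x = f (e n) \<tau>" using f(2)[OF eJ, of n] by auto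
        then have "x = g (case_nat n \<tau>)" by (simp add: g_def)
        then show "x \<in> range g" by blast
      qed
    qed
    ultimately show ?thesis
      unfolding J(1) by (rule analytic_inI)
  qed
qed

text \<open>The points of a dense sequence \<open>c\<close> steer a sequence towards the limit: the step from
  \<open>x\<^sub>k\<close> to \<open>c (\<tau> (k+1))\<close> is taken only if it is shorter than \<open>2^-k\<close>.\<close>

lemma analytic_in_topspace_polish:
  assumes "completely_metrizable_space Z" "separable_space Z"
  shows "analytic_in Z (topspace Z)"
proof (cases "topspace Z = {}")
  case False
  obtain M d where "Metric_space M d" and compl: "Metric_space.mcomplete M d"
    and Z: "Z = Metric_space.mtopology M d"
    using assms(1) by (auto simp: completely_metrizable_space_def)
  interpret Metric_space M d by fact
  obtain C where C: "countable C" "C \<subseteq> M" "mtopology closure_of C = M"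
    using assms(2) by (auto simp: separable_space_def Z)
  have "C \<noteq> {}" using C False Z by auto
  define c where "c = from_nat_into C"
  have c: "range c = C" unfolding c_def using \<open>C \<noteq> {}\<close> C(1) by (rule range_from_nat_into)
  have cM: "c n \<in> M" for n using c C(2) by auto
  define x :: "(nat \<Rightarrow> nat) \<Rightarrow> nat \<Rightarrow> 'a" where
    "x \<tau> = rec_nat (c (\<tau> 0)) (\<lambda>k y. if d (c (\<tau> (Suc k))) y < (1/2)^k then c (\<tau> (Suc k)) else y)" for \<tau>
  have x0: "x \<tau> 0 = c (\<tau> 0)" for \<tau> by (simp add: x_def)
  have xS: "x \<tau> (Suc k) = (if d (c (\<tau> (Suc k))) (x \<tau> k) < (1/2)^k then c (\<tau> (Suc k)) else x \<tau> k)" for \<tau> k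
    by (simp add: x_def)
  have xM: "x \<tau> k \<in> M" for \<tau> k
    by (induction k) (auto simp: x0 xS cM)
  have step: "d (x \<tau> k) (x \<tau> (Suc k)) \<le> (1/2)^k" for \<tau> k
    using cM xM by (auto simp: xS commute)
  \<comment> \<open>The exact geometric sum, rather than the bound \<open>2 * (1/2)^k\<close>, makes
    the induction on \<open>l\<close> close.\<close>
  have dist: "d (x \<tau> k) (x \<tau> (k + l)) \<le> 2 * (1/2)^k - 2 * (1/2)^(k + l)" for \<tau> k l
  proof (induction l)
    case (Suc l)
    have "d (x \<tau> k) (x \<tau> (k + Suc l)) \<le> d (x \<tau> k) (x \<tau> (k + l)) + d (x \<tau> (k + l)) (x \<tau> (Suc (k + l)))"
      using triangle xM by simp
    also have "\<dots> \<le> 2 * (1/2)^k - 2 * (1/2)^(k + l) + (1/2)^(k + l)"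
      using add_mono[OF Suc step] .
    finally show ?case by simp
  qed (simp add: xM)
  have dist_le: "d (x \<tau> k) (x \<tau> l) \<le> 2 * (1/2)^k" if kl: "k \<le> l" for \<tau> k l
  proof -
    obtain n where n: "l = k + n" using le_Suc_ex[OF kl] by blast
    have "0 \<le> (1/2 :: real)^(k + n)" by simp
    then show ?thesis using dist[of \<tau> k n] unfolding n by linarith
  qed
  have small: "\<exists>k. 4 * (1/2)^k < (e::real)" if e: "e > 0" for e
  proof -
    have "\<exists>k. (1/2)^k < e / 4" by (rule real_arch_pow_inv) (use e in simp_all)
    then obtain k where "(1/2)^k < e / 4" ..
    then have "4 * (1/2)^k < e" by linarith
    then show ?thesis ..
  qed
  \<comment> \<open>The \<open>k\<close>-th point depends on finitely many coordinates, hence is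
    locally constant in \<open>\<tau>\<close>; continuity of the limit comes from uniform
    convergence.\<close>
  have x_cong: "x \<tau> k = x \<tau>' k" if "\<forall>i\<le>k. \<tau> i = \<tau>' i" for \<tau> \<tau>' k
    using that by (induction k) (auto simp: x0 xS)
  have x_cont: "continuous_map euclidean mtopology (\<lambda>\<tau>. x \<tau> k)" for k
  proof -
    have "open {\<tau>. x \<tau> k \<in> U}" for U
    proof (subst open_subopen, intro ballI)
      fix \<tau> assume \<tau>: "\<tau> \<in> {\<tau>. x \<tau> k \<in> U}"
      have "{\<tau>'. map \<tau>' [0..<Suc k] = map \<tau> [0..<Suc k]} \<subseteq> {\<tau>. x \<tau> k \<in> U}"
      proof
        fix \<tau>' assume "\<tau>' \<in> {\<tau>'. map \<tau>' [0..<Suc k] = map \<tau> [0..<Suc k]}"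
        then have "x \<tau>' k = x \<tau> k"
          by (intro x_cong) (simp add: less_Suc_eq_le del: upt_Suc)
        with \<tau> show "\<tau>' \<in> {\<tau>. x \<tau> k \<in> U}" by simp
      qed
      then show "\<exists>W. open W \<and> \<tau> \<in> W \<and> W \<subseteq> {\<tau>. x \<tau> k \<in> U}"
        using open_prefix by blast
    qed
    then show ?thesis using xM by (simp add: continuous_map_def)
  qed
  obtain f where f_cont: "continuous_map euclidean mtopology f"
    and f_lim: "\<And>e. 0 < e \<Longrightarrow> \<forall>\<^sub>F n in sequentially. \<forall>\<tau>\<in>topspace euclidean. d (x \<tau> n) (f \<tau>) < e"
  proof (rule continuous_map_uniformly_Cauchy_limit[OF compl, of euclidean "\<lambda>n \<tau>. x \<tau> n"])
    show "\<forall>\<^sub>F n in sequentially. continuous_map euclidean mtopology (\<lambda>\<tau>. x \<tau> n)" by (simp add: x_cont)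
    fix e :: real assume "e > 0"
    then obtain k where k: "4 * (1/2)^k < e" using small by blast
    have "d (x \<tau> n) (x \<tau> n') < e" if "k \<le> n" "k \<le> n'" for n n' \<tau>
    proof -
      have "d (x \<tau> n) (x \<tau> n') \<le> d (x \<tau> k) (x \<tau> n) + d (x \<tau> k) (x \<tau> n')"
        using triangle[of "x \<tau> n" "x \<tau> k" "x \<tau> n'"] xM by (simp add: commute)
      also have "\<dots> \<le> 2 * (1/2)^k + 2 * (1/2)^k" using add_mono[OF dist_le[OF that(1)] dist_le[OF that(2)]] .
      finally show ?thesis using k by linarith
    qed
    then show "\<exists>N. \<forall>n n' \<tau>. N \<le> n \<longrightarrow> N \<le> n' \<longrightarrow> \<tau> \<in> topspace euclidean \<longrightarrow> d (x \<tau> n) (x \<tau> n') < e"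
      by blast
  qed (rule that)
  have fM: "f \<tau> \<in> M" for \<tau>
    using continuous_map_image_subset_topspace[OF f_cont] by auto
  have f: "limitin mtopology (x \<tau>) (f \<tau>) sequentially" for \<tau>
    unfolding limitin_metric using fM xM
    by (intro conjI allI impI) (simp, drule f_lim, erule eventually_mono, simp)
  note f_cont
  moreover have "range f = M"
  proof
    show "M \<subseteq> range f"
    proof
      fix y assume y: "y \<in> M"
      \<comment> \<open>Half of the step length as tolerance: consecutive approximations of
        \<open>y\<close> then pass the test in \<open>x\<close>, no step is refused, and
        \<open>x \<tau> k = c (\<tau> k)\<close>.\<close>
      have "\<exists>n. d (c n) y < (1/2)^k / 2" for k
      proof -
        have "y \<in> mtopology closure_of C" using y C(3) by simp
        moreover have "(1/2)^k / 2 > (0::real)" by simp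
        ultimately obtain z where "z \<in> C" "z \<in> mball y ((1/2)^k / 2)"
          unfolding metric_closure_of by blast
        then show ?thesis using c commute by auto
      qed
      then obtain \<tau> where \<tau>: "d (c (\<tau> k)) y < (1/2)^k / 2" for k by metis
      have xc: "x \<tau> k = c (\<tau> k)" for k
      proof (induction k)
        case (Suc k)
        have "d (c (\<tau> (Suc k))) (c (\<tau> k)) \<le> d (c (\<tau> (Suc k))) y + d (c (\<tau> k)) y"
          using triangle[of "c (\<tau> (Suc k))" y "c (\<tau> k)"] cM y by (simp add: commute)
        also have "\<dots> < (1/2)^Suc k / 2 + (1/2)^k / 2" using add_strict_mono[OF \<tau> \<tau>] .
        also have "\<dots> \<le> (1/2)^k" by simp
        finally show ?case using Suc by (simp add: xS)
      qed (simp add: x0)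
      have "limitin mtopology (x \<tau>) y sequentially"
        unfolding limit_metric_sequentially
      proof (intro conjI allI impI)
        fix e :: real assume "e > 0"
        then obtain k where k: "4 * (1/2)^k < e" using small by blast
        have "d (x \<tau> n) y < e" if "k \<le> n" for n
        proof -
          have "d (x \<tau> n) y < (1/2)^n / 2" using \<tau> xc by simp
          also have "\<dots> \<le> (1/2)^n" by simp
          also have "\<dots> \<le> (1/2)^k" using that by (intro power_decreasing) auto
          also have "\<dots> \<le> 4 * (1/2)^k" by simp
          finally show ?thesis using k by linarith
        qed
        then show "\<exists>N. \<forall>n\<ge>N. x \<tau> n \<in> M \<and> d (x \<tau> n) y < e" using xM by blast
      qed (use y in auto)
      then have "f \<tau> = y" using limitin_metric_unique[OF f] by simp
      then show "y \<in> range f" by blast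
    qed
  qed (use fM in auto)
  ultimately show ?thesis unfolding Z topspace_mtopology by (rule analytic_inI)
qed simp

lemma baire_polish:
  "completely_metrizable_space (euclidean :: (nat \<Rightarrow> nat) topology)"
  "second_countable (euclidean :: (nat \<Rightarrow> nat) topology)"
  "Hausdorff_space (euclidean :: (nat \<Rightarrow> nat) topology)"
proof -
  have *: "(euclidean :: nat topology) = discrete_topology UNIV"
    by (rule topology_eq[THEN iffD2]) (auto simp: discrete_topology_class.open_discrete)
  show m: "completely_metrizable_space (euclidean :: (nat \<Rightarrow> nat) topology)"
    unfolding euclidean_product_topology[symmetric] completely_metrizable_space_product_topology *
    by (simp add: completely_metrizable_space_discrete_topology)
  show "Hausdorff_space (euclidean :: (nat \<Rightarrow> nat) topology)"
    using m completely_metrizable_imp_metrizable_space metrizable_imp_Hausdorff_space by blast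
  obtain \<B> :: "(nat \<Rightarrow> nat) set set" where "countable \<B>" "topological_basis \<B>"
    using ex_countable_basis by blast
  then show "second_countable (euclidean :: (nat \<Rightarrow> nat) topology)"
    unfolding second_countable_def topological_basis_def
    by (metis (no_types, lifting) \<open>topological_basis \<B>\<close> open_openin topological_basisE)
qed

lemma analytic_in_polish_subset:
  assumes "completely_metrizable_space Z" "second_countable Z" "closedin Z C \<or> openin Z C"
  shows "analytic_in Z C"
proof (rule analytic_in_subtopology)
  have "completely_metrizable_space (subtopology Z C)" "separable_space (subtopology Z C)"
    using assms completely_metrizable_space_closedin completely_metrizable_space_openin
      second_countable_imp_separable_space second_countable_subtopology by blast+
  moreover have "topspace (subtopology Z C) = C"
    using assms(3) closedin_subset openin_subset by fastforce
  ultimately show "analytic_in (subtopology Z C) C"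
    using analytic_in_topspace_polish by metis
qed

lemmas analytic_in_baire = analytic_in_polish_subset[OF baire_polish(1,2)]

text \<open>One sequence \<open>\<tau>\<close> codes a sequence of sequences. Demanding that all
  \<open>f n\<close> take the same value on their parts cuts out a set that is closed because
  \<open>X\<close> is Hausdorff, and closed subsets of the Baire space are analytic.\<close>

lemma analytic_in_INT:
  fixes A :: "nat \<Rightarrow> 'a set"
  assumes X: "Hausdorff_space X" and A: "\<And>n. analytic_in X (A n)"
  shows "analytic_in X (\<Inter>n. A n)"
proof (cases "\<exists>n. A n = {}")
  case True
  then have "(\<Inter>n. A n) = {}" by blast
  then show ?thesis by simp
next
  case False
  then have "\<exists>f :: (nat \<Rightarrow> nat) \<Rightarrow> 'a. continuous_map euclidean X f \<and> range f = A n" for n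
    using A by (auto simp: analytic_in_def)
  then obtain f :: "nat \<Rightarrow> (nat \<Rightarrow> nat) \<Rightarrow> 'a"
    where f: "\<And>n. continuous_map euclidean X (f n)" "\<And>n. range (f n) = A n"
    by metis
  define g where "g n \<tau> = f n (\<lambda>k. \<tau> (prod_encode (n, k)))" for n \<tau>
  have g: "continuous_map euclidean X (g n)" for n
  proof -
    have "continuous_map euclidean euclidean (\<lambda>\<tau> :: nat \<Rightarrow> nat. \<lambda>k. \<tau> (prod_encode (n, k)))"
      using continuous_on_reindex by (simp add: continuous_map_iff_continuous2)
    from continuous_map_compose[OF this f(1)[of n]]
    show ?thesis by (simp add: g_def[abs_def] comp_def)
  qed
  define C where "C = (\<Inter>n. {\<tau>. g n \<tau> = g 0 \<tau>})"
  have "closedin euclidean {\<tau> \<in> topspace euclidean. g n \<tau> = g 0 \<tau>}" for n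
    using X g g by (rule closedin_continuous_maps_eq)
  then have "closed C"
    by (auto simp: C_def)
  then have "analytic_in X (g 0 ` C)"
    by (intro analytic_in_continuous_image[OF _ g] analytic_in_baire) simp
  also have "g 0 ` C = (\<Inter>n. A n)"
  proof
    show "g 0 ` C \<subseteq> (\<Inter>n. A n)"
    proof (rule image_subsetI, rule INT_I)
      fix \<tau> n assume "\<tau> \<in> C"
      then have "g n \<tau> = g 0 \<tau>" by (simp add: C_def)
      then show "g 0 \<tau> \<in> A n" unfolding f(2)[symmetric] g_def by (metis rangeI)
    qed
    show "(\<Inter>n. A n) \<subseteq> g 0 ` C"
    proof
      fix x assume "x \<in> (\<Inter>n. A n)"
      then have "x \<in> range (f n)" for n by (simp add: f(2))
      then have "\<exists>\<sigma>. f n \<sigma> = x" for n by (metis rangeE)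
      then obtain \<sigma> where \<sigma>: "\<And>n. f n (\<sigma> n) = x" by metis
      define \<tau> where "\<tau> j = (case prod_decode j of (n, k) \<Rightarrow> \<sigma> n k)" for j
      have "g n \<tau> = x" for n using \<sigma> by (simp add: g_def \<tau>_def)
      then show "x \<in> g 0 ` C" unfolding C_def by (intro image_eqI[of _ _ \<tau>]) auto
    qed
  qed
  finally show ?thesis .
qed

lemma analytic_in_Int:
  assumes "Hausdorff_space X" "analytic_in X A" "analytic_in X B"
  shows "analytic_in X (A \<inter> B)"
proof -
  have "A \<inter> B = (\<Inter>n::nat. if n = 0 then A else B)" by auto
  moreover have "analytic_in X (\<Inter>n::nat. if n = 0 then A else B)"
    using assms by (intro analytic_in_INT) auto
  ultimately show ?thesis by simp
qed

text \<open>Pulling \<open>C\<close> back along a parametrisation of the whole space reduces the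
  claim to open and closed subsets of the Baire space.\<close>

lemma analytic_in_openin_closedin:
  assumes "analytic_in X (topspace X)" "closedin X C \<or> openin X C"
  shows "analytic_in X C"
proof (cases "topspace X = {}")
  case True
  then show ?thesis using assms(2) by (auto dest: closedin_subset openin_subset)
next
  case False
  then obtain f :: "(nat \<Rightarrow> nat) \<Rightarrow> 'a" where f: "continuous_map euclidean X f" "range f = topspace X"
    using assms(1) by (auto simp: analytic_in_def)
  have "C \<subseteq> topspace X" using assms(2) closedin_subset openin_subset by blast
  then have "f ` {\<tau>. f \<tau> \<in> C} = C" using f(2) by auto
  moreover have "closed {\<tau>. f \<tau> \<in> C} \<or> open {\<tau>. f \<tau> \<in> C}"
    using assms(2) closedin_continuous_map_preimage[OF f(1), of C]
      openin_continuous_map_preimage[OF f(1), of C] by fastforce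
  ultimately show ?thesis
    using analytic_in_continuous_image[OF analytic_in_baire f(1)] by fastforce
qed

text \<open>Analytic sets are not closed under complements, so the induction carries
  \<open>B\<close> together with its complement.\<close>

lemma borel_imp_analytic_in:
  assumes X: "Hausdorff_space X" "analytic_in X (topspace X)"
    and B: "B \<in> sigma_sets (topspace X) {U. openin X U}"
  shows "analytic_in X B"
proof -
  have "analytic_in X B \<and> analytic_in X (topspace X - B)"
    using B
  proof (induction rule: sigma_sets.induct)
    case (Basic U)
    then show ?case
      using analytic_in_openin_closedin[OF X(2)] closedin_diff[OF closedin_topspace] by blast
  next
    case (Compl B)
    moreover have "topspace X - (topspace X - B) = B"
      using Compl.hyps sigma_sets_into_sp[of "{U. openin X U}" "topspace X" B] openin_subset by blast
    ultimately show ?case by simp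
  next
    case (Union B)
    have *: "topspace X - (\<Union>n. B n) = (\<Inter>n. topspace X - B n)" by auto
    show ?case unfolding *
      using Union.IH by (intro conjI analytic_in_INT[OF X(1)] analytic_in_UN) auto
  qed (simp add: X)
  then show ?thesis ..
qed

text \<open>The Borel set that represents the type is analytic in its Polish topology, and the
  homeomorphism carries a parametrisation of it over to the type.\<close>

lemma analytic_set_UNIV_borel_space: "analytic_set (UNIV :: 'a::borel_space set)"
proof -
  obtain Y :: "real topology" and B where Y: "completely_metrizable_space Y" "separable_space Y"
    and B: "B \<in> sigma_sets (topspace Y) {V. openin Y V}"
    and hom: "(euclidean :: 'a topology) homeomorphic_space subtopology Y B"
    using borel_space[where 'a = 'a] by (auto simp: borel_space_topology_def)
  have "Hausdorff_space Y"
    using Y(1) by (intro metrizable_imp_Hausdorff_space completely_metrizable_imp_metrizable_space)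
  then have "analytic_in Y B"
    using analytic_in_topspace_polish[OF Y] B by (rule borel_imp_analytic_in)
  moreover have BY: "B \<subseteq> topspace Y"
    using sigma_sets_into_sp[OF _ B] openin_subset[of Y] by auto
  ultimately have "analytic_in (subtopology Y B) B"
    by (auto simp: analytic_in_def continuous_map_in_subtopology)
  moreover obtain h where "homeomorphic_map (subtopology Y B) (euclidean :: 'a topology) h"
    using hom[unfolded homeomorphic_space_sym[of euclidean]] unfolding homeomorphic_space by blast
  then have "continuous_map (subtopology Y B) (euclidean :: 'a topology) h" "h ` B = UNIV"
    using BY homeomorphic_imp_surjective_map[of "subtopology Y B" euclidean h]
    by (auto simp: homeomorphic_imp_continuous_map Int_absorb1)
  ultimately show ?thesis
    unfolding analytic_set_iff_analytic_in using analytic_in_continuous_image by metis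
qed

lemma analytic_in_prod:
  assumes "analytic_in X A" "analytic_in Y B"
  shows "analytic_in (prod_topology X Y) (A \<times> B)"
proof (cases "A = {} \<or> B = {}")
  case False
  then obtain f g :: "(nat \<Rightarrow> nat) \<Rightarrow> _" where f: "continuous_map euclidean X f" "range f = A"
    and g: "continuous_map euclidean Y g" "range g = B"
    using assms unfolding analytic_in_def by metis
  \<comment> \<open>Even and odd coordinates supply the two arguments independently.\<close>
  define h where "h \<tau> = (f (\<lambda>n. \<tau> (2 * n)), g (\<lambda>n. \<tau> (2 * n + 1)))" for \<tau>
  have "continuous_map euclidean euclidean (\<lambda>\<tau> :: nat \<Rightarrow> nat. \<lambda>n. \<tau> (2 * n))"
    "continuous_map euclidean euclidean (\<lambda>\<tau> :: nat \<Rightarrow> nat. \<lambda>n. \<tau> (2 * n + 1))"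
    using continuous_on_reindex by (simp_all add: continuous_map_iff_continuous2)
  from continuous_map_compose[OF this(1) f(1)] continuous_map_compose[OF this(2) g(1)]
  have "continuous_map euclidean (prod_topology X Y) h"
    by (simp add: h_def[abs_def] continuous_map_paired comp_def)
  moreover have "range h = A \<times> B"
  proof
    show "A \<times> B \<subseteq> range h"
    proof safe
      fix a b assume "a \<in> A" "b \<in> B"
      then obtain \<sigma> \<sigma>' where "a = f \<sigma>" "b = g \<sigma>'" using f(2) g(2) by blast
      then have "(a, b) = h (\<lambda>n. if even n then \<sigma> (n div 2) else \<sigma>' (n div 2))"
        by (simp add: h_def)
      then show "(a, b) \<in> range h" by blast
    qed
  qed (use f(2) g(2) in \<open>auto simp: h_def\<close>)
  ultimately show ?thesis by (rule analytic_inI)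
qed auto

section \<open>Capacitability of analytic sets\<close>

lemma Hausdorff_space_euclidean_t2: "Hausdorff_space (euclidean :: 'a::t2_space topology)"
  using hausdorff unfolding Hausdorff_space_def disjnt_def by (metis open_openin)

lemma analytic_set_image:
  "analytic_set A \<Longrightarrow> continuous_on UNIV g \<Longrightarrow> analytic_set (g ` A)"
  unfolding analytic_set_iff_analytic_in
  by (erule analytic_in_continuous_image) (simp add: continuous_map_iff_continuous2)

lemma analytic_set_UN:
  "countable I \<Longrightarrow> (\<And>i. i \<in> I \<Longrightarrow> analytic_set (A i)) \<Longrightarrow> analytic_set (\<Union>i\<in>I. A i)"
  unfolding analytic_set_iff_analytic_in by (rule analytic_in_UN)

lemma analytic_set_Int:
  fixes A :: "'a::t2_space set"
  shows "analytic_set A \<Longrightarrow> analytic_set B \<Longrightarrow> analytic_set (A \<inter> B)"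
  unfolding analytic_set_iff_analytic_in by (rule analytic_in_Int[OF Hausdorff_space_euclidean_t2])

lemma borel_imp_analytic_set:
  fixes B :: "'a::t2_space set"
  assumes "analytic_set (UNIV :: 'a set)" "B \<in> sets borel"
  shows "analytic_set B"
  using assms borel_imp_analytic_in[OF Hausdorff_space_euclidean_t2, of B]
  by (simp add: analytic_set_iff_analytic_in borel_def)

lemma analytic_set_Times: "analytic_set A \<Longrightarrow> analytic_set B \<Longrightarrow> analytic_set (A \<times> B)"
  unfolding analytic_set_iff_analytic_in prod_topology_euclidean[symmetric] by (rule analytic_in_prod)

lemma analytic_set_UNIV_prod: "analytic_set (UNIV :: ('a::borel_space \<times> 'b::borel_space) set)"
  using analytic_set_Times[OF analytic_set_UNIV_borel_space analytic_set_UNIV_borel_space] by simp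

text \<open>The quantifier over \<open>\<sigma>\<close> is a projection along the Baire space. For
  each \<open>k\<close> the condition is a countable union of rectangles, one per list, so the
  projected set is a countable intersection of analytic sets.\<close>

lemma analytic_set_souslin:
  fixes B :: "nat list \<Rightarrow> 'a::t2_space set"
  assumes B: "\<And>s. analytic_set (B s)"
  shows "analytic_set {x. \<exists>\<sigma>. \<forall>k. x \<in> B (map \<sigma> [0..<k])}"
proof -
  let ?Z = "prod_topology (euclidean :: 'a topology) (euclidean :: (nat \<Rightarrow> nat) topology)"
  define E where "E k = (\<Union>s. B s \<times> {\<sigma>. map \<sigma> [0..<k] = s})" for k
  have "analytic_in ?Z (E k)" for k
    unfolding E_def using B open_prefix
    by (intro analytic_in_UN analytic_in_prod analytic_in_baire)
      (auto simp: analytic_set_iff_analytic_in)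
  then have "analytic_in ?Z (\<Inter>k. E k)"
    by (intro analytic_in_INT)
      (simp_all only: Hausdorff_space_prod_topology Hausdorff_space_euclidean_t2 baire_polish simp_thms)
  then have "analytic_set (fst ` (\<Inter>k. E k))"
    unfolding analytic_set_iff_analytic_in
    by (rule analytic_in_continuous_image) (rule continuous_map_fst)
  also have "fst ` (\<Inter>k. E k) = {x. \<exists>\<sigma>. \<forall>k. x \<in> B (map \<sigma> [0..<k])}"
    by (force simp: E_def image_iff)
  finally show ?thesis .
qed

text \<open>Upper bounds instead of equal prefixes: the sets grow with each bound, and their
  intersection along \<open>\<sigma>\<close> is compact. Lists as indices turn them into a Souslin
  scheme.\<close>

definition bounded_by :: "nat list \<Rightarrow> (nat \<Rightarrow> nat) set" where
  "bounded_by s = {\<tau>. \<forall>i<length s. \<tau> i \<le> s ! i}"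

lemma bounded_by_prefix: "bounded_by (map \<sigma> [0..<k]) = {\<tau>. \<forall>i<k. \<tau> i \<le> \<sigma> i}"
  by (auto simp: bounded_by_def)

lemma compact_box: "compact {\<tau> :: nat \<Rightarrow> nat. \<forall>i. \<tau> i \<le> \<sigma> i}"
proof -
  have "compactin (product_topology (\<lambda>_. euclidean) UNIV) (\<Pi>\<^sub>E i\<in>UNIV. {..\<sigma> i})"
    by (simp add: compactin_PiE finite_imp_compact)
  moreover have "(\<Pi>\<^sub>E i\<in>UNIV. {..\<sigma> i}) = {\<tau>. \<forall>i. \<tau> i \<le> \<sigma> i}" by (auto simp: PiE_iff)
  ultimately show ?thesis by (simp add: euclidean_product_topology)
qed

lemma open_contains_prefix:
  fixes W :: "(nat \<Rightarrow> 'a::topological_space) set"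
  assumes "open W" "\<tau> \<in> W"
  shows "\<exists>k. \<forall>\<tau>'. (\<forall>i<k. \<tau>' i = \<tau> i) \<longrightarrow> \<tau>' \<in> W"
proof -
  have "openin (product_topology (\<lambda>_. euclidean) UNIV) W"
    using assms by (simp add: euclidean_product_topology)
  from product_topology_open_contains_basis[OF this \<open>\<tau> \<in> W\<close>]
  obtain V where V: "\<tau> \<in> (\<Pi>\<^sub>E i\<in>UNIV. V i)" "finite {i. V i \<noteq> UNIV}" "(\<Pi>\<^sub>E i\<in>UNIV. V i) \<subseteq> W"
    by auto
  obtain k where k: "\<forall>i\<in>{i. V i \<noteq> UNIV}. i < k"
    using finite_nat_set_iff_bounded[THEN iffD1, OF V(2)] by blast
  have "\<tau>' \<in> W" if "\<forall>i<k. \<tau>' i = \<tau> i" for \<tau>'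
  proof -
    have "\<tau>' i \<in> V i" for i
      using that k V(1) by (cases "V i = UNIV") (auto simp: PiE_iff)
    then show ?thesis using V(3) by (auto simp: PiE_iff)
  qed
  then show ?thesis by blast
qed

text \<open>The box below \<open>\<sigma>\<close> is compact, so a point outside its image is
  separated from the image by open sets, and this already happens at a finite stage. Hence taking
  closures makes the sets Borel without leaving the range of \<open>f\<close> in the limit.\<close>

lemma INT_closure_image_bounded_by:
  fixes f :: "(nat \<Rightarrow> nat) \<Rightarrow> 'a::t2_space"
  assumes f: "continuous_on UNIV f"
  shows "(\<Inter>k. closure (f ` bounded_by (map \<sigma> [0..<k]))) \<subseteq> f ` {\<tau>. \<forall>i. \<tau> i \<le> \<sigma> i}"
proof
  let ?N = "{\<tau>. \<forall>i. \<tau> i \<le> \<sigma> i}"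
  fix y assume y: "y \<in> (\<Inter>k. closure (f ` bounded_by (map \<sigma> [0..<k])))"
  show "y \<in> f ` ?N"
  proof (rule ccontr)
    assume ny: "y \<notin> f ` ?N"
    have "compact (f ` ?N)"
      using f compact_box by (intro compact_continuous_image continuous_on_subset[OF f]) auto
    then have "compactin euclidean (f ` ?N)" "compactin euclidean {y}" "disjnt (f ` ?N) {y}"
      using ny by auto
    from Hausdorff_space_compact_separation[OF Hausdorff_space_euclidean_t2 this]
    obtain V U where UV: "open V" "open U" "f ` ?N \<subseteq> V" "y \<in> U" "disjnt V U"
      by auto
    have W: "open (f -` V)" using f UV(1) by (rule open_vimage[rotated])
    define Q where "Q k = (\<Union>s\<in>{s. \<forall>\<tau>. map \<tau> [0..<k] = s \<longrightarrow> f \<tau> \<in> V}. {\<tau>. map \<tau> [0..<k] = s})" for k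
    have Q: "\<tau> \<in> Q k \<longleftrightarrow> (\<forall>\<tau>'. (\<forall>i<k. \<tau>' i = \<tau> i) \<longrightarrow> f \<tau>' \<in> V)" for \<tau> k
      by (auto simp: Q_def)
    have cover: "?N \<subseteq> (\<Union>k\<in>UNIV. Q k)"
      using open_contains_prefix[OF W] UV(3) by (simp add: subset_eq Q)
    have opQ: "open (Q k)" for k
      unfolding Q_def by (intro open_UN ballI open_prefix)
    obtain C where C: "finite C" "?N \<subseteq> (\<Union>k\<in>C. Q k)"
      using compactE_image[OF compact_box opQ cover] by auto
    \<comment> \<open>The sets \<open>Q k\<close> grow with \<open>k\<close>, so the largest index
      of the finite subcover serves for all; \<open>0\<close> keeps \<open>Max\<close> defined
      whatever \<open>C\<close> is.\<close>
    define m where "m = Max (insert 0 C)"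
    have mono: "Q k \<subseteq> Q m" if "k \<in> C" for k
    proof -
      have "k \<le> m" using that C(1) by (simp add: m_def)
      then show ?thesis by (auto simp: subset_eq Q)
    qed
    have "f \<tau> \<in> V" if "\<tau> \<in> bounded_by (map \<sigma> [0..<m])" for \<tau>
    proof -
      \<comment> \<open>Cutting \<open>\<tau>\<close> down to \<open>\<sigma>\<close> lands in the
        box and changes none of the first \<open>m\<close> coordinates.\<close>
      have "(\<lambda>i. min (\<tau> i) (\<sigma> i)) \<in> ?N" by simp
      with C(2) have "(\<lambda>i. min (\<tau> i) (\<sigma> i)) \<in> (\<Union>k\<in>C. Q k)" by (rule subsetD)
      then obtain k where "k \<in> C" "(\<lambda>i. min (\<tau> i) (\<sigma> i)) \<in> Q k" by (rule UN_E)
      then have "(\<lambda>i. min (\<tau> i) (\<sigma> i)) \<in> Q m" using subsetD[OF mono] by simp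
      then show ?thesis using that unfolding Q bounded_by_prefix by auto
    qed
    then have "f ` bounded_by (map \<sigma> [0..<m]) \<inter> U = {}"
      using UV(5) by (auto simp: disjnt_def)
    then have "closure (f ` bounded_by (map \<sigma> [0..<m])) \<inter> U = {}"
      using UV(2) by (simp add: open_Int_closure_eq_empty Int_commute)
    then show False using y UV(4) by blast
  qed
qed

text \<open>Continuity of the outer measure from below allows the coordinates to be bounded one after the
  other.\<close>

lemma outer_measure_bounded_by:
  fixes f :: "(nat \<Rightarrow> nat) \<Rightarrow> 'a::topological_space"
  assumes \<mu>: "space \<mu> = UNIV" and c: "c < outer_measure_of \<mu> (range f)"
  shows "\<exists>\<sigma>. \<forall>k. c < outer_measure_of \<mu> (f ` bounded_by (map \<sigma> [0..<k]))"
proof -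
  have next_coord: "\<exists>j. c < outer_measure_of \<mu> (f ` {\<tau>. (\<forall>i<k. \<tau> i \<le> \<sigma> i) \<and> \<tau> k \<le> j})"
    if "c < outer_measure_of \<mu> (f ` {\<tau>. \<forall>i<k. \<tau> i \<le> \<sigma> i})" for \<sigma> :: "nat \<Rightarrow> nat" and k
  proof -
    let ?A = "\<lambda>j. f ` {\<tau>. (\<forall>i<k. \<tau> i \<le> \<sigma> i) \<and> \<tau> k \<le> j}"
    have "incseq ?A" by (force simp: incseq_def)
    moreover have "(\<Union>j. ?A j) = f ` {\<tau>. \<forall>i<k. \<tau> i \<le> \<sigma> i}" by auto
    ultimately have "c < (SUP j. outer_measure_of \<mu> (?A j))"
      using that \<mu> by (subst SUP_outer_measure_of_incseq) auto
    then show ?thesis by (simp add: less_SUP_iff)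
  qed
  have "\<exists>\<sigma>. \<forall>k. c < outer_measure_of \<mu> (f ` {\<tau>. (\<forall>i<k. \<tau> i \<le> \<sigma> i) \<and> \<tau> k \<le> \<sigma> k})"
  proof (rule dependent_wellorder_choice)
    fix r k and \<sigma> \<sigma>' :: "nat \<Rightarrow> nat"
    assume "\<And>i. i < k \<Longrightarrow> \<sigma> i = \<sigma>' i"
    then have "{\<tau>. (\<forall>i<k. \<tau> i \<le> \<sigma> i) \<and> \<tau> k \<le> r} = {\<tau>. (\<forall>i<k. \<tau> i \<le> \<sigma>' i) \<and> \<tau> k \<le> r}" by auto
    then show "c < outer_measure_of \<mu> (f ` {\<tau>. (\<forall>i<k. \<tau> i \<le> \<sigma> i) \<and> \<tau> k \<le> r}) \<longleftrightarrow>
        c < outer_measure_of \<mu> (f ` {\<tau>. (\<forall>i<k. \<tau> i \<le> \<sigma>' i) \<and> \<tau> k \<le> r})" by simp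
  next
    fix k and \<sigma> :: "nat \<Rightarrow> nat"
    assume IH: "\<And>i. i < k \<Longrightarrow>
      c < outer_measure_of \<mu> (f ` {\<tau>. (\<forall>j<i. \<tau> j \<le> \<sigma> j) \<and> \<tau> i \<le> \<sigma> i})"
    show "\<exists>r. c < outer_measure_of \<mu> (f ` {\<tau>. (\<forall>i<k. \<tau> i \<le> \<sigma> i) \<and> \<tau> k \<le> r})"
    proof (rule next_coord)
      show "c < outer_measure_of \<mu> (f ` {\<tau>. \<forall>i<k. \<tau> i \<le> \<sigma> i})"
      proof (cases k)
        case (Suc i)
        have "{\<tau>. \<forall>j<k. \<tau> j \<le> \<sigma> j} = {\<tau>. (\<forall>j<i. \<tau> j \<le> \<sigma> j) \<and> \<tau> i \<le> \<sigma> i}"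
          by (auto simp: Suc less_Suc_eq)
        then show ?thesis using IH[of i] Suc by simp
      qed (use c in simp)
    qed
  qed
  then obtain \<sigma> where \<sigma>: "c < outer_measure_of \<mu> (f ` {\<tau>. (\<forall>i<k. \<tau> i \<le> \<sigma> i) \<and> \<tau> k \<le> \<sigma> k})" for k
    by blast
  have "c < outer_measure_of \<mu> (f ` bounded_by (map \<sigma> [0..<k]))" for k
    using \<sigma>[of k] by (rule less_le_trans) (auto intro!: outer_measure_of_mono simp: bounded_by_prefix)
  then show ?thesis by blast
qed

lemma emeasure_le_outer_measure:
  "A \<in> sets (completion \<mu>) \<Longrightarrow> emeasure (completion \<mu>) A \<le> outer_measure_of \<mu> A"
  unfolding outer_measure_of_def
proof (rule INF_greatest)
  fix B assume "A \<in> sets (completion \<mu>)" "B \<in> {B \<in> sets \<mu>. A \<subseteq> B}"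
  then have "emeasure (completion \<mu>) A \<le> emeasure (completion \<mu>) B" by (intro emeasure_mono) auto
  then show "emeasure (completion \<mu>) A \<le> emeasure \<mu> B"
    using \<open>B \<in> _\<close> by simp
qed

context
  fixes \<mu> :: "'a::t2_space measure" and f :: "(nat \<Rightarrow> nat) \<Rightarrow> 'a"
  assumes \<mu>: "finite_measure \<mu>" "sets \<mu> = sets borel" and f: "continuous_on UNIV f"
begin

lemma space_mu: "space \<mu> = UNIV"
  using sets_eq_imp_space_eq[OF \<mu>(2)] by simp

lemma closure_in_sets: "closure B \<in> sets \<mu>"
  using \<mu>(2) by simp

text \<open>The images themselves need not be Borel; their closures are, and the outer measure only
  grows.\<close>

lemma closure_image_bounded_by_gt:
  assumes "c < outer_measure_of \<mu> (range f)"
  shows "\<exists>\<sigma>. \<forall>k. c < emeasure \<mu> (closure (f ` bounded_by (map \<sigma> [0..<k])))"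
proof -
  obtain \<sigma> where \<sigma>: "\<And>k. c < outer_measure_of \<mu> (f ` bounded_by (map \<sigma> [0..<k]))"
    using outer_measure_bounded_by[OF space_mu assms] by blast
  have "outer_measure_of \<mu> (f ` B) \<le> emeasure \<mu> (closure (f ` B))" for B
    using outer_measure_of_mono[OF closure_subset] outer_measure_of_eq[OF closure_in_sets] by metis
  then show ?thesis using \<sigma> less_le_trans by metis
qed

lemma emeasure_INT_closure_ge:
  assumes "\<And>k. c \<le> emeasure \<mu> (closure (f ` bounded_by (map \<sigma> [0..<k])))"
  shows "c \<le> emeasure \<mu> (\<Inter>k. closure (f ` bounded_by (map \<sigma> [0..<k])))"
proof -
  have "decseq (\<lambda>k. closure (f ` bounded_by (map \<sigma> [0..<k])))"
    unfolding decseq_def bounded_by_prefix by (intro allI impI closure_mono image_mono) auto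
  moreover have "emeasure \<mu> B \<noteq> \<infinity>" for B
    using finite_measure.emeasure_finite[OF \<mu>(1)] by simp
  ultimately have "emeasure \<mu> (\<Inter>k. closure (f ` bounded_by (map \<sigma> [0..<k]))) =
      (INF k. emeasure \<mu> (closure (f ` bounded_by (map \<sigma> [0..<k]))))"
    using closure_in_sets by (subst INF_emeasure_decseq) auto
  then show ?thesis using assms by (simp add: le_INF_iff)
qed

lemma INT_closure_in_sets:
  "(\<Inter>k. closure (f ` bounded_by (map \<sigma> [0..<k]))) \<in> sets \<mu>"
  using closure_in_sets by (intro sets.countable_INT) auto

text \<open>Inner approximation: the intersections of closures are Borel, lie in the range and have
  measure arbitrarily close to its outer measure. Their union and a Borel hull of the range differ
  by a null set.\<close>

lemma range_in_completion: "range f \<in> sets (completion \<mu>)"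
proof -
  obtain E where E: "E \<in> sets \<mu>" "range f \<subseteq> E" "outer_measure_of \<mu> (range f) = emeasure \<mu> E"
    using outer_measure_of_attain[of "range f" \<mu>] space_mu by auto
  have fin: "emeasure \<mu> B \<noteq> \<infinity>" for B
    using finite_measure.emeasure_finite[OF \<mu>(1)] by simp
  \<comment> \<open>If the hull has measure at most \<open>1 / Suc n\<close>, the empty set will do;
    otherwise the subtraction in \<open>ennreal\<close> is exact and gives a level strictly below
    the measure of the hull.\<close>
  have "\<exists>D\<in>sets \<mu>. D \<subseteq> range f \<and> emeasure \<mu> E \<le> emeasure \<mu> D + ennreal (1 / Suc n)" for n
  proof (cases "emeasure \<mu> E \<le> ennreal (1 / Suc n)")
    case False
    define c where "c = emeasure \<mu> E - ennreal (1 / Suc n)"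
    have c: "c + ennreal (1 / Suc n) = emeasure \<mu> E"
      using False by (simp add: c_def diff_add_cancel_ennreal)
    have "c < emeasure \<mu> E"
      unfolding c_def using False fin[of E] by (intro ennreal_between) (auto simp: zero_less_iff_neq_zero simp flip: less_top)
    then obtain \<sigma> where "\<And>k. c < emeasure \<mu> (closure (f ` bounded_by (map \<sigma> [0..<k])))"
      using closure_image_bounded_by_gt E(3) by metis
    then have "c \<le> emeasure \<mu> (\<Inter>k. closure (f ` bounded_by (map \<sigma> [0..<k])))"
      by (intro emeasure_INT_closure_ge less_imp_le)
    then have "emeasure \<mu> E \<le> emeasure \<mu> (\<Inter>k. closure (f ` bounded_by (map \<sigma> [0..<k]))) + ennreal (1 / Suc n)"
      unfolding c[symmetric] by (intro add_right_mono)
    moreover have "(\<Inter>k. closure (f ` bounded_by (map \<sigma> [0..<k]))) \<subseteq> range f"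
      using INT_closure_image_bounded_by[OF f, of \<sigma>] by blast
    ultimately show ?thesis using INT_closure_in_sets by blast
  qed (auto intro!: bexI[of _ "{}"])
  then obtain D where D: "\<And>n. D n \<in> sets \<mu>" "\<And>n. D n \<subseteq> range f"
    "\<And>n. emeasure \<mu> E \<le> emeasure \<mu> (D n) + ennreal (1 / Suc n)" by metis
  define D' where "D' = (\<Union>n. D n)"
  have D': "D' \<in> sets \<mu>" "D' \<subseteq> range f" using D by (auto simp: D'_def)
  have ED': "emeasure \<mu> E \<le> emeasure \<mu> D' + ennreal (1 / Suc n)" for n
  proof -
    have "emeasure \<mu> (D n) \<le> emeasure \<mu> D'" using D' by (intro emeasure_mono) (auto simp: D'_def)
    then show ?thesis using D(3)[of n] by (meson add_right_mono order_trans)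
  qed
  have "emeasure \<mu> E \<le> emeasure \<mu> D'"
  proof (rule ennreal_le_epsilon)
    fix e :: real assume "e > 0"
    then obtain n where "1 / Suc n < e" using nat_approx_posE[of e] by metis
    then have "emeasure \<mu> D' + ennreal (1 / Suc n) \<le> emeasure \<mu> D' + ennreal e"
      by (intro add_left_mono ennreal_leI) linarith
    with ED' show "emeasure \<mu> E \<le> emeasure \<mu> D' + ennreal e" by (rule order_trans)
  qed
  then have "E - D' \<in> null_sets \<mu>"
    using D' E fin by (auto simp: null_sets_def emeasure_Diff intro!: diff_eq_0_ennreal simp: less_top)
  then show ?thesis
    using D' E by (intro sets_completionI[of _ D' "range f - D'" "E - D'"]) auto
qed

text \<open>The rational \<open>q\<close> keeps the inequality strict in the limit over
  \<open>k\<close> and makes the quantifier over levels countable. Negative \<open>c\<close> is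
  split off because \<open>ennreal\<close> collapses negative levels to \<open>0\<close>.\<close>

lemma measure_range_gt_iff:
  "c < measure (completion \<mu>) (range f) \<longleftrightarrow>
     c < 0 \<or> (\<exists>q\<in>\<rat>. c < q \<and> (\<exists>\<sigma>. \<forall>k. q \<le> measure \<mu> (closure (f ` bounded_by (map \<sigma> [0..<k])))))"
  (is "?L \<longleftrightarrow> ?R")
proof
  interpret C: finite_measure "completion \<mu>"
    by (rule finite_measureI) (simp add: finite_measure.emeasure_finite[OF \<mu>(1)])
  interpret finite_measure \<mu> by (rule \<mu>(1))
  {
    assume L: ?L
    show ?R
    proof (cases "c < 0")
      case False
      obtain q where q: "q \<in> \<rat>" "c < q" "q < measure (completion \<mu>) (range f)"
        using Rats_dense_in_real[OF L] by blast
      then have "ennreal q < emeasure (completion \<mu>) (range f)"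
        using False by (simp add: C.emeasure_eq_measure ennreal_less_iff)
      then have "ennreal q < outer_measure_of \<mu> (range f)"
        using emeasure_le_outer_measure[OF range_in_completion] by (rule less_le_trans)
      then obtain \<sigma> where "\<And>k. ennreal q < emeasure \<mu> (closure (f ` bounded_by (map \<sigma> [0..<k])))"
        using closure_image_bounded_by_gt by metis
      then have "\<forall>k. q \<le> measure \<mu> (closure (f ` bounded_by (map \<sigma> [0..<k])))"
        using False q(2) by (simp add: emeasure_eq_measure ennreal_less_iff less_imp_le)
      then show ?thesis using q by blast
    qed simp
  next
    assume R: ?R
    show ?L
    proof (cases "c < 0")
      case True
      then show ?thesis using measure_nonneg less_le_trans by blast
    next
      case False
      then obtain q \<sigma> where q: "c < q"
        and "\<And>k. q \<le> measure \<mu> (closure (f ` bounded_by (map \<sigma> [0..<k])))"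
        using R by blast
      then have "ennreal q \<le> emeasure \<mu> (\<Inter>k. closure (f ` bounded_by (map \<sigma> [0..<k])))"
        by (intro emeasure_INT_closure_ge) (simp add: emeasure_eq_measure)
      also have "\<dots> = emeasure (completion \<mu>) (\<Inter>k. closure (f ` bounded_by (map \<sigma> [0..<k])))"
        using INT_closure_in_sets by simp
      also have "\<dots> \<le> emeasure (completion \<mu>) (range f)"
        using range_in_completion INT_closure_image_bounded_by[OF f, of \<sigma>]
        by (intro emeasure_mono) auto
      finally show ?thesis using q False by (simp add: C.emeasure_eq_measure)
    qed
  }
qed

end

section \<open>Semi-analytic functions and their integrals\<close>

lemma analytic_set_in_completion:
  fixes A :: "'a::t2_space set"
  assumes "analytic_set A" "finite_measure \<mu>" "sets \<mu> = sets borel"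
  shows "A \<in> sets (completion \<mu>)"
  using assms(1) range_in_completion[OF assms(2,3)] unfolding analytic_set_def by auto

lemma analytic_set_kernel_gt:
  fixes \<kappa> :: "'b::t2_space \<Rightarrow> 'a::t2_space measure"
  assumes UNIV: "analytic_set (UNIV :: 'b set)" and \<kappa>: "\<kappa> \<in> borel \<rightarrow>\<^sub>M prob_algebra borel"
    and A: "analytic_set A"
  shows "analytic_set {y. c < measure (completion (\<kappa> y)) A}"
proof (cases "c < 0")
  case True
  then have "{y. c < measure (completion (\<kappa> y)) A} = UNIV"
    using measure_nonneg less_le_trans by blast
  then show ?thesis using UNIV by simp
next
  case c: False
  have \<kappa>_sp: "finite_measure (\<kappa> y)" "sets (\<kappa> y) = sets borel" for y
    using measurable_space[OF \<kappa>, of y] by (auto simp: space_prob_algebra prob_space.finite_measure)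
  show ?thesis
  proof (cases "A = {}")
    case True
    then have "{y. c < measure (completion (\<kappa> y)) A} = {}" using c by simp
    then show ?thesis by (simp add: analytic_set_def)
  next
    case False
    then obtain f :: "(nat \<Rightarrow> nat) \<Rightarrow> 'a" where f: "continuous_on UNIV f" "range f = A"
      using A by (auto simp: analytic_set_def)
    define B where "B q s = {y. q \<le> measure (\<kappa> y) (closure (f ` bounded_by s))}" for q s
    have "analytic_set (B q s)" for q s
    proof (rule borel_imp_analytic_set[OF UNIV])
      have "(\<lambda>y. measure (\<kappa> y) (closure (f ` bounded_by s))) \<in> borel_measurable borel"
        using measurable_compose[OF \<kappa> measurable_measure_prob_algebra] by simp
      then have "(\<lambda>y. measure (\<kappa> y) (closure (f ` bounded_by s))) -` {q..} \<inter> space borel \<in> sets borel"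
        by (rule measurable_sets) simp
      then show "B q s \<in> sets borel" by (simp add: B_def vimage_def)
    qed
    then have "analytic_set (\<Union>q\<in>{q \<in> \<rat>. c < q}. {y. \<exists>\<sigma>. \<forall>k. y \<in> B q (map \<sigma> [0..<k])})"
      by (intro analytic_set_UN analytic_set_souslin countable_subset[OF _ countable_rat]) auto
    also have "(\<Union>q\<in>{q \<in> \<rat>. c < q}. {y. \<exists>\<sigma>. \<forall>k. y \<in> B q (map \<sigma> [0..<k])}) =
        {y. c < measure (completion (\<kappa> y)) A}"
      using c measure_range_gt_iff[OF \<kappa>_sp f(1), of c] by (auto simp: f(2) B_def)
    finally show ?thesis .
  qed
qed

definition upper_semianalytic :: "('a::topological_space \<Rightarrow> real) \<Rightarrow> bool" where
  "upper_semianalytic q \<longleftrightarrow> (\<forall>c. analytic_set {y. c < q y})"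

lemma upper_semianalytic_borel:
  fixes q :: "'a::t2_space \<Rightarrow> real"
  assumes "analytic_set (UNIV :: 'a set)" "q \<in> borel_measurable borel"
  shows "upper_semianalytic q"
  unfolding upper_semianalytic_def
proof
  fix c
  have "q -` {c<..} \<inter> space borel \<in> sets borel" using assms(2) by (rule measurable_sets) simp
  then show "analytic_set {y. c < q y}"
    by (intro borel_imp_analytic_set[OF assms(1)]) (simp add: vimage_def)
qed

lemma upper_semianalytic_add:
  fixes p :: "'a::t2_space \<Rightarrow> real"
  assumes "upper_semianalytic p" "upper_semianalytic q"
  shows "upper_semianalytic (\<lambda>y. p y + q y)"
  unfolding upper_semianalytic_def
proof
  fix c
  have *: "c < p y + q y \<longleftrightarrow> (\<exists>r\<in>\<rat>. r < p y \<and> c - r < q y)" for y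
  proof
    assume "c < p y + q y"
    then have "c - q y < p y" by simp
    then obtain r where "r \<in> \<rat>" "c - q y < r" "r < p y" using Rats_dense_in_real by blast
    then show "\<exists>r\<in>\<rat>. r < p y \<and> c - r < q y" by (intro bexI[of _ r]) auto
  qed auto
  have "{y. c < p y + q y} = (\<Union>r\<in>\<rat>. {y. r < p y} \<inter> {y. c - r < q y})"
    by (auto simp: *)
  moreover have "analytic_set (\<Union>r\<in>\<rat>. {y. r < p y} \<inter> {y. c - r < q y})"
    using assms by (intro analytic_set_UN analytic_set_Int countable_rat) (auto simp: upper_semianalytic_def)
  ultimately show "analytic_set {y. c < p y + q y}" by simp
qed

lemma upper_semianalytic_scale:
  assumes "upper_semianalytic q" "0 < r"
  shows "upper_semianalytic (\<lambda>y. r * q y)"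
proof -
  have "{y. c < r * q y} = {y. c / r < q y}" for c
    using assms(2) by (auto simp: pos_divide_less_eq mult.commute)
  then show ?thesis using assms(1) by (simp add: upper_semianalytic_def)
qed

lemma upper_semianalytic_sum:
  fixes q :: "'i \<Rightarrow> 'a::t2_space \<Rightarrow> real"
  assumes "analytic_set (UNIV :: 'a set)" "\<And>i. i \<in> I \<Longrightarrow> upper_semianalytic (q i)"
  shows "upper_semianalytic (\<lambda>y. \<Sum>i\<in>I. q i y)"
  using assms(2)
proof (induction I rule: infinite_finite_induct)
  case (insert i I)
  then show ?case by (simp add: upper_semianalytic_add)
qed (auto intro: upper_semianalytic_borel[OF assms(1)])

text \<open>Raising the threshold by the approximation error puts each set on the right inside the
  left one. Conversely the strict inequality leaves a gap: one half pays for the error, the other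
  for the raised threshold. Serves the integrals as well as the completeness of the function
  space.\<close>

lemma greater_uniform_approx:
  fixes q :: "'a \<Rightarrow> real"
  assumes "\<And>n y. y \<in> S \<Longrightarrow> \<bar>q y - Q n y\<bar> \<le> 1 / Suc n"
  shows "{y \<in> S. c < q y} = (\<Union>n. {y \<in> S. c + 1 / Suc n < Q n y})"
proof (rule set_eqI, rule iffI)
  fix y assume y: "y \<in> {y \<in> S. c < q y}"
  then have "(q y - c) / 2 > 0" by simp
  then obtain n where n: "1 / real (Suc n) < (q y - c) / 2" using nat_approx_posE by blast
  have "q y - Q n y \<le> 1 / real (Suc n)" using abs_le_D1[OF assms] y by blast
  with n have "c + 1 / real (Suc n) < Q n y" by argo
  then show "y \<in> (\<Union>n. {y \<in> S. c + 1 / Suc n < Q n y})" using y by blast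
next
  fix y assume "y \<in> (\<Union>n. {y \<in> S. c + 1 / Suc n < Q n y})"
  then obtain n where n: "y \<in> S" "c + 1 / real (Suc n) < Q n y" by blast
  then have "- (q y - Q n y) \<le> 1 / real (Suc n)" using abs_le_D2[OF assms] by blast
  with n(2) have "c < q y" by argo
  with n(1) show "y \<in> {y \<in> S. c < q y}" by simp
qed

lemma upper_semianalytic_uniform_approx:
  fixes q :: "'a::t2_space \<Rightarrow> real"
  assumes "\<And>n. upper_semianalytic (Q n)" "\<And>n y. \<bar>q y - Q n y\<bar> \<le> 1 / Suc n"
  shows "upper_semianalytic q"
  unfolding upper_semianalytic_def
proof
  fix c
  have "{y. c < q y} = (\<Union>n. {y. c + 1 / Suc n < Q n y})"
    using greater_uniform_approx[of UNIV q Q c] assms(2) by simp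
  moreover have "analytic_set (\<Union>n. {y. c + 1 / Suc n < Q n y})"
    using assms(1) by (intro analytic_set_UN) (auto simp: upper_semianalytic_def)
  ultimately show "analytic_set {y. c < q y}" by simp
qed

lemma bA_up_iff:
  "f \<in> bA_up S \<longleftrightarrow>
     f \<in> extensional S \<and> (\<exists>M. \<forall>x\<in>S. \<bar>f x\<bar> \<le> M) \<and> (\<forall>c. analytic_set {x \<in> S. c < f x})"
proof -
  have "bounded ((\<lambda>x\<in>S. - f x) ` S) \<longleftrightarrow> (\<exists>M. \<forall>x\<in>S. \<bar>f x\<bar> \<le> M)"
    by (auto simp: bounded_iff)
  moreover have "{x \<in> S. (\<lambda>x\<in>S. - f x) x < c} = {x \<in> S. - c < f x}" for c by auto
  moreover have "(\<forall>c. analytic_set {x \<in> S. - c < f x}) \<longleftrightarrow> (\<forall>c. analytic_set {x \<in> S. c < f x})"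
    by (metis minus_minus)
  ultimately show ?thesis by (simp add: bA_up_def bA_low_def)
qed

lemma bA_low_iff_bA_up: "f \<in> bA_low S \<longleftrightarrow> f \<in> extensional S \<and> (\<lambda>x\<in>S. - f x) \<in> bA_up S"
proof -
  have "(\<lambda>x\<in>S. - (\<lambda>x\<in>S. - f x) x) = f" if "f \<in> extensional S"
    using that by (auto simp: fun_eq_iff extensional_def)
  moreover have "f \<in> bA_low S \<Longrightarrow> f \<in> extensional S" by (simp add: bA_low_def)
  ultimately show ?thesis
    unfolding bA_up_def mem_Collect_eq by (metis restrict_extensional)
qed

lemma borel_measurable_completion_bA_up:
  assumes f: "f \<in> bA_up S" and S: "S \<in> sets borel"
    and \<mu>: "finite_measure \<mu>" "sets \<mu> = sets borel"
  shows "(\<lambda>x. indicator S x * f x) \<in> borel_measurable (completion \<mu>)"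
  unfolding borel_measurable_iff_greater
proof
  fix c
  have "{x \<in> S. c < f x} \<in> sets (completion \<mu>)"
    using f by (intro analytic_set_in_completion[OF _ \<mu>]) (simp add: bA_up_iff)
  moreover have "- S \<in> sets (completion \<mu>)" using S \<mu>(2) by simp
  \<comment> \<open>Off \<open>S\<close> the product is \<open>0\<close>, which exceeds
    \<open>c\<close> exactly for negative \<open>c\<close>.\<close>
  moreover have "{x \<in> space (completion \<mu>). c < indicator S x * f x} =
      {x \<in> S. c < f x} \<union> (if c < 0 then - S else {})"
    using sets_eq_imp_space_eq[OF \<mu>(2)] by (auto simp: indicator_def)
  ultimately show "{x \<in> space (completion \<mu>). c < indicator S x * f x} \<in> sets (completion \<mu>)"
    by auto
qed

text \<open>The discretisation error: counting the levels below \<open>a\<close> rounds it to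
  \<open>\<lceil>a\<rceil> - 1\<close>, in truncated subtraction. \<open>a \<le> N\<close> ensures
  that no level is missing at the top.\<close>

lemma count_less_bounds:
  assumes "0 \<le> a" "a \<le> real N"
  shows "a - 1 \<le> real (card {k \<in> {1..N}. real k < a}) \<and> real (card {k \<in> {1..N}. real k < a}) \<le> a"
proof -
  obtain c where c: "c = nat \<lceil>a\<rceil>" by blast
  have less_iff: "real k < a \<longleftrightarrow> k < c" for k unfolding c by linarith
  have "c \<le> N" unfolding c using assms by linarith
  then have "{k \<in> {1..N}. k < c} = {1..<c}" by auto
  then have "{k \<in> {1..N}. real k < a} = {1..<c}" by (simp only: less_iff)
  then have "card {k \<in> {1..N}. real k < a} = c - 1" by simp
  then show ?thesis unfolding c using assms by linarith
qed

text \<open>The integrand is approximated within \<open>1/n\<close> by a positive combination of indicators of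
  analytic sets \<open>{k/n - M < f}\<close>.\<close>

lemma upper_semianalytic_set_integral:
  fixes \<kappa> :: "'b::t2_space \<Rightarrow> 'a::borel_space measure"
  assumes UNIV: "analytic_set (UNIV :: 'b set)" and \<kappa>: "\<kappa> \<in> borel \<rightarrow>\<^sub>M prob_algebra borel"
    and f: "f \<in> bA_up S" and S: "S \<in> sets borel"
  shows "upper_semianalytic (\<lambda>y. LINT z:S|completion (\<kappa> y). f z)"
proof -
  obtain M0 where M0: "\<forall>x\<in>S. \<bar>f x\<bar> \<le> M0" using f by (auto simp: bA_up_iff)
  define M where "M = max M0 1"
  have M: "M > 0" "\<And>x. x \<in> S \<Longrightarrow> \<bar>f x\<bar> \<le> M" using M0 by (auto simp: M_def)
  \<comment> \<open>The number of levels of width \<open>1 / Suc n\<close> that cover the range from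
    \<open>- M\<close> to \<open>M\<close>.\<close>
  define N where "N n = nat \<lceil>2 * M * Suc n\<rceil>" for n
  define A where "A n k = {x \<in> S. real k / Suc n - M < f x}" for n k
  have A: "analytic_set (A n k)" for n k using f by (simp add: A_def bA_up_iff)
  \<comment> \<open>Shifting by \<open>M\<close> makes the integrand nonnegative on
    \<open>S\<close>, so analytic sets get positive coefficients only. The correction
    \<open>- M\<close> multiplies the measure of the Borel set \<open>S\<close>, which is Borel in
    \<open>y\<close>.\<close>
  define Q where "Q n y = (\<Sum>k\<in>{1..N n}. 1 / Suc n * measure (completion (\<kappa> y)) (A n k)) +
    (- M) * measure (\<kappa> y) S" for n y
  have "upper_semianalytic (\<lambda>y. 1 / Suc n * measure (completion (\<kappa> y)) (A n k))" for n k
    using analytic_set_kernel_gt[OF UNIV \<kappa> A]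
    by (intro upper_semianalytic_scale) (auto simp: upper_semianalytic_def)
  moreover have "(\<lambda>y. (- M) * measure (\<kappa> y) S) \<in> borel_measurable borel"
    using measurable_compose[OF \<kappa> measurable_measure_prob_algebra[OF S]] by simp
  ultimately have "upper_semianalytic (Q n)" for n
    unfolding Q_def[abs_def]
    by (intro upper_semianalytic_add upper_semianalytic_sum[OF UNIV]) (auto intro: upper_semianalytic_borel[OF UNIV])
  moreover have "\<bar>(LINT z:S|completion (\<kappa> y). f z) - Q n y\<bar> \<le> 1 / Suc n" for n y
  proof -
    have \<kappa>y: "prob_space (\<kappa> y)" "sets (\<kappa> y) = sets borel"
      using measurable_space[OF \<kappa>, of y] by (auto simp: space_prob_algebra)
    interpret P: prob_space "\<kappa> y" by (rule \<kappa>y)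
    interpret C: prob_space "completion (\<kappa> y)"
      using P.emeasure_space_1 by (intro prob_spaceI) simp
    have AC: "A n k \<in> sets (completion (\<kappa> y))" for k
      using A by (rule analytic_set_in_completion) (use \<kappa>y P.finite_measure_axioms in auto)
    have SC: "S \<in> sets (completion (\<kappa> y))" using S \<kappa>y by simp
    have fm: "(\<lambda>x. indicator S x * f x) \<in> borel_measurable (completion (\<kappa> y))"
      using f S P.finite_measure_axioms \<kappa>y(2) by (rule borel_measurable_completion_bA_up)
    have fi: "integrable (completion (\<kappa> y)) (\<lambda>x. indicator S x * f x)"
      using M by (intro C.integrable_const_bound[OF _ fm, of M]) (auto simp: indicator_def)
    define h where "h x = (\<Sum>k\<in>{1..N n}. 1 / Suc n * indicator (A n k) x) + (- M) * indicator S x" for x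
    have hi: "integrable (completion (\<kappa> y)) h"
      unfolding h_def[abs_def] using AC SC
      by (intro Bochner_Integration.integrable_add Bochner_Integration.integrable_sum integrable_mult_right)
        (auto simp: C.emeasure_eq_measure)
    have "integral\<^sup>L (completion (\<kappa> y)) h = Q n y"
      unfolding h_def[abs_def] Q_def using AC SC S \<kappa>y(2)
      by (subst Bochner_Integration.integral_add)
        (auto simp: C.emeasure_eq_measure integral_sum sets_eq_imp_space_eq[OF \<kappa>y(2)])
    then have "(LINT z:S|completion (\<kappa> y). f z) - Q n y =
        (LINT x|completion (\<kappa> y). indicator S x * f x - h x)"
      using fi hi by (simp add: set_lebesgue_integral_def)
    moreover have "\<bar>indicator S x * f x - h x\<bar> \<le> 1 / Suc n" for x
    proof (cases "x \<in> S")
      case True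
      \<comment> \<open>The height of \<open>f x\<close> above \<open>- M\<close>, measured in
        levels; \<open>h\<close> replaces it by the number of levels passed.\<close>
      define a where "a = (f x + M) * Suc n"
      have "0 \<le> a" using M(2)[OF True] by (auto simp: a_def)
      moreover have "a \<le> (2 * M) * Suc n"
        unfolding a_def using M(2)[OF True] by (intro mult_right_mono) auto
      then have "a \<le> real (N n)" unfolding N_def by linarith
      ultimately have a: "a - 1 \<le> card {k \<in> {1..N n}. real k < a}" "card {k \<in> {1..N n}. real k < a} \<le> a"
        using count_less_bounds by blast+
      have "x \<in> A n k \<longleftrightarrow> real k < a" for k
        using True by (auto simp: A_def a_def field_simps)
      then have "(\<Sum>k\<in>{1..N n}. 1 / Suc n * indicator (A n k) x) =
          (\<Sum>k\<in>{1..N n}. 1 / Suc n * (if real k < a then 1 else 0))"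
        by (intro sum.cong) (auto simp: indicator_def)
      also have "\<dots> = 1 / Suc n * card {k \<in> {1..N n}. real k < a}"
        unfolding sum_distrib_left[symmetric] by (subst sum.inter_filter[symmetric]) simp_all
      finally have hx: "h x + M = card {k \<in> {1..N n}. real k < a} / Suc n"
        using True by (simp add: h_def)
      have fx: "f x + M = a / Suc n" by (simp add: a_def)
      have "(f x + M) - (h x + M) = (a - card {k \<in> {1..N n}. real k < a}) / Suc n"
        unfolding hx fx by (simp add: diff_divide_distrib)
      moreover have "\<bar>(a - card {k \<in> {1..N n}. real k < a}) / Suc n\<bar> \<le> 1 / Suc n"
        using a by (auto simp: abs_divide intro!: divide_right_mono)
      ultimately show ?thesis using True by simp
    next
      case False
      then show ?thesis by (simp add: h_def A_def indicator_def)
    qed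
    then have "\<bar>LINT x|completion (\<kappa> y). indicator S x * f x - h x\<bar> \<le> (LINT x|completion (\<kappa> y). 1 / Suc n)"
      using fi hi by (intro integral_abs_bound[THEN order_trans] integral_mono) auto
    ultimately show ?thesis using C.prob_space by simp
  qed
  ultimately show ?thesis by (rule upper_semianalytic_uniform_approx)
qed

section \<open>The contraction estimate\<close>

text \<open>\<open>c\<close> is a one-step reward: the transition probability into \<open>G\<close>
  for \<open>R_up\<close>, its negative for \<open>R_low\<close> after the sign change, and
  \<open>0\<close> for \<open>T_up\<close> and \<open>T_low\<close>.\<close>

definition dp_op :: "('x \<times> 'u) set \<Rightarrow> ('x \<times> 'u \<Rightarrow> 'x measure) \<Rightarrow> 'x set \<Rightarrow> ('x \<times> 'u \<Rightarrow> real) \<Rightarrow>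
    ('x \<Rightarrow> real) \<Rightarrow> ('x \<Rightarrow> real)" where
  "dp_op K T S c f = (\<lambda>x\<in>S. SUP u\<in>{u. (x, u) \<in> K}. c (x, u) + T_int T S u f x)"

lemma dp_op_apply:
  "x \<in> S \<Longrightarrow> dp_op K T S c f x = (SUP u\<in>{u. (x, u) \<in> K}. c (x, u) + T_int T S u f x)"
  by (simp add: dp_op_def)

definition neg_on :: "'x set \<Rightarrow> ('x \<Rightarrow> real) \<Rightarrow> 'x \<Rightarrow> real" where
  "neg_on S f = (\<lambda>x\<in>S. - f x)"

lemma neg_on_neg_on: "f \<in> extensional S \<Longrightarrow> neg_on S (neg_on S f) = f"
  by (auto simp: neg_on_def fun_eq_iff extensional_def)

lemma neg_on_bA_up: "f \<in> bA_low S \<Longrightarrow> neg_on S f \<in> bA_up S"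
  by (simp add: bA_low_iff_bA_up neg_on_def)

lemma neg_on_bA_low: "f \<in> bA_up S \<Longrightarrow> neg_on S f \<in> bA_low S"
  by (simp add: bA_up_def neg_on_def)

lemma const_bA_up:
  fixes S :: "'x::borel_space set"
  assumes "S \<in> sets borel"
  shows "(\<lambda>x\<in>S. r) \<in> bA_up S"
proof -
  have "analytic_set {x \<in> S. c < (\<lambda>x\<in>S. r) x}" for c
  proof (rule borel_imp_analytic_set[OF analytic_set_UNIV_borel_space])
    have "{x \<in> S. c < (\<lambda>x\<in>S. r) x} = (if c < r then S else {})" by auto
    then show "{x \<in> S. c < (\<lambda>x\<in>S. r) x} \<in> sets borel" using assms by simp
  qed
  then show ?thesis by (auto simp: bA_up_iff)
qed

lemma sup_dist_neg_on: "sup_dist S (neg_on S f) (neg_on S g) = sup_dist S f g"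
  by (simp add: sup_dist_def neg_on_def abs_minus_commute)

section \<open>The complete metric space of bounded upper semi-analytic functions\<close>

lemma sup_dist_bounds:
  assumes f: "f \<in> bA_up S" and g: "g \<in> bA_up S"
  shows "x \<in> S \<Longrightarrow> \<bar>f x - g x\<bar> \<le> sup_dist S f g" "0 \<le> sup_dist S f g"
proof -
  obtain M M' where M: "\<forall>x\<in>S. \<bar>f x\<bar> \<le> M" "\<forall>x\<in>S. \<bar>g x\<bar> \<le> M'" using f g by (auto simp: bA_up_iff)
  have "\<bar>f x - g x\<bar> \<le> M + M'" if "x \<in> S" for x
    using bspec[OF M(1) that] bspec[OF M(2) that] by linarith
  then have bdd: "bdd_above ((\<lambda>x. \<bar>f x - g x\<bar>) ` S)" by (auto intro!: bdd_aboveI)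
  show le: "\<bar>f x - g x\<bar> \<le> sup_dist S f g" if "x \<in> S" for x
    unfolding sup_dist_def using cSUP_upper[OF that bdd] that by auto
  show "0 \<le> sup_dist S f g"
  proof (cases "S = {}")
    case False
    then obtain x where "x \<in> S" by blast
    then show ?thesis using le[of x] by linarith
  qed (simp add: sup_dist_def)
qed

text \<open>\<open>0 \<le> r\<close> covers the empty \<open>S\<close>, where the distance is
  \<open>0\<close> by convention.\<close>

lemma sup_dist_le: "0 \<le> r \<Longrightarrow> (\<And>x. x \<in> S \<Longrightarrow> \<bar>f x - g x\<bar> \<le> r) \<Longrightarrow> sup_dist S f g \<le> r"
  by (auto simp: sup_dist_def intro: cSUP_least)

text \<open>The axioms of a metric space ask for nonnegativity and symmetry at all arguments, while
  the supremum of an unbounded set of reals is unspecified; hence the value \<open>0\<close> off the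
  carrier.\<close>

definition bA_dist :: "'x::borel_space set \<Rightarrow> ('x \<Rightarrow> real) \<Rightarrow> ('x \<Rightarrow> real) \<Rightarrow> real" where
  "bA_dist S f g = (if f \<in> bA_up S \<and> g \<in> bA_up S then sup_dist S f g else 0)"

lemma Metric_space_bA_up: "Metric_space (bA_up S) (bA_dist S)"
proof
  show "0 \<le> bA_dist S f g" for f g by (simp add: bA_dist_def sup_dist_bounds(2))
  show "bA_dist S f g = bA_dist S g f" for f g
    by (simp add: bA_dist_def sup_dist_def abs_minus_commute conj_commute)
  fix f g assume *: "f \<in> bA_up S" "g \<in> bA_up S"
  have "f = g" if "sup_dist S f g = 0"
  proof (rule extensionalityI[of _ S])
    show "f x = g x" if "x \<in> S" for x
      using sup_dist_bounds(1)[OF * that] \<open>sup_dist S f g = 0\<close> by simp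
  qed (use * in \<open>auto simp: bA_up_iff\<close>)
  moreover have "sup_dist S g g = 0" by (simp add: sup_dist_def)
  ultimately show "bA_dist S f g = 0 \<longleftrightarrow> f = g" using * by (auto simp: bA_dist_def)
  fix h assume h: "h \<in> bA_up S"
  have "sup_dist S f h \<le> sup_dist S f g + sup_dist S g h"
  proof (rule sup_dist_le)
    fix x assume "x \<in> S"
    then show "\<bar>f x - h x\<bar> \<le> sup_dist S f g + sup_dist S g h"
      using sup_dist_bounds(1)[OF *] sup_dist_bounds(1)[OF *(2) h] by (smt (verit))
  qed (simp add: sup_dist_bounds(2) * h)
  then show "bA_dist S f h \<le> bA_dist S f g + bA_dist S g h" using * h by (simp add: bA_dist_def)
qed

text \<open>Cauchy sequences converge uniformly on \<open>S\<close>, and a uniform limit stays in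
  the space because its upper level sets are countable unions of level sets of the
  approximations.\<close>

lemma mcomplete_bA_up: "Metric_space.mcomplete (bA_up S) (bA_dist S)"
proof -
  interpret Metric_space "bA_up S" "bA_dist S" by (rule Metric_space_bA_up)
  show ?thesis unfolding mcomplete_def
  proof (intro allI impI)
    fix F assume F: "MCauchy F"
    have Fb: "F n \<in> bA_up S" for n using F by (auto simp: MCauchy_def)
    have "\<exists>N. \<forall>m n x. N \<le> m \<and> N \<le> n \<and> x \<in> S \<longrightarrow> dist (F m x) (F n x) < e" if e: "e > 0" for e
    proof -
      obtain N where "\<forall>n n'. N \<le> n \<longrightarrow> N \<le> n' \<longrightarrow> bA_dist S (F n) (F n') < e"
        using F e unfolding MCauchy_def by blast
      then have "\<forall>m n x. N \<le> m \<and> N \<le> n \<and> x \<in> S \<longrightarrow> dist (F m x) (F n x) < e"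
        using le_less_trans[OF sup_dist_bounds(1)[OF Fb Fb]]
        by (simp add: bA_dist_def Fb dist_real_def)
      then show ?thesis ..
    qed
    then have "\<exists>l. \<forall>e>0. \<exists>N. \<forall>n x. N \<le> n \<and> x \<in> S \<longrightarrow> dist (F n x) (l x) < e"
      unfolding uniformly_convergent_eq_cauchy by blast
    then obtain l where l: "\<forall>e>0. \<exists>N. \<forall>n x. N \<le> n \<and> x \<in> S \<longrightarrow> dist (F n x) (l x) < e" ..
    define f where "f = restrict l S"
    have lim: "\<exists>N. \<forall>n\<ge>N. \<forall>x\<in>S. \<bar>f x - F n x\<bar> \<le> e" if "e > 0" for e
    proof -
      obtain N where "\<forall>n x. N \<le> n \<and> x \<in> S \<longrightarrow> dist (F n x) (l x) < e" using l \<open>e > 0\<close> by blast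
      then have "\<forall>n\<ge>N. \<forall>x\<in>S. \<bar>f x - F n x\<bar> \<le> e"
        by (simp add: f_def dist_real_def abs_minus_commute less_imp_le)
      then show ?thesis ..
    qed
    have "\<exists>n. \<forall>x\<in>S. \<bar>f x - F n x\<bar> \<le> 1 / Suc k" for k
      using lim[of "1 / Suc k"] by auto
    \<comment> \<open>A choice of indices with the explicit rate that
      \<open>greater_uniform_approx\<close> asks for.\<close>
    then obtain r where r: "\<And>k x. x \<in> S \<Longrightarrow> \<bar>f x - F (r k) x\<bar> \<le> 1 / Suc k" by metis
    have f: "f \<in> bA_up S"
      unfolding bA_up_iff
    proof (intro conjI allI)
      obtain M where M: "\<forall>x\<in>S. \<bar>F (r 0) x\<bar> \<le> M" using Fb[of "r 0"] by (auto simp: bA_up_iff)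
      have "\<bar>f x\<bar> \<le> M + 1" if "x \<in> S" for x
        using r[OF that, of 0] bspec[OF M that] by simp
      then show "\<exists>M. \<forall>x\<in>S. \<bar>f x\<bar> \<le> M" by blast
      fix c
      have "analytic_set (\<Union>k. {x \<in> S. c + 1 / Suc k < F (r k) x})"
        using Fb by (intro analytic_set_UN) (auto simp: bA_up_iff)
      moreover have "{x \<in> S. c < f x} = (\<Union>k. {x \<in> S. c + 1 / Suc k < F (r k) x})"
        using r by (rule greater_uniform_approx)
      ultimately show "analytic_set {x \<in> S. c < f x}" by simp
    qed (simp add: f_def)
    have "\<exists>N. \<forall>n\<ge>N. bA_dist S (F n) f < e" if e: "e > 0" for e
    proof -
      obtain N where N: "\<forall>n\<ge>N. \<forall>x\<in>S. \<bar>f x - F n x\<bar> \<le> e / 2" using lim[OF half_gt_zero[OF e]] ..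
      have "bA_dist S (F n) f < e" if "n \<ge> N" for n
      proof -
        have "sup_dist S (F n) f \<le> e / 2"
          using that e N by (intro sup_dist_le) (auto simp: abs_minus_commute)
        then show ?thesis using Fb f e by (simp add: bA_dist_def)
      qed
      then show ?thesis by blast
    qed
    then have "limitin mtopology F f sequentially"
      unfolding limit_metric_sequentially using Fb f by simp
    then show "\<exists>f. limitin mtopology F f sequentially" by blast
  qed
qed

lemma contraction_on_bA_up_fixpoint:
  fixes S :: "'x::borel_space set"
  assumes S: "S \<in> sets borel" and F: "contraction_on (bA_up S) S \<beta> F"
  shows "\<exists>!f. f \<in> bA_up S \<and> F f = f"
proof (rule ex_ex1I)
  interpret Metric_space "bA_up S" "bA_dist S"
    by (rule Metric_space_bA_up)
  have FF: "F f \<in> bA_up S" if "f \<in> bA_up S" for f using F that by (auto simp: contraction_on_def)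
  have ne: "bA_up S \<noteq> {}" using const_bA_up[OF S] by blast
  obtain f where "f \<in> bA_up S" "F f = f"
    using Banach_fixedpoint_thm[OF mcomplete_bA_up ne, of F \<beta>] F FF
    by (auto simp: contraction_on_def bA_dist_def)
  then show "\<exists>f. f \<in> bA_up S \<and> F f = f" by blast
  fix f g assume *: "f \<in> bA_up S \<and> F f = f" "g \<in> bA_up S \<and> F g = g"
  have "sup_dist S (F f) (F g) \<le> \<beta> * sup_dist S f g" using F * unfolding contraction_on_def by blast
  then have "sup_dist S f g \<le> \<beta> * sup_dist S f g" using * by simp
  moreover have "0 \<le> sup_dist S f g" using * sup_dist_bounds(2) by blast
  moreover have "\<beta> < 1" using F by (simp add: contraction_on_def)
  ultimately have "sup_dist S f g = 0"
    by (smt (verit) mult_le_cancel_right1)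
  then show "f = g" using zero[of f g] * by (simp add: bA_dist_def)
qed

text \<open>The sign change is an isometry between the two function spaces, so contraction and
  fixpoint are inherited by conjugation instead of being proved again for infima.\<close>

lemma contraction_on_conjugate_neg:
  fixes S :: "'x::borel_space set"
  assumes S: "S \<in> sets borel" and F: "contraction_on (bA_up S) S \<beta> F"
    and F': "\<And>f. f \<in> bA_low S \<Longrightarrow> F' f = neg_on S (F (neg_on S f))"
  shows "contraction_on (bA_low S) S \<beta> F'" "\<exists>!f. f \<in> bA_low S \<and> F' f = f"
proof -
  have FF: "F f \<in> bA_up S" if "f \<in> bA_up S" for f using F that by (auto simp: contraction_on_def)
  have dist: "sup_dist S (F f) (F g) \<le> \<beta> * sup_dist S f g" if "f \<in> bA_up S" "g \<in> bA_up S" for f g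
    using F that by (auto simp: contraction_on_def)
  have low_ext: "f \<in> extensional S" if "f \<in> bA_low S" for f
    using that by (simp add: bA_low_def)
  have up_ext: "f \<in> extensional S" if "f \<in> bA_up S" for f
    using that by (simp add: bA_up_def)
  have "sup_dist S (F' f) (F' g) \<le> \<beta> * sup_dist S f g" if "f \<in> bA_low S" "g \<in> bA_low S" for f g
    using dist[OF that[THEN neg_on_bA_up]] by (simp add: F' that sup_dist_neg_on)
  moreover have "F' f \<in> bA_low S" if "f \<in> bA_low S" for f
    using that by (simp add: F' neg_on_bA_low FF neg_on_bA_up)
  ultimately show "contraction_on (bA_low S) S \<beta> F'"
    using F by (simp add: contraction_on_def)
  obtain f where f: "f \<in> bA_up S" "F f = f" and uniq: "\<And>g. g \<in> bA_up S \<Longrightarrow> F g = g \<Longrightarrow> g = f"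
    using contraction_on_bA_up_fixpoint[OF S F] by blast
  show "\<exists>!f. f \<in> bA_low S \<and> F' f = f"
  proof (rule ex1I)
    show "neg_on S f \<in> bA_low S \<and> F' (neg_on S f) = neg_on S f"
      using f by (simp add: F' neg_on_bA_low neg_on_neg_on up_ext)
  next
    fix g assume g: "g \<in> bA_low S \<and> F' g = g"
    then have "neg_on S (neg_on S (F (neg_on S g))) = neg_on S g" using F'[of g] by simp
    then have "F (neg_on S g) = neg_on S g"
      using g by (simp add: neg_on_neg_on up_ext FF neg_on_bA_up)
    then have "neg_on S g = f" using uniq[of "neg_on S g"] g neg_on_bA_up by blast
    then show "g = neg_on S f" using g neg_on_neg_on[OF low_ext] by metis
  qed
qed

section \<open>One-step operators of a decision process and their iterates\<close>

locale cdt =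
  fixes K :: "('x::borel_space \<times> 'u::borel_space) set" and T :: "'x \<times> 'u \<Rightarrow> 'x measure" and S :: "'x set"
  assumes mdp: "cdt_MP K T" and S: "S \<in> sets borel"
begin

lemma T_kernel: "T \<in> borel \<rightarrow>\<^sub>M prob_algebra borel"
  using mdp by (simp add: cdt_MP_def)

lemma prob_space_T: "prob_space (T z)" and sets_T: "sets (T z) = sets borel"
  using measurable_space[OF T_kernel, of z] by (simp_all add: space_prob_algebra)

lemma prob_space_completion_T: "prob_space (completion (T z))"
  using prob_space.emeasure_space_1[OF prob_space_T] by (intro prob_spaceI) simp

lemma K_nonempty: "{u. (x, u) \<in> K} \<noteq> {}"
  using mdp by (auto simp: cdt_MP_def)

lemma integrable_T:
  assumes f: "f \<in> bA_up S"
  shows "set_integrable (completion (T z)) S f"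
proof -
  interpret prob_space "completion (T z)" by (rule prob_space_completion_T)
  obtain M where M: "\<forall>x\<in>S. \<bar>f x\<bar> \<le> M" using f by (auto simp: bA_up_iff)
  then have "norm (indicator S x *\<^sub>R f x) \<le> \<bar>M\<bar>" for x
    by (auto simp: indicator_def dest: bspec[OF M])
  moreover have "(\<lambda>x. indicator S x *\<^sub>R f x) \<in> borel_measurable (completion (T z))"
    using borel_measurable_completion_bA_up[OF f S prob_space.finite_measure[OF prob_space_T] sets_T] by simp
  ultimately show ?thesis
    unfolding set_integrable_def by (intro integrable_const_bound) auto
qed

text \<open>A general \<open>h\<close> instead of a constant: during the iteration the gap between
  the two functions is \<open>r * stay k\<close>, and this is what is integrated once more.\<close>

lemma T_int_add_mono:
  assumes "f \<in> bA_up S" "g \<in> bA_up S" "h \<in> bA_up S" "\<And>x. x \<in> S \<Longrightarrow> f x \<le> g x + r * h x"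
  shows "T_int T S u f x \<le> T_int T S u g x + r * T_int T S u h x"
proof -
  have gh: "set_integrable (completion (T (x, u))) S (\<lambda>y. r * h y)"
    using integrable_T[OF assms(3)] by simp
  have "T_int T S u f x \<le> (LINT y:S|completion (T (x, u)). g y + r * h y)"
    unfolding T_int_def
    using assms integrable_T gh set_integral_add(1)[OF integrable_T[OF assms(2)] gh]
    by (intro set_integral_mono) auto
  also have "\<dots> = T_int T S u g x + r * T_int T S u h x"
    unfolding T_int_def using set_integral_add(2)[OF integrable_T[OF assms(2)] gh] by simp
  finally show ?thesis .
qed

lemma T_int_bound:
  assumes f: "f \<in> bA_up S" and M: "0 \<le> M" "\<And>x. x \<in> S \<Longrightarrow> \<bar>f x\<bar> \<le> M"
  shows "\<bar>T_int T S u f x\<bar> \<le> M"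
proof -
  interpret prob_space "completion (T (x, u))" by (rule prob_space_completion_T)
  have "\<bar>T_int T S u f x\<bar> \<le> (LINT y|completion (T (x, u)). M)"
    unfolding T_int_def set_lebesgue_integral_def
    using integrable_T[OF f, of "(x, u)"] M
    by (intro integral_abs_bound[THEN order_trans] integral_mono)
      (auto simp: set_integrable_def indicator_def)
  then show ?thesis using prob_space by simp
qed

lemma T_int_neg_on: "T_int T S u (neg_on S f) x = - T_int T S u f x"
proof -
  have "indicator S y *\<^sub>R neg_on S f y = - (indicator S y *\<^sub>R f y)" for y
    by (simp add: neg_on_def indicator_def)
  then show ?thesis by (simp add: T_int_def set_lebesgue_integral_def)
qed

lemma upper_semianalytic_T_int:
  assumes "f \<in> bA_up S"
  shows "upper_semianalytic (\<lambda>(x, u). T_int T S u f x)"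
  using upper_semianalytic_set_integral[OF analytic_set_UNIV_prod T_kernel assms S]
  by (simp add: T_int_def split_beta')

text \<open>A supremum exceeds \<open>c\<close> iff some admissible control does, so the level set
  is a projection of an analytic set. This is why suprema go with upper semi-analytic functions, and
  where Borel measurability is lost.\<close>

lemma upper_semianalytic_imp_SUP:
  assumes q: "upper_semianalytic q" and C: "\<And>z. \<bar>q z\<bar> \<le> C"
  shows "(\<lambda>x\<in>S. SUP u\<in>{u. (x, u) \<in> K}. q (x, u)) \<in> bA_up S"
  unfolding bA_up_iff
proof (intro conjI allI)
  have bdd: "bdd_above ((\<lambda>u. q (x, u)) ` {u. (x, u) \<in> K})" for x
    using C by (auto intro!: bdd_aboveI[of _ C] dest: abs_le_D1)
  have "\<bar>SUP u\<in>{u. (x, u) \<in> K}. q (x, u)\<bar> \<le> C" for x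
    using C K_nonempty[of x] by (intro cSup_abs_le) auto
  then show "\<exists>M. \<forall>x\<in>S. \<bar>(\<lambda>x\<in>S. SUP u\<in>{u. (x, u) \<in> K}. q (x, u)) x\<bar> \<le> M" by auto
  fix c
  have "{x \<in> S. c < (\<lambda>x\<in>S. SUP u\<in>{u. (x, u) \<in> K}. q (x, u)) x} =
      fst ` (K \<inter> {z. c < q z} \<inter> S \<times> UNIV)"
    using less_cSUP_iff[OF K_nonempty bdd] by (force simp: image_iff)
  moreover have "analytic_set K" using mdp by (simp add: cdt_MP_def)
  moreover have "S \<times> (UNIV :: 'u set) \<in> sets borel"
    using S by (simp add: borel_Times)
  then have "analytic_set (S \<times> (UNIV :: 'u set))"
    by (rule borel_imp_analytic_set[OF analytic_set_UNIV_prod])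
  ultimately show "analytic_set {x \<in> S. c < (\<lambda>x\<in>S. SUP u\<in>{u. (x, u) \<in> K}. q (x, u)) x}"
    using q by (auto intro!: analytic_set_image analytic_set_Int continuous_on_fst simp: upper_semianalytic_def)
qed simp

definition stay :: "nat \<Rightarrow> 'x \<Rightarrow> real" where
  "stay k = (T_up K T S ^^ k) (\<lambda>x\<in>S. 1)"

context
  fixes c :: "'x \<times> 'u \<Rightarrow> real" and C :: real
  assumes c: "c \<in> borel_measurable borel" and C: "\<And>z. \<bar>c z\<bar> \<le> C"
begin

lemma abs_dp_op_integrand_le:
  assumes f: "f \<in> bA_up S"
  shows "\<exists>M. \<forall>x u. \<bar>c (x, u) + T_int T S u f x\<bar> \<le> M"
proof -
  obtain M where M: "\<forall>x\<in>S. \<bar>f x\<bar> \<le> M" using f by (auto simp: bA_up_iff)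
  have "\<bar>T_int T S u f x\<bar> \<le> \<bar>M\<bar>" for x u
    using M by (intro T_int_bound[OF f]) force+
  then have "\<bar>c (x, u) + T_int T S u f x\<bar> \<le> C + \<bar>M\<bar>" for x u
    by (meson C abs_triangle_ineq add_mono order_trans)
  then show ?thesis by blast
qed

lemma bdd_above_dp_op:
  assumes f: "f \<in> bA_up S"
  shows "bdd_above ((\<lambda>u. c (x, u) + T_int T S u f x) ` A)"
proof -
  obtain M where "\<And>x u. \<bar>c (x, u) + T_int T S u f x\<bar> \<le> M"
    using abs_dp_op_integrand_le[OF f] by blast
  then show ?thesis by (auto intro!: bdd_aboveI[of _ M] dest: abs_le_D1)
qed

lemma dp_op_bA_up:
  assumes f: "f \<in> bA_up S"
  shows "dp_op K T S c f \<in> bA_up S"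
proof -
  obtain M where M: "\<And>x u. \<bar>c (x, u) + T_int T S u f x\<bar> \<le> M"
    using abs_dp_op_integrand_le[OF f] by blast
  have "upper_semianalytic (\<lambda>z. c z + (case z of (x, u) \<Rightarrow> T_int T S u f x))"
    using c by (intro upper_semianalytic_add upper_semianalytic_borel upper_semianalytic_T_int f analytic_set_UNIV_prod)
  moreover have "\<bar>c z + (case z of (x, u) \<Rightarrow> T_int T S u f x)\<bar> \<le> M" for z
    using M[of "fst z" "snd z"] by (simp add: split_beta)
  ultimately have "(\<lambda>x\<in>S. SUP u\<in>{u. (x, u) \<in> K}.
      c (x, u) + (case (x, u) of (x, u) \<Rightarrow> T_int T S u f x)) \<in> bA_up S"
    by (rule upper_semianalytic_imp_SUP)
  then show ?thesis by (simp add: dp_op_def)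
qed

lemma dp_op_iter_bA_up: "f \<in> bA_up S \<Longrightarrow> (dp_op K T S c ^^ k) f \<in> bA_up S"
  by (induction k) (auto intro: dp_op_bA_up)

end

lemma T_up_eq_dp_op: "T_up K T S = dp_op K T S (\<lambda>_. 0)"
  by (auto simp: T_up_def dp_op_def fun_eq_iff)

lemma stay_bA_up: "stay k \<in> bA_up S"
  unfolding stay_def T_up_eq_dp_op by (rule dp_op_iter_bA_up[of _ 0]) (auto intro: const_bA_up S)

lemma stay_0: "x \<in> S \<Longrightarrow> stay 0 x = 1"
  by (simp add: stay_def)

lemma stay_Suc: "x \<in> S \<Longrightarrow> stay (Suc k) x = (SUP u\<in>{u. (x, u) \<in> K}. T_int T S u (stay k) x)"
  by (simp add: stay_def T_up_def)

lemma T_int_stay_le: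
  assumes "(x, u) \<in> K" "x \<in> S"
  shows "T_int T S u (stay k) x \<le> stay (Suc k) x"
  unfolding stay_Suc[OF assms(2)]
  using assms(1) bdd_above_dp_op[of "\<lambda>_. 0" 0 "stay k" x] stay_bA_up by (intro cSUP_upper) auto

lemma T_int_nonneg:
  assumes "\<And>x. x \<in> S \<Longrightarrow> 0 \<le> f x"
  shows "0 \<le> T_int T S u f x"
  unfolding T_int_def set_lebesgue_integral_def
  using assms by (intro integral_nonneg_AE) (auto simp: indicator_def)

lemma stay_bounds: "x \<in> S \<Longrightarrow> 0 \<le> stay k x \<and> stay k x \<le> 1"
proof (induction k arbitrary: x)
  case (Suc k)
  have nonneg: "0 \<le> T_int T S u (stay k) x" for u using Suc.IH by (intro T_int_nonneg) blast
  have le: "T_int T S u (stay k) x \<le> 1" for u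
  proof (rule abs_le_D1, rule T_int_bound[OF stay_bA_up])
    show "\<bar>stay k y\<bar> \<le> 1" if "y \<in> S" for y using Suc.IH[OF that] by simp
  qed simp
  obtain u where "(x, u) \<in> K" using K_nonempty by blast
  then have "0 \<le> stay (Suc k) x" using T_int_stay_le[OF _ Suc.prems, of u k] nonneg[of u] by linarith
  moreover have "stay (Suc k) x \<le> 1"
    unfolding stay_Suc[OF Suc.prems] using K_nonempty le by (intro cSUP_least) auto
  ultimately show ?case by simp
qed (simp add: stay_0)

context
  fixes c :: "'x \<times> 'u \<Rightarrow> real" and C :: real
  assumes c: "c \<in> borel_measurable borel" and C: "\<And>z. \<bar>c z\<bar> \<le> C"
begin

text \<open>The reward \<open>c\<close> is common to both sides and drops out, so only the
  transition part acts on the gap. Carrying \<open>r * stay k\<close> rather than \<open>r\<close>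
  is what later gives a modulus below \<open>1\<close>.\<close>

lemma dp_op_iter_le:
  assumes f: "f \<in> bA_up S" and g: "g \<in> bA_up S" and r: "0 \<le> r"
    and le: "\<And>x. x \<in> S \<Longrightarrow> f x \<le> g x + r"
  shows "x \<in> S \<Longrightarrow> (dp_op K T S c ^^ k) f x \<le> (dp_op K T S c ^^ k) g x + r * stay k x"
proof (induction k arbitrary: x)
  case (Suc k)
  let ?f = "(dp_op K T S c ^^ k) f" and ?g = "(dp_op K T S c ^^ k) g"
  have fg: "?f \<in> bA_up S" "?g \<in> bA_up S" using dp_op_iter_bA_up[OF c C] f g by blast+
  have "dp_op K T S c ?f x \<le> dp_op K T S c ?g x + r * stay (Suc k) x"
    unfolding dp_op_apply[OF Suc.prems]
  proof (rule cSUP_least[OF K_nonempty])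
    fix u assume u: "u \<in> {u. (x, u) \<in> K}"
    have "c (x, u) + T_int T S u ?f x \<le> (c (x, u) + T_int T S u ?g x) + r * T_int T S u (stay k) x"
      using T_int_add_mono[OF fg stay_bA_up Suc.IH] by simp
    also have "\<dots> \<le> (SUP u\<in>{u. (x, u) \<in> K}. c (x, u) + T_int T S u ?g x) + r * stay (Suc k) x"
      using u r T_int_stay_le[OF _ Suc.prems] bdd_above_dp_op[OF c C fg(2)]
      by (intro add_mono cSUP_upper mult_left_mono) auto
    finally show "c (x, u) + T_int T S u ?f x \<le>
        (SUP u\<in>{u. (x, u) \<in> K}. c (x, u) + T_int T S u ?g x) + r * stay (Suc k) x" .
  qed
  then show ?case by simp
qed (simp add: le stay_0)

lemma contraction_on_dp_op:
  assumes \<beta>: "0 \<le> \<beta>" "\<beta> < 1" and stay: "\<And>x. x \<in> S \<Longrightarrow> stay m x \<le> \<beta>"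
  shows "contraction_on (bA_up S) S \<beta> (dp_op K T S c ^^ m)"
  unfolding contraction_on_def
proof (intro conjI ballI \<beta>)
  show "dp_op K T S c ^^ m \<in> bA_up S \<rightarrow> bA_up S" using dp_op_iter_bA_up[OF c C] by blast
  fix f g assume f: "f \<in> bA_up S" and g: "g \<in> bA_up S"
  have *: "(dp_op K T S c ^^ m) f x - (dp_op K T S c ^^ m) g x \<le> \<beta> * sup_dist S f g"
    if f: "f \<in> bA_up S" and g: "g \<in> bA_up S" and x: "x \<in> S" for f g x
  proof -
    have "f x \<le> g x + sup_dist S f g" if "x \<in> S" for x
      using abs_le_D1[OF sup_dist_bounds(1)[OF f g that]] by linarith
    then have "(dp_op K T S c ^^ m) f x \<le> (dp_op K T S c ^^ m) g x + sup_dist S f g * stay m x"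
      using f g sup_dist_bounds(2)[OF f g] x by (intro dp_op_iter_le) auto
    also have "sup_dist S f g * stay m x \<le> sup_dist S f g * \<beta>"
      using stay[OF x] sup_dist_bounds(2)[OF f g] by (intro mult_left_mono)
    finally show ?thesis by (simp add: mult.commute)
  qed
  have "sup_dist S g f = sup_dist S f g" by (simp add: sup_dist_def abs_minus_commute)
  then show "sup_dist S ((dp_op K T S c ^^ m) f) ((dp_op K T S c ^^ m) g) \<le> \<beta> * sup_dist S f g"
    using *[OF f g] *[OF g f] \<beta> sup_dist_bounds(2)[OF f g]
    by (intro sup_dist_le abs_leI) (auto simp: minus_diff_eq)
qed

text \<open>Formulated for any infimum operator with reward \<open>- c\<close>, so as to cover
  \<open>R_low\<close> and \<open>T_low\<close> at once and to supply the hypothesis of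
  \<open>contraction_on_conjugate_neg\<close>.\<close>

lemma INF_iter_conjugate:
  assumes F: "\<And>f. F f = (\<lambda>x\<in>S. INF u\<in>{u. (x, u) \<in> K}. - c (x, u) + T_int T S u f x)"
    and f: "f \<in> bA_low S"
  shows "(F ^^ k) f = neg_on S ((dp_op K T S c ^^ k) (neg_on S f))"
proof (induction k)
  case 0
  then show ?case using f by (simp add: neg_on_neg_on bA_low_def)
next
  case (Suc k)
  let ?g = "(dp_op K T S c ^^ k) (neg_on S f)"
  have "F (neg_on S ?g) = neg_on S (dp_op K T S c ?g)"
  proof (rule extensionalityI[of _ S])
    fix x assume "x \<in> S"
    \<comment> \<open>An infimum of reals is minus the supremum of the negated set, and negation
      turns the integrands of \<open>F\<close> into those of \<open>dp_op\<close>.\<close>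
    moreover have "uminus ` ((\<lambda>u. - c (x, u) + T_int T S u (neg_on S ?g) x) ` {u. (x, u) \<in> K}) =
        (\<lambda>u. c (x, u) + T_int T S u ?g x) ` {u. (x, u) \<in> K}"
      by (simp add: image_image T_int_neg_on add.commute)
    ultimately show "F (neg_on S ?g) x = neg_on S (dp_op K T S c ?g) x"
      unfolding F by (simp add: neg_on_def[of S "dp_op K T S c ?g"] dp_op_apply Inf_real_def)
  qed (simp_all add: F neg_on_def[of S "dp_op K T S c ?g"])
  then show ?case by (simp add: Suc.IH)
qed

end

end

section \<open>Universal measurability and selection\<close>

text \<open>The null measure witnesses that the intersection runs over a nonempty family; an empty
  intersection would not be bounded by \<open>Pow (space M)\<close>.\<close>

lemma univ_completion_basis:
  "(\<Inter>\<mu>\<in>{\<mu>. sets \<mu> = sets M \<and> finite_measure \<mu>}. sets (completion \<mu>)) \<subseteq> Pow (space M)"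
proof -
  have "finite_measure (null_measure M)" by (rule finite_measureI) simp
  then have "null_measure M \<in> {\<mu>. sets \<mu> = sets M \<and> finite_measure \<mu>}" by simp
  then have "(\<Inter>\<mu>\<in>{\<mu>. sets \<mu> = sets M \<and> finite_measure \<mu>}. sets (completion \<mu>))
      \<subseteq> sets (completion (null_measure M))"
    by (rule INF_lower)
  also have "\<dots> \<subseteq> Pow (space M)"
    using sets.space_closed[of "completion (null_measure M)"] by simp
  finally show ?thesis .
qed

lemma space_univ_completion [simp]: "space (univ_completion M) = space M"
  unfolding univ_completion_def by (rule space_measure_of[OF univ_completion_basis])

lemma sets_univ_completion:
  "sets (univ_completion M) =
     (\<Inter>\<mu>\<in>{\<mu>. sets \<mu> = sets M \<and> finite_measure \<mu>}. sets (completion \<mu>))" (is "_ = ?A")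
proof -
  have "sets (univ_completion M) = sigma_sets (space M) ?A"
    unfolding univ_completion_def by (rule sets_measure_of[OF univ_completion_basis])
  also have "\<dots> = ?A"
  proof
    show "sigma_sets (space M) ?A \<subseteq> ?A"
    proof (rule INF_greatest)
      fix \<mu> assume \<mu>: "\<mu> \<in> {\<mu>. sets \<mu> = sets M \<and> finite_measure \<mu>}"
      then have "?A \<subseteq> sets (completion \<mu>)" by (rule INF_lower)
      moreover have "space M \<in> sets (completion \<mu>)"
        using \<mu> sets.top[of "completion \<mu>"] sets_eq_imp_space_eq[of \<mu> M] by simp
      ultimately show "sigma_sets (space M) ?A \<subseteq> sets (completion \<mu>)"
        by (rule sets.sigma_sets_subset')
    qed
  qed (auto intro: sigma_sets.Basic)
  finally show ?thesis .
qed

lemma sets_univ_completionI: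
  "(\<And>\<mu>. sets \<mu> = sets M \<Longrightarrow> finite_measure \<mu> \<Longrightarrow> A \<in> sets (completion \<mu>)) \<Longrightarrow> A \<in> sets (univ_completion M)"
  by (simp add: sets_univ_completion)

lemma sets_univ_completionD:
  "A \<in> sets (univ_completion M) \<Longrightarrow> sets \<mu> = sets M \<Longrightarrow> finite_measure \<mu> \<Longrightarrow> A \<in> sets (completion \<mu>)"
  by (simp add: sets_univ_completion)

lemma measurable_univ_completionD:
  assumes "f \<in> univ_completion M \<rightarrow>\<^sub>M N" "sets \<mu> = sets M" "finite_measure \<mu>"
  shows "f \<in> completion \<mu> \<rightarrow>\<^sub>M N"
proof (rule measurableI)
  show "f x \<in> space N" if "x \<in> space (completion \<mu>)" for x
    using measurable_space[OF assms(1), of x] that sets_eq_imp_space_eq[OF assms(2)] by simp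
  show "f -` A \<inter> space (completion \<mu>) \<in> sets (completion \<mu>)" if "A \<in> sets N" for A
    using sets_univ_completionD[OF measurable_sets[OF assms(1) that] assms(2,3)]
      sets_eq_imp_space_eq[OF assms(2)] by simp
qed

text \<open>The preimage is tested against \<open>\<mu>\<close> by testing the set against the image
  measure of \<open>\<mu>\<close>. With both sides completed, a universally measurable map may
  follow a Borel one.\<close>

lemma measurable_univ_completion:
  assumes f: "f \<in> M \<rightarrow>\<^sub>M N"
  shows "f \<in> univ_completion M \<rightarrow>\<^sub>M univ_completion N"
proof (rule measurableI)
  show "f x \<in> space (univ_completion N)" if "x \<in> space (univ_completion M)" for x
    using measurable_space[OF f] that by simp
  fix A assume A: "A \<in> sets (univ_completion N)"
  show "f -` A \<inter> space (univ_completion M) \<in> sets (univ_completion M)"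
  proof (rule sets_univ_completionI)
    fix \<mu> assume \<mu>: "sets \<mu> = sets M" "finite_measure \<mu>"
    have f\<mu>: "f \<in> \<mu> \<rightarrow>\<^sub>M N" using f measurable_cong_sets[OF \<mu>(1) refl] by blast
    have "finite_measure (distr \<mu> N f)" using finite_measure.finite_measure_distr[OF \<mu>(2) f\<mu>] .
    then have "A \<in> sets (completion (distr \<mu> N f))"
      using A by (intro sets_univ_completionD) auto
    moreover have "f \<in> completion \<mu> \<rightarrow>\<^sub>M completion (distr \<mu> N f)"
    proof (rule completion.measurable_completion2)
      show "f \<in> completion \<mu> \<rightarrow>\<^sub>M distr \<mu> N f" using measurable_completion[OF f\<mu>] by simp
      have "distr (completion \<mu>) (distr \<mu> N f) f = distr \<mu> N f"
        using distr_completion[OF f\<mu>] by (metis distr_cong sets_distr)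
      then show "null_sets (distr \<mu> N f) \<subseteq> null_sets (distr (completion \<mu>) (distr \<mu> N f) f)" by simp
    qed
    ultimately have "f -` A \<inter> space (completion \<mu>) \<in> sets (completion \<mu>)" by (rule measurable_sets[rotated])
    then show "f -` A \<inter> space (univ_completion M) \<in> sets (completion \<mu>)"
      using sets_eq_imp_space_eq[OF \<mu>(1)] by simp
  qed
qed

lemma analytic_set_in_univ_completion:
  fixes A :: "'a::t2_space set"
  shows "analytic_set A \<Longrightarrow> A \<in> sets (univ_completion borel)"
  using analytic_set_in_completion by (intro sets_univ_completionI)

lemma borel_measurable_univ_completion_bA_up:
  assumes f: "f \<in> bA_up S" and S: "S \<in> sets borel"
  shows "(\<lambda>x. indicator S x * f x) \<in> borel_measurable (univ_completion borel)"
  unfolding borel_measurable_iff_greater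
proof
  fix c
  show "{x \<in> space (univ_completion borel). c < indicator S x * f x} \<in> sets (univ_completion borel)"
  proof (rule sets_univ_completionI)
    fix \<mu> :: "'a measure" assume \<mu>: "sets \<mu> = sets borel" "finite_measure \<mu>"
    have "{x \<in> space (completion \<mu>). c < indicator S x * f x} \<in> sets (completion \<mu>)"
      using borel_measurable_completion_bA_up[OF f S \<mu>(2,1)] unfolding borel_measurable_iff_greater ..
    then show "{x \<in> space (univ_completion borel). c < indicator S x * f x} \<in> sets (completion \<mu>)"
      using sets_eq_imp_space_eq[OF \<mu>(1)] by simp
  qed
qed

lemma borel_measurable_univ_completion_upper_semianalytic:
  fixes q :: "'a::t2_space \<Rightarrow> real"
  shows "upper_semianalytic q \<Longrightarrow> q \<in> borel_measurable (univ_completion borel)"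
  unfolding borel_measurable_iff_greater
  by (auto simp: upper_semianalytic_def intro: analytic_set_in_univ_completion)

text \<open>The selector picks the lexicographically least point of the closed set
  \<open>{\<tau>. fst (f \<tau>) = x}\<close>, where \<open>f\<close> parametrises \<open>A\<close> by the Baire space.\<close>

theorem jankov_von_neumann:
  fixes A :: "('x::t2_space \<times> 'u::topological_space) set"
  assumes A: "analytic_set A" and \<phi>0: "\<phi>0 \<in> univ_completion borel \<rightarrow>\<^sub>M borel"
  shows "\<exists>\<phi>\<in>univ_completion borel \<rightarrow>\<^sub>M borel.
    \<forall>x. if x \<in> fst ` A then (x, \<phi> x) \<in> A else \<phi> x = \<phi>0 x"
proof (cases "A = {}")
  case True
  then show ?thesis using \<phi>0 by auto
next
  case False
  then obtain f :: "(nat \<Rightarrow> nat) \<Rightarrow> 'x \<times> 'u" where f: "continuous_on UNIV f" "range f = A"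
    using A by (auto simp: analytic_set_def)
  \<comment> \<open>The points whose fibre meets the cylinder of \<open>s\<close>: projections of
    analytic sets, hence universally measurable.\<close>
  define D where "D s = (\<lambda>\<tau>. fst (f \<tau>)) ` {\<tau>. map \<tau> [0..<length s] = s}" for s
  have cont: "continuous_on UNIV (\<lambda>\<tau>. fst (f \<tau>))" "continuous_on UNIV (\<lambda>\<tau>. snd (f \<tau>))"
    using f(1) by (auto intro: continuous_intros)
  have "analytic_set {\<tau> :: nat \<Rightarrow> nat. map \<tau> [0..<length s] = s}" for s
    using analytic_in_baire open_prefix by (auto simp: analytic_set_iff_analytic_in)
  then have D: "D s \<in> sets (univ_completion borel)" for s
    unfolding D_def using cont(1) by (intro analytic_set_in_univ_completion analytic_set_image)
  \<comment> \<open>Greedy descent: the prefix is extended by the least \<open>j\<close> for which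
    the fibre of \<open>x\<close> still meets the cylinder. For \<open>x\<close> outside the
    projection of \<open>A\<close> the values are arbitrary.\<close>
  define pre where "pre x = rec_nat [] (\<lambda>k s. s @ [LEAST j. x \<in> D (s @ [j])])" for x
  have pre_0: "pre x 0 = []" and
    pre_Suc: "pre x (Suc k) = pre x k @ [LEAST j. x \<in> D (pre x k @ [j])]" for x k
    by (simp_all add: pre_def)
  have pre_meas: "(\<lambda>x. pre x k) \<in> univ_completion borel \<rightarrow>\<^sub>M count_space UNIV" for k
  proof (induction k)
    case (Suc k)
    have "(\<lambda>x. s @ [LEAST j. x \<in> D (s @ [j])]) \<in> univ_completion borel \<rightarrow>\<^sub>M count_space UNIV" for s
    proof -
      have "Measurable.pred (univ_completion borel) (\<lambda>x. x \<in> D (s @ [j]))" for j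
        using D by (simp add: pred_def)
      then have "(\<lambda>x. LEAST j. x \<in> D (s @ [j])) \<in> univ_completion borel \<rightarrow>\<^sub>M count_space UNIV"
        by (rule measurable_Least)
      from measurable_compose[OF this, of "\<lambda>j. s @ [j]" "count_space UNIV"]
      show ?thesis by simp
    qed
    from measurable_compose_countable[OF this Suc] show ?case by (simp add: pre_Suc)
  qed (simp add: pre_0)
  define t where "t x k = last (pre x (Suc k))" for x k
  have pre_t: "pre x k = map (t x) [0..<k]" for x k
    by (induction k) (auto simp: pre_0 pre_Suc t_def)
  have "(\<lambda>x. t x k) \<in> borel_measurable (univ_completion borel)" for k
    unfolding t_def using measurable_compose[OF pre_meas, of last borel] by simp
  then have t_meas: "t \<in> borel_measurable (univ_completion borel)"
    by (rule measurable_coordinatewise_then_product)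
  have fst_t: "fst (f (t x)) = x" if x: "x \<in> fst ` A" for x
  proof (rule ccontr)
    assume neq: "fst (f (t x)) \<noteq> x"
    have pre_D: "x \<in> D (pre x k)" for k
    proof (induction k)
      case 0
      then show ?case using x f(2) by (force simp: pre_0 D_def)
    next
      case (Suc k)
      then obtain \<tau> where "map \<tau> [0..<length (pre x k)] = pre x k" "fst (f \<tau>) = x"
        by (auto simp: D_def)
      then have "x \<in> D (pre x k @ [\<tau> (length (pre x k))])" by (auto simp: D_def)
      then show ?case unfolding pre_Suc by (rule LeastI)
    qed
    \<comment> \<open>The fibre is closed: were \<open>t x\<close> outside it, a whole cylinder
      around \<open>t x\<close> would miss the fibre, against \<open>pre_D\<close>.\<close>
    have "open ((\<lambda>\<tau>. fst (f \<tau>)) -` (- {x}))"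
      using cont(1) by (intro open_vimage) auto
    from open_contains_prefix[OF this, of "t x"] neq
    obtain k where k: "\<And>\<tau>. \<forall>i<k. \<tau> i = t x i \<Longrightarrow> fst (f \<tau>) \<noteq> x" by auto
    obtain \<tau> where \<tau>: "map \<tau> [0..<k] = pre x k" "fst (f \<tau>) = x"
      using pre_D[of k] by (auto simp: D_def pre_t)
    then have "\<forall>i<k. \<tau> i = t x i" by (simp add: pre_t)
    with k \<tau>(2) show False by blast
  qed
  define \<phi> where "\<phi> x = (if x \<in> fst ` A then snd (f (t x)) else \<phi>0 x)" for x
  have "(\<lambda>x. snd (f (t x))) \<in> univ_completion borel \<rightarrow>\<^sub>M borel"
    using t_meas borel_measurable_continuous_onI[OF cont(2)] by (rule measurable_compose)
  moreover have "analytic_set (fst ` A)"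
    using A by (rule analytic_set_image) (rule continuous_on_fst[OF continuous_on_id])
  then have "{x \<in> space (univ_completion borel). x \<in> fst ` A} \<in> sets (univ_completion borel)"
    using analytic_set_in_univ_completion by simp
  ultimately have "\<phi> \<in> univ_completion borel \<rightarrow>\<^sub>M borel"
    unfolding \<phi>_def[abs_def] using \<phi>0 by (intro measurable_If)
  moreover have "(x, \<phi> x) \<in> A" if "x \<in> fst ` A" for x
  proof -
    have "(x, \<phi> x) = f (t x)" using that fst_t[OF that] by (simp add: \<phi>_def prod_eq_iff)
    then show ?thesis using f(2) by auto
  qed
  ultimately show ?thesis by (intro bexI[of _ \<phi>]) (auto simp: \<phi>_def)
qed

section \<open>Path laws of universally measurable policies\<close>

text \<open>Countability allows one exceptional null set for all generators together; stability
  under intersections lets measurability of a probability kernel be checked on the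
  generators.\<close>

lemma countable_Int_stable_generator:
  obtains G :: "'a::second_countable_topology set set"
  where "countable G" "Int_stable G" "UNIV \<in> G" "sets borel = sigma_sets UNIV G"
proof -
  obtain \<B> :: "'a set set" where \<B>: "countable \<B>" "topological_basis \<B>"
    using ex_countable_basis by blast
  define G where "G = Inter ` {F. finite F \<and> F \<subseteq> \<B>}"
  show thesis
  proof
    show "countable G"
      unfolding G_def using countable_Collect_finite_subset[OF \<B>(1)] by (rule countable_image)
    show "UNIV \<in> G" unfolding G_def by (rule image_eqI[of _ _ "{}"]) auto
    show "Int_stable G"
    proof (rule Int_stableI)
      fix a b assume "a \<in> G" "b \<in> G"
      then obtain F F' where "a = \<Inter>F" "b = \<Inter>F'" "finite F" "finite F'" "F \<subseteq> \<B>" "F' \<subseteq> \<B>"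
        by (auto simp: G_def)
      then show "a \<inter> b \<in> G"
        unfolding G_def by (intro image_eqI[of _ _ "F \<union> F'"]) auto
    qed
    have op: "open a" if "a \<in> G" for a
      using that \<B>(2) by (auto simp: G_def topological_basis_def intro!: open_Inter)
    have "\<B> \<subseteq> G"
    proof
      fix b assume "b \<in> \<B>"
      then show "b \<in> G" unfolding G_def by (intro image_eqI[of _ _ "{b}"]) auto
    qed
    moreover have "sets (borel :: 'a measure) = sigma_sets UNIV \<B>"
      unfolding borel_eq_countable_basis[OF \<B>] by (rule sets_measure_of) simp
    ultimately have "sets (borel :: 'a measure) \<subseteq> sigma_sets UNIV G"
      using sigma_sets_mono' by simp
    moreover have "sigma_sets UNIV G \<subseteq> sets borel"
      using op by (intro sets.sigma_sets_subset'[of _ borel, simplified]) auto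
    ultimately show "sets (borel :: 'a measure) = sigma_sets UNIV G" by blast
  qed
qed

text \<open>For each generator the probability has a Borel version, and the countably many
  exceptional sets fit into one null set \<open>N\<close>. Off \<open>N\<close> the kernel itself is
  kept, so no measure has to be rebuilt from its values on generators.\<close>

lemma ex_borel_kernel:
  fixes k :: "'h \<Rightarrow> 'u::second_countable_topology measure"
  assumes \<mu>: "finite_measure \<mu>" "sets \<mu> = sets M" and k: "k \<in> univ_completion M \<rightarrow>\<^sub>M prob_algebra borel"
  shows "\<exists>\<kappa>\<in>M \<rightarrow>\<^sub>M prob_algebra borel. AE h in \<mu>. k h = \<kappa> h"
proof -
  obtain G :: "'u set set" where G: "countable G" "Int_stable G" "UNIV \<in> G" "sets borel = sigma_sets UNIV G"
    using countable_Int_stable_generator .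
  have space: "space \<mu> = space M" using sets_eq_imp_space_eq[OF \<mu>(2)] .
  have k\<mu>: "k \<in> completion \<mu> \<rightarrow>\<^sub>M prob_algebra borel"
    using k \<mu>(2,1) by (rule measurable_univ_completionD)
  have "\<exists>g\<in>borel_measurable \<mu>. AE h in \<mu>. emeasure (k h) B = g h" if "B \<in> G" for B
  proof -
    have "B \<in> sets borel" using that G(4) by auto
    then have "(\<lambda>h. emeasure (k h) B) \<in> borel_measurable (completion \<mu>)"
      using measurable_compose[OF measurable_prob_algebraD[OF k\<mu>]] measurable_emeasure_subprob_algebra
      by blast
    then show ?thesis by (rule completion_ex_borel_measurable)
  qed
  then obtain g where g: "\<And>B. B \<in> G \<Longrightarrow> g B \<in> borel_measurable \<mu>"
    "\<And>B. B \<in> G \<Longrightarrow> AE h in \<mu>. emeasure (k h) B = g B h" by metis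
  then have "AE h in \<mu>. \<forall>B\<in>G. emeasure (k h) B = g B h"
    using G(1) by (intro AE_ball_countable') auto
  then obtain N where N: "N \<in> null_sets \<mu>" "{h \<in> space \<mu>. \<not> (\<forall>B\<in>G. emeasure (k h) B = g B h)} \<subseteq> N"
    by (auto elim!: AE_E)
  \<comment> \<open>A point mass on \<open>N\<close> keeps \<open>\<kappa>\<close> a probability
    kernel everywhere.\<close>
  define \<kappa> where "\<kappa> h = (if h \<in> N then return borel undefined else k h)" for h
  have k_prob: "prob_space (k h)" "sets (k h) = sets borel" if "h \<in> space M" for h
    using measurable_space[OF k, of h] that by (simp_all add: space_prob_algebra)
  have "\<kappa> \<in> M \<rightarrow>\<^sub>M prob_algebra borel"
  proof (rule measurable_prob_algebra_generated[OF G(4,2)])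
    fix B assume B: "B \<in> G"
    have "(\<lambda>h. if h \<in> N then emeasure (return borel undefined) B else g B h) \<in> borel_measurable \<mu>"
      using g(1)[OF B] N(1) by (intro measurable_If_set) auto
    moreover have "emeasure (\<kappa> h) B = (if h \<in> N then emeasure (return borel undefined) B else g B h)"
      if "h \<in> space \<mu>" for h
      using N(2) B that by (auto simp: \<kappa>_def)
    ultimately have "(\<lambda>h. emeasure (\<kappa> h) B) \<in> borel_measurable \<mu>"
      by (simp cong: measurable_cong)
    then show "(\<lambda>h. emeasure (\<kappa> h) B) \<in> borel_measurable M"
      using measurable_cong_sets[OF \<mu>(2) refl] by blast
  qed (auto simp: \<kappa>_def k_prob prob_space_return)
  moreover have "AE h in \<mu>. k h = \<kappa> h"
    using AE_not_in[OF N(1)] by eventually_elim (simp add: \<kappa>_def)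
  ultimately show ?thesis by blast
qed

text \<open>The hypothesis on rectangles, a generator stable under intersections, identifies the
  joint law of \<open>X\<close> and \<open>Y\<close> with the law of \<open>X\<close> followed by
  \<open>J\<close>; the integral of \<open>f\<close> then splits.\<close>

lemma nn_integral_disintegration:
  assumes P: "prob_space P" and X[measurable]: "X \<in> P \<rightarrow>\<^sub>M M" and Y[measurable]: "Y \<in> P \<rightarrow>\<^sub>M N"
    and \<kappa>[measurable]: "\<kappa> \<in> M \<rightarrow>\<^sub>M prob_algebra N"
    and eq: "\<And>A B. A \<in> sets M \<Longrightarrow> B \<in> sets N \<Longrightarrow>
      emeasure P {\<omega> \<in> space P. X \<omega> \<in> A \<and> Y \<omega> \<in> B} = (\<integral>\<^sup>+\<omega>. indicator A (X \<omega>) * emeasure (\<kappa> (X \<omega>)) B \<partial>P)"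
    and f[measurable]: "f \<in> borel_measurable (M \<Otimes>\<^sub>M N)"
  shows "(\<integral>\<^sup>+\<omega>. f (X \<omega>, Y \<omega>) \<partial>P) = (\<integral>\<^sup>+\<omega>. \<integral>\<^sup>+y. f (X \<omega>, y) \<partial>\<kappa> (X \<omega>) \<partial>P)"
proof -
  interpret prob_space P by (rule P)
  define J where "J x = distr (\<kappa> x) (M \<Otimes>\<^sub>M N) (Pair x)" for x
  have \<kappa>x: "prob_space (\<kappa> x)" "sets (\<kappa> x) = sets N" if "x \<in> space M" for x
    using measurable_space[OF \<kappa> that] by (simp_all add: space_prob_algebra)
  have J[measurable]: "J \<in> M \<rightarrow>\<^sub>M prob_algebra (M \<Otimes>\<^sub>M N)"
    unfolding J_def[abs_def] by (rule measurable_distr_prob_space2[OF \<kappa>]) simp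
  define \<nu> where "\<nu> = distr P M X \<bind> J"
  have dX: "distr P M X \<in> space (prob_algebra M)"
    by (simp add: space_prob_algebra prob_space_distr)
  have sets_\<nu>: "sets \<nu> = sets (M \<Otimes>\<^sub>M N)"
    unfolding \<nu>_def using dX J by (rule sets_bind')
  have emeasure_J: "emeasure (J x) (A \<times> B) = indicator A x * emeasure (\<kappa> x) B"
    if "x \<in> space M" "A \<in> sets M" "B \<in> sets N" for x A B
  proof -
    have "Pair x -` (A \<times> B) \<inter> space (\<kappa> x) = (if x \<in> A then B else {})"
      using that sets.sets_into_space[OF that(3)] sets_eq_imp_space_eq[OF \<kappa>x(2)[OF that(1)]] by auto
    moreover have "Pair x \<in> \<kappa> x \<rightarrow>\<^sub>M M \<Otimes>\<^sub>M N"
      unfolding measurable_cong_sets[OF \<kappa>x(2)[OF that(1)] refl] using that(1) by (rule measurable_Pair1')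
    ultimately show ?thesis
      using that by (simp add: J_def emeasure_distr indicator_def)
  qed
  have "distr P (M \<Otimes>\<^sub>M N) (\<lambda>\<omega>. (X \<omega>, Y \<omega>)) = \<nu>"
  proof (rule measure_eqI_generator_eq[OF Int_stable_pair_measure_generator[of M N]])
    show "{A \<times> B |A B. A \<in> sets M \<and> B \<in> sets N} \<subseteq> Pow (space M \<times> space N)"
      using sets.space_closed[of M] sets.space_closed[of N] by auto
    fix Z assume "Z \<in> {A \<times> B |A B. A \<in> sets M \<and> B \<in> sets N}"
    then obtain A B where Z: "Z = A \<times> B" and AB[measurable]: "A \<in> sets M" "B \<in> sets N" by auto
    have "emeasure (distr P (M \<Otimes>\<^sub>M N) (\<lambda>\<omega>. (X \<omega>, Y \<omega>))) Z = emeasure P {\<omega> \<in> space P. X \<omega> \<in> A \<and> Y \<omega> \<in> B}"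
      unfolding Z by (subst emeasure_distr) (auto intro!: arg_cong[where f = "emeasure P"])
    also have "\<dots> = (\<integral>\<^sup>+\<omega>. indicator A (X \<omega>) * emeasure (\<kappa> (X \<omega>)) B \<partial>P)"
      using AB by (rule eq)
    also have "\<dots> = (\<integral>\<^sup>+\<omega>. emeasure (J (X \<omega>)) Z \<partial>P)"
      unfolding Z using measurable_space[OF X] AB by (intro nn_integral_cong) (simp add: emeasure_J)
    also have "\<dots> = (\<integral>\<^sup>+x. emeasure (J x) Z \<partial>distr P M X)"
    proof (rule nn_integral_distr[symmetric, OF X])
      have "Z \<in> sets (M \<Otimes>\<^sub>M N)" unfolding Z by simp
      then have "(\<lambda>x. emeasure (J x) Z) \<in> borel_measurable M"
        using measurable_compose[OF measurable_prob_algebraD[OF J]] measurable_emeasure_subprob_algebra by blast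
      then show "(\<lambda>x. emeasure (J x) Z) \<in> borel_measurable (distr P M X)" by simp
    qed
    also have "\<dots> = emeasure \<nu> Z"
      unfolding \<nu>_def Z by (rule emeasure_bind_prob_algebra[symmetric, OF dX J]) simp
    finally show "emeasure (distr P (M \<Otimes>\<^sub>M N) (\<lambda>\<omega>. (X \<omega>, Y \<omega>))) Z = emeasure \<nu> Z" .
  next
    show "range (\<lambda>_::nat. space M \<times> space N) \<subseteq> {A \<times> B |A B. A \<in> sets M \<and> B \<in> sets N}"
      by auto
    have "prob_space (distr P (M \<Otimes>\<^sub>M N) (\<lambda>\<omega>. (X \<omega>, Y \<omega>)))" by (rule prob_space_distr) simp
    then show "emeasure (distr P (M \<Otimes>\<^sub>M N) (\<lambda>\<omega>. (X \<omega>, Y \<omega>))) (space M \<times> space N) \<noteq> \<infinity>"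
      using finite_measure.emeasure_finite[OF prob_space.finite_measure] by simp
  qed (auto simp: sets_\<nu> sets_pair_measure)
  then have "(\<integral>\<^sup>+\<omega>. f (X \<omega>, Y \<omega>) \<partial>P) = (\<integral>\<^sup>+z. f z \<partial>\<nu>)"
    by (subst (asm) eq_commute) (simp add: nn_integral_distr)
  also have "\<dots> = (\<integral>\<^sup>+x. \<integral>\<^sup>+z. f z \<partial>J x \<partial>distr P M X)"
    unfolding \<nu>_def by (rule nn_integral_bind[OF f]) (simp add: measurable_prob_algebraD)
  also have "\<dots> = (\<integral>\<^sup>+\<omega>. \<integral>\<^sup>+z. f z \<partial>J (X \<omega>) \<partial>P)"
    using measurable_compose[OF measurable_prob_algebraD[OF J] nn_integral_measurable_subprob_algebra[OF f]]
    by (intro nn_integral_distr X) simp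
  also have "\<dots> = (\<integral>\<^sup>+\<omega>. \<integral>\<^sup>+y. f (X \<omega>, y) \<partial>\<kappa> (X \<omega>) \<partial>P)"
  proof (rule nn_integral_cong)
    fix \<omega> assume "\<omega> \<in> space P"
    then have x: "X \<omega> \<in> space M" using measurable_space[OF X] by blast
    have "Pair (X \<omega>) \<in> \<kappa> (X \<omega>) \<rightarrow>\<^sub>M M \<Otimes>\<^sub>M N"
      unfolding measurable_cong_sets[OF \<kappa>x(2)[OF x] refl] using x by (rule measurable_Pair1')
    then show "(\<integral>\<^sup>+z. f z \<partial>J (X \<omega>)) = (\<integral>\<^sup>+y. f (X \<omega>, y) \<partial>\<kappa> (X \<omega>))"
      unfolding J_def by (simp add: nn_integral_distr)
  qed
  finally show ?thesis .
qed

text \<open>Puts the existence theorem into the form of a one-step integral identity under the limit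
  measure; the finite-horizon laws \<open>C 0 n\<close> enter only as its marginals.\<close>

lemma ionescu_tulcea_limit:
  fixes k :: "nat \<Rightarrow> (nat \<Rightarrow> 'a) \<Rightarrow> 'a measure"
  assumes k: "\<And>n. k n \<in> PiM {..<n} (\<lambda>_. M) \<rightarrow>\<^sub>M prob_algebra M"
  shows "\<exists>P. prob_space P \<and> sets P = sets (PiM UNIV (\<lambda>_. M)) \<and>
    (\<forall>n. \<forall>f\<in>borel_measurable (PiM {..<Suc n} (\<lambda>_. M)).
      (\<integral>\<^sup>+\<omega>. f (restrict \<omega> {..<Suc n}) \<partial>P) =
      (\<integral>\<^sup>+\<omega>. \<integral>\<^sup>+z. f ((restrict \<omega> {..<n})(n := z)) \<partial>k n (restrict \<omega> {..<n}) \<partial>P))"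
proof -
  have "k i \<in> PiM {0..<i} (\<lambda>_. M) \<rightarrow>\<^sub>M subprob_algebra M" for i
    using measurable_prob_algebraD[OF k] by (simp add: atLeast0LessThan)
  moreover have "prob_space (k i x)" if "x \<in> space (PiM {0..<i} (\<lambda>_. M))" for i x
    using measurable_space[OF k, of x i] that by (simp add: atLeast0LessThan space_prob_algebra)
  ultimately interpret Ionescu_Tulcea k "\<lambda>_. M" by (rule Ionescu_Tulcea.intro)
  let ?c = "\<lambda>n. C 0 n (\<lambda>x. undefined)"
  \<comment> \<open>\<open>CI\<close> passes through the least initial segment containing the index
    set; for an initial segment this is the segment itself.\<close>
  have up_to_eq: "up_to {0..<n} = n" for n
  proof (rule antisym)
    show "up_to {0..<n} \<le> n" by (subst up_to_iff) auto
    show "n \<le> up_to {0..<n}"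
    proof (rule ccontr)
      assume "\<not> n \<le> up_to {0..<n}"
      then show False using up_to_less[of "{0..<n}" "up_to {0..<n}"] by simp
    qed
  qed
  have u: "(\<lambda>x. undefined) \<in> space (PiM {0..<0 :: nat} (\<lambda>_. M))" by (simp add: space_PiM)
  have sets_c: "sets (?c n) = sets (PiM {0..<n} (\<lambda>_. M))" for n using sets_C[OF u, of n] by simp
  have marginal: "distr PF.lim (PiM {0..<n} (\<lambda>_. M)) (\<lambda>\<omega>. restrict \<omega> {0..<n}) = ?c n" for n
  proof -
    have "distr PF.lim (PiM {0..<n} (\<lambda>_. M)) (\<lambda>\<omega>. restrict \<omega> {0..<n}) = CI {0..<n}"
      by (rule distr_lim) simp
    also have "\<dots> = distr (?c n) (?c n) (\<lambda>\<omega>. \<omega>)"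
      unfolding CI_def up_to_eq
    proof (rule distr_cong)
      fix \<omega> assume "\<omega> \<in> space (?c n)"
      then have "\<omega> \<in> space (PiM {0..<n} (\<lambda>_. M))" using sets_eq_imp_space_eq[OF sets_c] by simp
      then show "restrict \<omega> {0..<n} = \<omega>" by (simp add: space_PiM PiE_restrict)
    qed (simp_all add: sets_c)
    finally show ?thesis by (simp add: distr_id)
  qed
  have meas: "(\<lambda>\<omega>. restrict \<omega> {0..<n}) \<in> PF.lim \<rightarrow>\<^sub>M PiM {0..<n} (\<lambda>_. M)" for n
    unfolding measurable_cong_sets[OF PF.sets_lim refl] by (rule measurable_restrict_subset) simp
  have lim: "(\<integral>\<^sup>+\<omega>. g (restrict \<omega> {0..<n}) \<partial>PF.lim) = (\<integral>\<^sup>+\<omega>. g \<omega> \<partial>?c n)"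
    if "g \<in> borel_measurable (PiM {0..<n} (\<lambda>_. M))" for g n
    unfolding marginal[symmetric] using nn_integral_distr[OF meas, of g n] that by simp
  have "(\<integral>\<^sup>+\<omega>. f (restrict \<omega> {0..<Suc n}) \<partial>PF.lim) =
      (\<integral>\<^sup>+\<omega>. \<integral>\<^sup>+z. f ((restrict \<omega> {0..<n})(n := z)) \<partial>k n (restrict \<omega> {0..<n}) \<partial>PF.lim)"
    if f: "f \<in> borel_measurable (PiM {0..<Suc n} (\<lambda>_. M))" for f n
  proof -
    have eP: "eP n \<in> ?c n \<rightarrow>\<^sub>M subprob_algebra (PiM {0..<Suc n} (\<lambda>_. M))"
      unfolding measurable_cong_sets[OF sets_c refl] by (rule measurable_eP)
    have "(\<integral>\<^sup>+\<omega>. f (restrict \<omega> {0..<Suc n}) \<partial>PF.lim) = (\<integral>\<^sup>+\<omega>. f \<omega> \<partial>?c (Suc n))"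
      using f by (rule lim)
    also have "\<dots> = (\<integral>\<^sup>+\<omega>. \<integral>\<^sup>+y. f y \<partial>eP n \<omega> \<partial>?c n)"
      using nn_integral_bind[OF f eP] by simp
    also have "\<dots> = (\<integral>\<^sup>+\<omega>. \<integral>\<^sup>+y. f y \<partial>eP n (restrict \<omega> {0..<n}) \<partial>PF.lim)"
      using measurable_compose[OF measurable_eP nn_integral_measurable_subprob_algebra[OF f]]
      by (rule lim[symmetric])
    also have "\<dots> = (\<integral>\<^sup>+\<omega>. \<integral>\<^sup>+z. f ((restrict \<omega> {0..<n})(n := z)) \<partial>k n (restrict \<omega> {0..<n}) \<partial>PF.lim)"
      using f measurable_space[OF meas] by (intro nn_integral_cong nn_integral_eP) auto
    finally show ?thesis .
  qed
  moreover have "prob_space PF.lim"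
    using meas[of 0] prob_space_C[OF u, of 0, folded marginal] by (rule prob_space_distrD)
  ultimately show ?thesis
    using PF.sets_lim
    by (intro exI[of _ PF.lim]) (simp add: atLeast0LessThan)
qed

section \<open>Histories and the one-step kernel of the history process\<close>

lemma space_path_space [simp]: "space path_space = UNIV"
  by (simp add: path_space_def space_PiM)

lemma measurable_coordinate [measurable]: "(\<lambda>\<omega>. \<omega> n) \<in> path_space \<rightarrow>\<^sub>M borel"
  unfolding path_space_def by (rule measurable_component_singleton) simp

lemma measurable_fst_borel [measurable]:
  "fst \<in> (borel :: ('x::second_countable_topology \<times> 'u::second_countable_topology) measure) \<rightarrow>\<^sub>M borel"
  and measurable_snd_borel [measurable]:
  "snd \<in> (borel :: ('x \<times> 'u) measure) \<rightarrow>\<^sub>M borel"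
  by (simp_all add: borel_prod[symmetric])

lemma measurable_Pair_borel [measurable (raw)]:
  fixes f :: "_ \<Rightarrow> 'x::second_countable_topology" and g :: "_ \<Rightarrow> 'u::second_countable_topology"
  shows "f \<in> M \<rightarrow>\<^sub>M borel \<Longrightarrow> g \<in> M \<rightarrow>\<^sub>M borel \<Longrightarrow> (\<lambda>z. (f z, g z)) \<in> M \<rightarrow>\<^sub>M borel"
  unfolding borel_prod[symmetric] by (rule measurable_Pair)

lemma measurable_restrict_path: "(\<lambda>\<omega>. restrict \<omega> {..<n}) \<in> path_space \<rightarrow>\<^sub>M (\<Pi>\<^sub>M i\<in>{..<n}. borel)"
  unfolding path_space_def by (rule measurable_restrict_subset) simp

lemma measurable_history [measurable]: "history n \<in> path_space \<rightarrow>\<^sub>M history_space n"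
  unfolding history_def[abs_def] history_space_def
  by (intro measurable_Pair measurable_restrict_path) measurable

lemma measurable_snd_history [measurable]: "snd \<in> history_space n \<rightarrow>\<^sub>M borel"
  by (simp add: history_space_def)

definition extend :: "nat \<Rightarrow> ('x, 'u) history \<Rightarrow> 'u \<Rightarrow> 'x \<Rightarrow> ('x, 'u) history" where
  "extend n h u x' = ((fst h)(n := (snd h, u)), x')"

lemma history_Suc:
  "history (Suc n) \<omega> = extend n (history n \<omega>) (snd (\<omega> n)) (fst (\<omega> (Suc n)))"
  by (auto simp: history_def extend_def fun_eq_iff restrict_def less_Suc_eq)

lemma measurable_extend:
  "(\<lambda>((h, u), x'). extend n h u x') \<in>
     (history_space n \<Otimes>\<^sub>M (borel :: 'u::borel_space measure)) \<Otimes>\<^sub>M (borel :: 'x::borel_space measure)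
       \<rightarrow>\<^sub>M history_space (Suc n)"
proof -
  have [measurable]: "fst \<in> history_space n \<rightarrow>\<^sub>M (\<Pi>\<^sub>M i\<in>{..<n}. (borel :: ('x \<times> 'u) measure))"
    by (simp add: history_space_def)
  have "(\<lambda>z. (fst (fst (fst z)))(n := (snd (fst (fst z)), snd (fst z)))) \<in>
      (history_space n \<Otimes>\<^sub>M (borel :: 'u::borel_space measure)) \<Otimes>\<^sub>M (borel :: 'x::borel_space measure)
       \<rightarrow>\<^sub>M (\<Pi>\<^sub>M i\<in>{..<Suc n}. (borel :: ('x \<times> 'u) measure))"
    by (rule measurable_fun_upd[where J = "{..<n}"]) (auto simp: lessThan_Suc)
  then show ?thesis
    unfolding history_space_def[of "Suc n"] extend_def split_beta' by simp
qed

text \<open>The transition kernel of the history process, seen as a Markov process whose state space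
  changes with time.\<close>

definition next_kernel ::
  "('x::borel_space \<times> 'u::borel_space \<Rightarrow> 'x measure) \<Rightarrow> nat \<Rightarrow> (('x, 'u) history \<Rightarrow> 'u measure) \<Rightarrow>
    ('x, 'u) history \<Rightarrow> ('x, 'u) history measure" where
  "next_kernel T n \<kappa> h = \<kappa> h \<bind> (\<lambda>u. distr (T (snd h, u)) (history_space (Suc n)) (extend n h u))"

context
  fixes T :: "'x::borel_space \<times> 'u::borel_space \<Rightarrow> 'x measure"
  assumes T [measurable]: "T \<in> borel \<rightarrow>\<^sub>M prob_algebra borel"
begin

lemma T_next_measurable:
  "(\<lambda>(h, u). T (snd h, u)) \<in> history_space n \<Otimes>\<^sub>M borel \<rightarrow>\<^sub>M prob_algebra borel"
  unfolding split_beta' by (rule measurable_compose[OF _ T]) measurable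

lemma next_state_measurable:
  "(\<lambda>(h, u). distr (T (snd h, u)) (history_space (Suc n)) (extend n h u)) \<in>
     history_space n \<Otimes>\<^sub>M borel \<rightarrow>\<^sub>M prob_algebra (history_space (Suc n))"
  unfolding split_beta'
  by (rule measurable_distr_prob_space2[OF T_next_measurable[unfolded split_beta']])
    (use measurable_extend in \<open>simp add: split_beta'\<close>)

lemma next_kernel_measurable:
  assumes \<kappa>: "\<kappa> \<in> history_space n \<rightarrow>\<^sub>M prob_algebra borel"
  shows "next_kernel T n \<kappa> \<in> history_space n \<rightarrow>\<^sub>M prob_algebra (history_space (Suc n))"
  unfolding next_kernel_def[abs_def] using \<kappa> next_state_measurable by (rule measurable_bind_prob_space2)

lemma nn_integral_next_kernel:
  assumes \<kappa>: "\<kappa> \<in> history_space n \<rightarrow>\<^sub>M prob_algebra borel" and h: "h \<in> space (history_space n)"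
    and f: "f \<in> borel_measurable (history_space (Suc n))"
  shows "(\<integral>\<^sup>+y. f y \<partial>next_kernel T n \<kappa> h) = (\<integral>\<^sup>+u. \<integral>\<^sup>+x'. f (extend n h u x') \<partial>T (snd h, u) \<partial>\<kappa> h)"
proof -
  have \<kappa>h: "sets (\<kappa> h) = sets borel" using measurable_space[OF \<kappa> h] by (simp add: space_prob_algebra)
  have "(\<lambda>u. distr (T (snd h, u)) (history_space (Suc n)) (extend n h u)) \<in>
      borel \<rightarrow>\<^sub>M prob_algebra (history_space (Suc n))"
    using measurable_compose[OF measurable_Pair1'[OF h] next_state_measurable] by simp
  then have "(\<lambda>u. distr (T (snd h, u)) (history_space (Suc n)) (extend n h u)) \<in>
      \<kappa> h \<rightarrow>\<^sub>M subprob_algebra (history_space (Suc n))"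
    unfolding measurable_cong_sets[OF \<kappa>h refl] by (rule measurable_prob_algebraD)
  then have "(\<integral>\<^sup>+y. f y \<partial>next_kernel T n \<kappa> h) =
      (\<integral>\<^sup>+u. \<integral>\<^sup>+y. f y \<partial>distr (T (snd h, u)) (history_space (Suc n)) (extend n h u) \<partial>\<kappa> h)"
    unfolding next_kernel_def by (rule nn_integral_bind[OF f])
  also have "\<dots> = (\<integral>\<^sup>+u. \<integral>\<^sup>+x'. f (extend n h u x') \<partial>T (snd h, u) \<partial>\<kappa> h)"
  proof (rule nn_integral_cong, rule nn_integral_distr)
    fix u
    have "sets (T (snd h, u)) = sets borel"
      using measurable_space[OF T, of "(snd h, u)"] by (simp add: space_prob_algebra)
    moreover have "extend n h u \<in> borel \<rightarrow>\<^sub>M history_space (Suc n)"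
      using measurable_compose[OF measurable_Pair1'[of "(h, u)" "history_space n \<Otimes>\<^sub>M borel" borel] measurable_extend]
        h by (simp add: space_pair_measure)
    ultimately show "extend n h u \<in> T (snd h, u) \<rightarrow>\<^sub>M history_space (Suc n)"
      using measurable_cong_sets by blast
  qed (use f in simp)
  finally show ?thesis .
qed

end

context
  fixes T :: "'x::borel_space \<times> 'u::borel_space \<Rightarrow> 'x measure"
  assumes T [measurable]: "T \<in> borel \<rightarrow>\<^sub>M prob_algebra borel"
begin

lemma prob_space_kernel: "prob_space (T z)" "sets (T z) = sets borel"
  using measurable_space[OF T, of z] by (simp_all add: space_prob_algebra)

text \<open>A coordinate of a path is a pair, so each step of the construction draws a state and
  then a control. Both identities of a path law are read off with \<open>law'\<close>: at time
  \<open>n\<close> for the control, at time \<open>Suc n\<close> for the next state.\<close>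

lemma path_law_exists_borel:
  assumes \<kappa>: "\<And>n. \<kappa> n \<in> history_space n \<rightarrow>\<^sub>M prob_algebra borel"
  shows "\<exists>P. path_law T \<kappa> x P"
proof -
  let ?M = "\<lambda>n. \<Pi>\<^sub>M i\<in>{..<n}. (borel :: ('x \<times> 'u) measure)"
  \<comment> \<open>The law of the \<open>n\<close>-th state given the pairs before it; only time
    \<open>0\<close> refers to the initial state.\<close>
  define IC where "IC n \<omega> = (case n of 0 \<Rightarrow> return borel x | Suc j \<Rightarrow> T (\<omega> j))"
    for n and \<omega> :: "nat \<Rightarrow> 'x \<times> 'u"
  define k where "k n \<omega> = IC n \<omega> \<bind> (\<lambda>x'. distr (\<kappa> n (\<omega>, x')) borel (Pair x'))"
    for n and \<omega> :: "nat \<Rightarrow> 'x \<times> 'u"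
  have IC: "IC n \<in> ?M n \<rightarrow>\<^sub>M prob_algebra borel" for n
  proof (cases n)
    case 0
    then show ?thesis
      by (simp add: IC_def[abs_def] space_prob_algebra prob_space_return)
  next
    case (Suc j)
    have "(\<lambda>\<omega>. \<omega> j) \<in> ?M n \<rightarrow>\<^sub>M borel" by (rule measurable_component_singleton) (simp add: Suc)
    then have "(\<lambda>\<omega>. T (\<omega> j)) \<in> ?M n \<rightarrow>\<^sub>M prob_algebra borel" using T by (rule measurable_compose)
    then show ?thesis by (simp add: IC_def[abs_def] Suc)
  qed
  have \<kappa>': "(\<lambda>(\<omega>, x'). \<kappa> n (\<omega>, x')) \<in> ?M n \<Otimes>\<^sub>M borel \<rightarrow>\<^sub>M prob_algebra borel" for n
    using \<kappa>[of n] by (simp add: history_space_def)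
  have ctrl: "(\<lambda>(\<omega>, x'). distr (\<kappa> n (\<omega>, x')) borel (Pair x')) \<in> ?M n \<Otimes>\<^sub>M borel \<rightarrow>\<^sub>M prob_algebra borel" for n
    unfolding split_beta'
    by (rule measurable_distr_prob_space2[OF \<kappa>'[unfolded split_beta']]) (simp add: split_beta')
  have k: "k n \<in> ?M n \<rightarrow>\<^sub>M prob_algebra borel" for n
    unfolding k_def[abs_def] using IC ctrl by (rule measurable_bind_prob_space2)
  have k_int: "(\<integral>\<^sup>+z. g z \<partial>k n \<omega>) = (\<integral>\<^sup>+x'. \<integral>\<^sup>+u. g (x', u) \<partial>\<kappa> n (\<omega>, x') \<partial>IC n \<omega>)"
    if \<omega>: "\<omega> \<in> space (?M n)" and g: "g \<in> borel_measurable borel" for g n \<omega>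
  proof -
    have IC\<omega>: "sets (IC n \<omega>) = sets borel" using measurable_space[OF IC \<omega>] by (simp add: space_prob_algebra)
    have "(\<lambda>x'. distr (\<kappa> n (\<omega>, x')) borel (Pair x')) \<in> borel \<rightarrow>\<^sub>M prob_algebra borel"
      using measurable_compose[OF measurable_Pair1'[OF \<omega>] ctrl] by simp
    then have "(\<lambda>x'. distr (\<kappa> n (\<omega>, x')) borel (Pair x')) \<in> IC n \<omega> \<rightarrow>\<^sub>M subprob_algebra borel"
      unfolding measurable_cong_sets[OF IC\<omega> refl] by (rule measurable_prob_algebraD)
    then have "(\<integral>\<^sup>+z. g z \<partial>k n \<omega>) = (\<integral>\<^sup>+x'. \<integral>\<^sup>+z. g z \<partial>distr (\<kappa> n (\<omega>, x')) borel (Pair x') \<partial>IC n \<omega>)"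
      unfolding k_def by (rule nn_integral_bind[OF g])
    also have "\<dots> = (\<integral>\<^sup>+x'. \<integral>\<^sup>+u. g (x', u) \<partial>\<kappa> n (\<omega>, x') \<partial>IC n \<omega>)"
    proof (rule nn_integral_cong, rule nn_integral_distr)
      fix x'
      have "sets (\<kappa> n (\<omega>, x')) = sets borel"
        using measurable_space[OF \<kappa>, of "(\<omega>, x')" n] \<omega>
        by (simp add: space_prob_algebra history_space_def space_pair_measure)
      then have "\<kappa> n (\<omega>, x') \<rightarrow>\<^sub>M (borel :: ('x \<times> 'u) measure) = borel \<rightarrow>\<^sub>M borel"
        by (rule measurable_cong_sets) simp
      then show "Pair x' \<in> \<kappa> n (\<omega>, x') \<rightarrow>\<^sub>M (borel :: ('x \<times> 'u) measure)" by simp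
    qed (use g in simp)
    finally show ?thesis .
  qed
  obtain P where P: "prob_space P" "sets P = sets path_space"
    and law: "\<And>n f. f \<in> borel_measurable (?M (Suc n)) \<Longrightarrow>
      (\<integral>\<^sup>+\<omega>. f (restrict \<omega> {..<Suc n}) \<partial>P) =
      (\<integral>\<^sup>+\<omega>. \<integral>\<^sup>+z. f ((restrict \<omega> {..<n})(n := z)) \<partial>k n (restrict \<omega> {..<n}) \<partial>P)"
    using ionescu_tulcea_limit[OF k] unfolding path_space_def by blast
  interpret P: prob_space P by (rule P)
  have space_P: "space P = UNIV" using sets_eq_imp_space_eq[OF P(2)] by simp
  have PM: "P \<rightarrow>\<^sub>M N = path_space \<rightarrow>\<^sub>M N" for N :: "'z measure"
    by (rule measurable_cong_sets[OF P(2) refl])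
  have rs: "restrict \<omega> {..<n} \<in> space (?M n)" for \<omega> :: "nat \<Rightarrow> 'x \<times> 'u" and n
    by (simp add: space_PiM)
  have law': "(\<integral>\<^sup>+\<omega>. g (history n \<omega>) (snd (\<omega> n)) \<partial>P) =
      (\<integral>\<^sup>+\<omega>. \<integral>\<^sup>+x'. \<integral>\<^sup>+u. g (restrict \<omega> {..<n}, x') u
        \<partial>\<kappa> n (restrict \<omega> {..<n}, x') \<partial>IC n (restrict \<omega> {..<n}) \<partial>P)"
    if g: "(\<lambda>(h, u). g h u) \<in> borel_measurable (history_space n \<Otimes>\<^sub>M borel)" for g n
  proof -
    define f where "f \<omega> = g (restrict \<omega> {..<n}, fst (\<omega> n)) (snd (\<omega> n))" for \<omega>
    have c: "(\<lambda>\<omega>. \<omega> n) \<in> ?M (Suc n) \<rightarrow>\<^sub>M borel"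
      by (rule measurable_component_singleton) simp
    have r: "(\<lambda>\<omega>. restrict \<omega> {..<n}) \<in> ?M (Suc n) \<rightarrow>\<^sub>M ?M n"
      by (rule measurable_restrict_subset) auto
    have "(\<lambda>\<omega>. ((restrict \<omega> {..<n}, fst (\<omega> n)), snd (\<omega> n))) \<in> ?M (Suc n) \<rightarrow>\<^sub>M history_space n \<Otimes>\<^sub>M borel"
      unfolding history_space_def
      by (intro measurable_Pair r measurable_compose[OF c]) measurable
    from measurable_compose[OF this g] have f: "f \<in> borel_measurable (?M (Suc n))"
      by (simp add: f_def[abs_def])
    have "(\<integral>\<^sup>+\<omega>. g (history n \<omega>) (snd (\<omega> n)) \<partial>P) = (\<integral>\<^sup>+\<omega>. f (restrict \<omega> {..<Suc n}) \<partial>P)"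
      by (intro nn_integral_cong) (simp add: f_def history_def Int_absorb1 restrict_restrict)
    also have "\<dots> = (\<integral>\<^sup>+\<omega>. \<integral>\<^sup>+z. f ((restrict \<omega> {..<n})(n := z)) \<partial>k n (restrict \<omega> {..<n}) \<partial>P)"
      using f by (rule law)
    also have "\<dots> = (\<integral>\<^sup>+\<omega>. \<integral>\<^sup>+z. g (restrict \<omega> {..<n}, fst z) (snd z) \<partial>k n (restrict \<omega> {..<n}) \<partial>P)"
    proof (intro nn_integral_cong)
      fix \<omega> and z :: "'x \<times> 'u"
      have "restrict ((restrict \<omega> {..<n})(n := z)) {..<n} = restrict \<omega> {..<n}" by auto
      then show "f ((restrict \<omega> {..<n})(n := z)) = g (restrict \<omega> {..<n}, fst z) (snd z)"
        by (simp add: f_def)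
    qed
    also have "\<dots> = (\<integral>\<^sup>+\<omega>. \<integral>\<^sup>+x'. \<integral>\<^sup>+u. g (restrict \<omega> {..<n}, x') u
        \<partial>\<kappa> n (restrict \<omega> {..<n}, x') \<partial>IC n (restrict \<omega> {..<n}) \<partial>P)"
    proof (intro nn_integral_cong)
      fix \<omega> :: "nat \<Rightarrow> 'x \<times> 'u"
      have "(\<lambda>z. ((restrict \<omega> {..<n}, fst z), snd z)) \<in> (borel :: ('x \<times> 'u) measure) \<rightarrow>\<^sub>M history_space n \<Otimes>\<^sub>M borel"
        unfolding history_space_def by (intro measurable_Pair measurable_const rs) measurable
      from measurable_compose[OF this g]
      show "(\<integral>\<^sup>+z. g (restrict \<omega> {..<n}, fst z) (snd z) \<partial>k n (restrict \<omega> {..<n})) =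
        (\<integral>\<^sup>+x'. \<integral>\<^sup>+u. g (restrict \<omega> {..<n}, x') u \<partial>\<kappa> n (restrict \<omega> {..<n}, x') \<partial>IC n (restrict \<omega> {..<n}))"
        by (subst k_int[OF rs]) (simp_all add: split_beta')
    qed
    finally show ?thesis .
  qed
  have \<kappa>_prob: "prob_space (\<kappa> n h)" "sets (\<kappa> n h) = sets borel" if "h \<in> space (history_space n)" for n h
    using measurable_space[OF \<kappa> that] by (simp_all add: space_prob_algebra)
  have rsh: "(restrict \<omega> {..<n}, x') \<in> space (history_space n)" for \<omega> :: "nat \<Rightarrow> 'x \<times> 'u" and n x'
    by (simp add: history_space_def space_pair_measure space_PiM)
  have \<kappa>_const: "(\<integral>\<^sup>+u. c \<partial>\<kappa> n (restrict \<omega> {..<n}, x')) = c" for c n \<omega> x'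
    using prob_space.emeasure_space_1[OF \<kappa>_prob(1)[OF rsh]] by simp
  have "(\<integral>\<^sup>+\<omega>. indicator (- {x}) (snd (history 0 \<omega>)) \<partial>P) =
      (\<integral>\<^sup>+\<omega>. \<integral>\<^sup>+x'. \<integral>\<^sup>+u. indicator (- {x}) (snd (restrict \<omega> {..<0}, x'))
        \<partial>\<kappa> 0 (restrict \<omega> {..<0}, x') \<partial>IC 0 (restrict \<omega> {..<0}) \<partial>P)"
    by (rule law') measurable
  also have "\<dots> = (\<integral>\<^sup>+\<omega>. 0 \<partial>P)"
    unfolding \<kappa>_const by (simp add: IC_def nn_integral_return)
  finally have "(\<integral>\<^sup>+\<omega>. indicator (- {x}) (snd (history 0 \<omega>)) \<partial>P) = (0 :: ennreal)" by simp
  then have "AE \<omega> in P. indicator (- {x}) (snd (history 0 \<omega>)) = (0 :: ennreal)"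
    by (subst (asm) nn_integral_0_iff_AE) (simp_all add: PM)
  then have x0: "AE \<omega> in P. fst (\<omega> 0) = x"
    by eventually_elim (auto simp: history_def indicator_def split: if_splits)
  have ctrl_law: "emeasure P {\<omega>. history n \<omega> \<in> A \<and> snd (\<omega> n) \<in> B} =
      (\<integral>\<^sup>+\<omega>. indicator A (history n \<omega>) * emeasure (\<kappa> n (history n \<omega>)) B \<partial>P)"
    if A[measurable]: "A \<in> sets (history_space n)" and B[measurable]: "B \<in> sets borel" for n A B
  proof -
    have "{\<omega> \<in> space path_space. history n \<omega> \<in> A \<and> snd (\<omega> n) \<in> B} \<in> sets path_space" by measurable
    then have "emeasure P {\<omega>. history n \<omega> \<in> A \<and> snd (\<omega> n) \<in> B} =
        (\<integral>\<^sup>+\<omega>. indicator {\<omega>. history n \<omega> \<in> A \<and> snd (\<omega> n) \<in> B} \<omega> \<partial>P)"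
      using P(2) by simp
    also have "\<dots> = (\<integral>\<^sup>+\<omega>. indicator A (history n \<omega>) * indicator B (snd (\<omega> n)) \<partial>P)"
      by (intro nn_integral_cong) (auto simp: indicator_def)
    also have "\<dots> = (\<integral>\<^sup>+\<omega>. \<integral>\<^sup>+x'. \<integral>\<^sup>+u. indicator A (restrict \<omega> {..<n}, x') * indicator B u
        \<partial>\<kappa> n (restrict \<omega> {..<n}, x') \<partial>IC n (restrict \<omega> {..<n}) \<partial>P)"
      by (rule law') measurable
    \<comment> \<open>The innermost integrand becomes constant in the control, so that
      \<open>law'\<close> can be applied backwards in the last step.\<close>
    also have "\<dots> = (\<integral>\<^sup>+\<omega>. \<integral>\<^sup>+x'. \<integral>\<^sup>+u. indicator A (restrict \<omega> {..<n}, x') * emeasure (\<kappa> n (restrict \<omega> {..<n}, x')) B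
        \<partial>\<kappa> n (restrict \<omega> {..<n}, x') \<partial>IC n (restrict \<omega> {..<n}) \<partial>P)"
      using B \<kappa>_prob(2)[OF rsh] unfolding \<kappa>_const
      by (intro nn_integral_cong) (simp add: nn_integral_cmult_indicator)
    also have "\<dots> = (\<integral>\<^sup>+\<omega>. indicator A (history n \<omega>) * emeasure (\<kappa> n (history n \<omega>)) B \<partial>P)"
    proof (rule law'[symmetric])
      have "(\<lambda>h. emeasure (\<kappa> n h) B) \<in> borel_measurable (history_space n)"
        using measurable_compose[OF measurable_prob_algebraD[OF \<kappa>]] measurable_emeasure_subprob_algebra[OF B] by blast
      then show "(\<lambda>(h, u). indicator A h * emeasure (\<kappa> n h) B) \<in> borel_measurable (history_space n \<Otimes>\<^sub>M borel)"
        by measurable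
    qed
    finally show ?thesis .
  qed
  have state_law: "emeasure P {\<omega>. (history n \<omega>, snd (\<omega> n)) \<in> A \<and> fst (\<omega> (Suc n)) \<in> B} =
      (\<integral>\<^sup>+\<omega>. indicator A (history n \<omega>, snd (\<omega> n)) * emeasure (T (\<omega> n)) B \<partial>P)"
    if A[measurable]: "A \<in> sets (history_space n \<Otimes>\<^sub>M borel)" and B[measurable]: "B \<in> sets borel" for n A B
  proof -
    \<comment> \<open>The condition at time \<open>n\<close> and on the next state, expressed
      through the history at \<open>Suc n\<close>, to which \<open>law'\<close> applies; the
      integral over the following control is then that of a constant.\<close>
    define g where "g h = indicator A ((restrict (fst h) {..<n}, fst (fst h n)), snd (fst h n)) * (indicator B (snd h) :: ennreal)"
      for h :: "(nat \<Rightarrow> 'x \<times> 'u) \<times> 'x"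
    have c: "(\<lambda>h. fst h n) \<in> history_space (Suc n) \<rightarrow>\<^sub>M (borel :: ('x \<times> 'u) measure)"
      unfolding history_space_def
      by (rule measurable_compose[OF measurable_fst]) (rule measurable_component_singleton, simp)
    have r: "(\<lambda>h :: ('x, 'u) history. restrict (fst h) {..<n}) \<in> history_space (Suc n) \<rightarrow>\<^sub>M ?M n"
      unfolding history_space_def
      by (rule measurable_compose[OF measurable_fst]) (rule measurable_restrict_subset, auto)
    have "(\<lambda>h :: ('x, 'u) history. ((restrict (fst h) {..<n}, fst (fst h n)), snd (fst h n))) \<in>
        history_space (Suc n) \<rightarrow>\<^sub>M history_space n \<Otimes>\<^sub>M borel"
      unfolding history_space_def[of n]
      by (intro measurable_Pair r measurable_compose[OF c measurable_fst_borel]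
          measurable_compose[OF c measurable_snd_borel])
    from measurable_compose[OF this borel_measurable_indicator[OF A]]
    have g: "g \<in> borel_measurable (history_space (Suc n))"
      unfolding g_def[abs_def] by measurable
    have g_ext: "g (restrict \<omega> {..<Suc n}, x') = indicator A (history n \<omega>, snd (\<omega> n)) * indicator B x'" for \<omega> x'
      by (simp add: g_def history_def Int_absorb1 restrict_restrict)
    have "{\<omega> \<in> space path_space. (history n \<omega>, snd (\<omega> n)) \<in> A \<and> fst (\<omega> (Suc n)) \<in> B} \<in> sets path_space"
      by measurable
    then have "emeasure P {\<omega>. (history n \<omega>, snd (\<omega> n)) \<in> A \<and> fst (\<omega> (Suc n)) \<in> B} =
        (\<integral>\<^sup>+\<omega>. indicator {\<omega>. (history n \<omega>, snd (\<omega> n)) \<in> A \<and> fst (\<omega> (Suc n)) \<in> B} \<omega> \<partial>P)"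
      using P(2) by simp
    also have "\<dots> = (\<integral>\<^sup>+\<omega>. g (history (Suc n) \<omega>) \<partial>P)"
      unfolding history_def[of "Suc n"] g_ext by (intro nn_integral_cong) (auto simp: indicator_def)
    also have "\<dots> = (\<integral>\<^sup>+\<omega>. \<integral>\<^sup>+x'. \<integral>\<^sup>+u. g (restrict \<omega> {..<Suc n}, x')
        \<partial>\<kappa> (Suc n) (restrict \<omega> {..<Suc n}, x') \<partial>IC (Suc n) (restrict \<omega> {..<Suc n}) \<partial>P)"
      by (rule law') (use g in measurable)
    also have "\<dots> = (\<integral>\<^sup>+\<omega>. \<integral>\<^sup>+x'. indicator A (history n \<omega>, snd (\<omega> n)) * indicator B x' \<partial>T (\<omega> n) \<partial>P)"
      unfolding \<kappa>_const g_ext by (simp add: IC_def)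
    also have "\<dots> = (\<integral>\<^sup>+\<omega>. indicator A (history n \<omega>, snd (\<omega> n)) * emeasure (T (\<omega> n)) B \<partial>P)"
      using B prob_space_kernel(2) by (intro nn_integral_cong) (simp add: nn_integral_cmult_indicator)
    finally show ?thesis .
  qed
  have "path_law T \<kappa> x P"
    unfolding path_law_def nn_integral_completion using P x0 ctrl_law state_law by blast
  then show ?thesis ..
qed

end

text \<open>A choice operator, because the recursion for \<open>history_law\<close> needs the
  version as a function of the measure.\<close>

definition borel_version :: "'h measure \<Rightarrow> ('h \<Rightarrow> 'u::topological_space measure) \<Rightarrow> 'h \<Rightarrow> 'u measure" where
  "borel_version \<mu> k = (SOME \<kappa>. \<kappa> \<in> \<mu> \<rightarrow>\<^sub>M prob_algebra borel \<and> (AE h in \<mu>. k h = \<kappa> h))"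

text \<open>The completion disappears: as a supremum over simple functions below the integrand, the
  nonnegative integral has the same value for \<open>P\<close> and for its completion.\<close>

lemma path_lawD:
  assumes "path_law T \<pi> x P"
  shows "prob_space P" "sets P = sets path_space" "AE \<omega> in P. fst (\<omega> 0) = x"
    "A \<in> sets (history_space n) \<Longrightarrow> B \<in> sets borel \<Longrightarrow>
      emeasure P {\<omega>. history n \<omega> \<in> A \<and> snd (\<omega> n) \<in> B} =
      (\<integral>\<^sup>+\<omega>. indicator A (history n \<omega>) * emeasure (\<pi> n (history n \<omega>)) B \<partial>P)"
    "A' \<in> sets (history_space n \<Otimes>\<^sub>M borel) \<Longrightarrow> B' \<in> sets borel \<Longrightarrow>
      emeasure P {\<omega>. (history n \<omega>, snd (\<omega> n)) \<in> A' \<and> fst (\<omega> (Suc n)) \<in> B'} =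
      (\<integral>\<^sup>+\<omega>. indicator A' (history n \<omega>, snd (\<omega> n)) * emeasure (T (\<omega> n)) B' \<partial>P)"
  using assms unfolding path_law_def nn_integral_completion by blast+

lemma path_law_space: "path_law T \<pi> x P \<Longrightarrow> space P = UNIV"
  using sets_eq_imp_space_eq[OF path_lawD(2)] by simp

lemma path_law_measurable: "path_law T \<pi> x P \<Longrightarrow> f \<in> path_space \<rightarrow>\<^sub>M N \<Longrightarrow> f \<in> P \<rightarrow>\<^sub>M N"
  using measurable_cong_sets[OF path_lawD(2) refl] by blast

lemma path_law_cong_AE:
  assumes P: "path_law T \<pi> x P" and eq: "\<And>n. AE \<omega> in P. \<pi> n (history n \<omega>) = \<pi>' n (history n \<omega>)"
  shows "path_law T \<pi>' x P"
proof -
  have "(\<integral>\<^sup>+\<omega>. indicator A (history n \<omega>) * emeasure (\<pi> n (history n \<omega>)) B \<partial>P) =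
      (\<integral>\<^sup>+\<omega>. indicator A (history n \<omega>) * emeasure (\<pi>' n (history n \<omega>)) B \<partial>P)" for n A B
    using eq[of n] by (intro nn_integral_cong_AE) (auto elim!: eventually_mono)
  with P show ?thesis
    unfolding path_law_def nn_integral_completion by simp
qed

context
  fixes T :: "'x::borel_space \<times> 'u::borel_space \<Rightarrow> 'x measure"
  assumes T [measurable]: "T \<in> borel \<rightarrow>\<^sub>M prob_algebra borel"
begin

lemma nn_integral_next_state:
  assumes P: "path_law T \<pi> x P"
    and f: "f \<in> borel_measurable ((history_space n \<Otimes>\<^sub>M borel) \<Otimes>\<^sub>M borel)"
  shows "(\<integral>\<^sup>+\<omega>. f ((history n \<omega>, snd (\<omega> n)), fst (\<omega> (Suc n))) \<partial>P) =
    (\<integral>\<^sup>+\<omega>. \<integral>\<^sup>+x'. f ((history n \<omega>, snd (\<omega> n)), x') \<partial>T (\<omega> n) \<partial>P)"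
proof -
  have T_eq: "T (\<omega> n) = (\<lambda>(h, u). T (snd h, u)) (history n \<omega>, snd (\<omega> n))" for \<omega>
    by (simp add: history_def)
  show ?thesis
    unfolding T_eq
  proof (rule nn_integral_disintegration[OF path_lawD(1)[OF P] _ _ T_next_measurable[OF T] _ f])
    show "(\<lambda>\<omega>. (history n \<omega>, snd (\<omega> n))) \<in> P \<rightarrow>\<^sub>M history_space n \<Otimes>\<^sub>M borel"
      "(\<lambda>\<omega>. fst (\<omega> (Suc n))) \<in> P \<rightarrow>\<^sub>M borel"
      by (rule path_law_measurable[OF P], measurable)+
    show "emeasure P {\<omega> \<in> space P. (history n \<omega>, snd (\<omega> n)) \<in> A \<and> fst (\<omega> (Suc n)) \<in> B} =
      (\<integral>\<^sup>+\<omega>. indicator A (history n \<omega>, snd (\<omega> n)) *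
        emeasure ((\<lambda>(h, u). T (snd h, u)) (history n \<omega>, snd (\<omega> n))) B \<partial>P)"
      if "A \<in> sets (history_space n \<Otimes>\<^sub>M borel)" "B \<in> sets borel" for A B
      unfolding T_eq[symmetric] using path_lawD(5)[OF P that] path_law_space[OF P] by simp
  qed
qed

text \<open>Disintegration asks for a Borel kernel, hence the detour over some
  \<open>\<kappa>\<close> that agrees with the policy almost surely along the path.\<close>

lemma nn_integral_control:
  assumes P: "path_law T \<pi> x P" and \<kappa>: "\<kappa> \<in> history_space n \<rightarrow>\<^sub>M prob_algebra borel"
    and eq: "AE \<omega> in P. \<pi> n (history n \<omega>) = \<kappa> (history n \<omega>)"
    and f: "f \<in> borel_measurable (history_space n \<Otimes>\<^sub>M borel)"
  shows "(\<integral>\<^sup>+\<omega>. f (history n \<omega>, snd (\<omega> n)) \<partial>P) =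
    (\<integral>\<^sup>+\<omega>. \<integral>\<^sup>+u. f (history n \<omega>, u) \<partial>\<kappa> (history n \<omega>) \<partial>P)"
proof (rule nn_integral_disintegration[OF path_lawD(1)[OF P] _ _ \<kappa> _ f])
  show "history n \<in> P \<rightarrow>\<^sub>M history_space n" "(\<lambda>\<omega>. snd (\<omega> n)) \<in> P \<rightarrow>\<^sub>M borel"
    by (rule path_law_measurable[OF P], measurable)+
  fix A B assume AB: "A \<in> sets (history_space n :: ('x, 'u) history measure)" "B \<in> sets (borel :: 'u measure)"
  have "emeasure P {\<omega> \<in> space P. history n \<omega> \<in> A \<and> snd (\<omega> n) \<in> B} =
      (\<integral>\<^sup>+\<omega>. indicator A (history n \<omega>) * emeasure (\<pi> n (history n \<omega>)) B \<partial>P)"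
    using path_lawD(4)[OF P AB] path_law_space[OF P] by simp
  also have "\<dots> = (\<integral>\<^sup>+\<omega>. indicator A (history n \<omega>) * emeasure (\<kappa> (history n \<omega>)) B \<partial>P)"
    using eq by (intro nn_integral_cong_AE) (auto elim!: eventually_mono)
  finally show "emeasure P {\<omega> \<in> space P. history n \<omega> \<in> A \<and> snd (\<omega> n) \<in> B} =
      (\<integral>\<^sup>+\<omega>. indicator A (history n \<omega>) * emeasure (\<kappa> (history n \<omega>)) B \<partial>P)" .
qed

lemma distr_history_Suc:
  assumes P: "path_law T \<pi> x P" and \<kappa>: "\<kappa> \<in> history_space n \<rightarrow>\<^sub>M prob_algebra borel"
    and eq: "AE \<omega> in P. \<pi> n (history n \<omega>) = \<kappa> (history n \<omega>)"
  shows "distr P (history_space (Suc n)) (history (Suc n)) =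
    distr P (history_space n) (history n) \<bind> next_kernel T n \<kappa>"
proof (rule measure_eqI)
  have H: "history n \<in> P \<rightarrow>\<^sub>M history_space n" for n
    by (rule path_law_measurable[OF P]) measurable
  have dH: "distr P (history_space n) (history n) \<in> space (prob_algebra (history_space n))"
    using prob_space.prob_space_distr[OF path_lawD(1)[OF P] H] by (simp add: space_prob_algebra)
  note N = next_kernel_measurable[OF T \<kappa>]
  show "sets (distr P (history_space (Suc n)) (history (Suc n))) =
      sets (distr P (history_space n) (history n) \<bind> next_kernel T n \<kappa>)"
    using sets_bind'[OF dH N] by simp
  fix A assume "A \<in> sets (distr P (history_space (Suc n)) (history (Suc n)))"
  then have A: "A \<in> sets (history_space (Suc n))" by simp
  define f where "f z = (indicator A ((\<lambda>((h, u), x'). extend n h u x') z) :: ennreal)" for z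
  have f: "f \<in> borel_measurable ((history_space n \<Otimes>\<^sub>M borel) \<Otimes>\<^sub>M borel)"
    unfolding f_def[abs_def] using measurable_extend A by (intro measurable_compose[OF measurable_extend]) simp
  have g: "(\<lambda>z. \<integral>\<^sup>+x'. f (z, x') \<partial>T (snd (fst z), snd z)) \<in> borel_measurable (history_space n \<Otimes>\<^sub>M borel)"
    using f
    by (intro nn_integral_measurable_subprob_algebra2[OF _
          measurable_prob_algebraD[OF T_next_measurable[OF T, unfolded split_beta']]])
      (simp add: split_beta')
  have "emeasure (distr P (history_space (Suc n)) (history (Suc n))) A =
      (\<integral>\<^sup>+\<omega>. f ((history n \<omega>, snd (\<omega> n)), fst (\<omega> (Suc n))) \<partial>P)"
  proof -
    have "emeasure (distr P (history_space (Suc n)) (history (Suc n))) A =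
        (\<integral>\<^sup>+h. indicator A h \<partial>distr P (history_space (Suc n)) (history (Suc n)))"
      using A by simp
    also have "\<dots> = (\<integral>\<^sup>+\<omega>. indicator A (history (Suc n) \<omega>) \<partial>P)"
      using A by (intro nn_integral_distr H) simp
    finally show ?thesis by (simp add: f_def history_Suc)
  qed
  also have "\<dots> = (\<integral>\<^sup>+\<omega>. \<integral>\<^sup>+x'. f ((history n \<omega>, snd (\<omega> n)), x') \<partial>T (\<omega> n) \<partial>P)"
    by (rule nn_integral_next_state[OF P f])
  also have "\<dots> = (\<integral>\<^sup>+\<omega>. \<integral>\<^sup>+x'. f ((history n \<omega>, snd (\<omega> n)), x') \<partial>T (snd (history n \<omega>), snd (\<omega> n)) \<partial>P)"
    by (simp add: history_def)
  also have "\<dots> = (\<integral>\<^sup>+\<omega>. \<integral>\<^sup>+u. \<integral>\<^sup>+x'. f ((history n \<omega>, u), x') \<partial>T (snd (history n \<omega>), u) \<partial>\<kappa> (history n \<omega>) \<partial>P)"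
    using nn_integral_control[OF P \<kappa> eq g] by simp
  also have "\<dots> = (\<integral>\<^sup>+\<omega>. \<integral>\<^sup>+y. indicator A y \<partial>next_kernel T n \<kappa> (history n \<omega>) \<partial>P)"
    using A measurable_space[OF H] unfolding f_def
    by (intro nn_integral_cong) (simp add: nn_integral_next_kernel[OF T \<kappa>])
  also have "\<dots> = (\<integral>\<^sup>+h. \<integral>\<^sup>+y. indicator A y \<partial>next_kernel T n \<kappa> h \<partial>distr P (history_space n) (history n))"
    using A measurable_compose[OF measurable_prob_algebraD[OF N] nn_integral_measurable_subprob_algebra[of "indicator A"]]
    by (intro nn_integral_distr[symmetric] H) simp
  also have "\<dots> = (\<integral>\<^sup>+y. indicator A y \<partial>(distr P (history_space n) (history n) \<bind> next_kernel T n \<kappa>))"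
    using A measurable_prob_algebraD[OF N] by (intro nn_integral_bind[symmetric]) auto
  also have "\<dots> = emeasure (distr P (history_space n) (history n) \<bind> next_kernel T n \<kappa>) A"
    using A sets_bind'[OF dH N] by simp
  finally show "emeasure (distr P (history_space (Suc n)) (history (Suc n))) A =
    emeasure (distr P (history_space n) (history n) \<bind> next_kernel T n \<kappa>) A" .
qed

text \<open>Breaks a circle: the Borel version at time \<open>n\<close> is taken relative to the law
  of the history, which depends on the versions at earlier times. No path measure is involved yet. A
  history at time \<open>0\<close> has no completed pair, which leaves the function
  \<open>\<lambda>_. undefined\<close>.\<close>

primrec history_law :: "('x, 'u) policy \<Rightarrow> 'x \<Rightarrow> nat \<Rightarrow> ('x, 'u) history measure" where
  "history_law \<pi> x 0 = return (history_space 0) (\<lambda>_. undefined, x)"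
| "history_law \<pi> x (Suc n) =
     history_law \<pi> x n \<bind> next_kernel T n (borel_version (history_law \<pi> x n) (\<pi> n))"

lemma distr_history_0:
  assumes P: "path_law T \<pi> x P"
  shows "distr P (history_space 0) (history 0) = return (history_space 0) (\<lambda>_. undefined, x)"
proof (rule measure_eqI)
  interpret prob_space P using path_lawD(1)[OF P] .
  have H: "history 0 \<in> P \<rightarrow>\<^sub>M history_space 0" by (rule path_law_measurable[OF P]) measurable
  fix A assume A: "A \<in> sets (distr P (history_space 0) (history 0))"
  have "AE \<omega> in P. history 0 \<omega> = (\<lambda>_. undefined, x)"
    using path_lawD(3)[OF P] by eventually_elim (auto simp: history_def)
  then have "AE \<omega> in P. indicator A (history 0 \<omega>) = (indicator A (\<lambda>_. undefined, x) :: ennreal)"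
    by eventually_elim simp
  then have "(\<integral>\<^sup>+\<omega>. indicator A (history 0 \<omega>) \<partial>P) = (\<integral>\<^sup>+\<omega>. indicator A (\<lambda>_. undefined, x) \<partial>P)"
    by (rule nn_integral_cong_AE)
  moreover have "(\<integral>\<^sup>+\<omega>. indicator A (history 0 \<omega>) \<partial>P) = emeasure (distr P (history_space 0) (history 0)) A"
    using A nn_integral_distr[OF H, of "indicator A"] by simp
  ultimately show "emeasure (distr P (history_space 0) (history 0)) A =
      emeasure (return (history_space 0) (\<lambda>_. undefined, x)) A"
    using A emeasure_space_1 by simp
qed simp

context
  fixes \<pi> :: "('x, 'u) policy"
  assumes \<pi>: "\<And>n. \<pi> n \<in> univ_completion (history_space n) \<rightarrow>\<^sub>M prob_algebra borel"
begin

lemma borel_version: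
  assumes "\<mu> \<in> space (prob_algebra (history_space n))"
  shows "borel_version \<mu> (\<pi> n) \<in> history_space n \<rightarrow>\<^sub>M prob_algebra borel"
    "AE h in \<mu>. \<pi> n h = borel_version \<mu> (\<pi> n) h"
proof -
  have \<mu>: "finite_measure \<mu>" "sets \<mu> = sets (history_space n)"
    using assms by (auto simp: space_prob_algebra prob_space.finite_measure)
  have "\<exists>\<kappa>. \<kappa> \<in> \<mu> \<rightarrow>\<^sub>M prob_algebra borel \<and> (AE h in \<mu>. \<pi> n h = \<kappa> h)"
    using ex_borel_kernel[OF \<mu> \<pi>] measurable_cong_sets[OF \<mu>(2) refl] by blast
  then have "borel_version \<mu> (\<pi> n) \<in> \<mu> \<rightarrow>\<^sub>M prob_algebra borel \<and>
      (AE h in \<mu>. \<pi> n h = borel_version \<mu> (\<pi> n) h)"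
    unfolding borel_version_def by (rule someI_ex)
  then show "borel_version \<mu> (\<pi> n) \<in> history_space n \<rightarrow>\<^sub>M prob_algebra borel"
    "AE h in \<mu>. \<pi> n h = borel_version \<mu> (\<pi> n) h"
    using measurable_cong_sets[OF \<mu>(2) refl] by blast+
qed

lemma history_law: "history_law \<pi> x n \<in> space (prob_algebra (history_space n))"
proof (induction n)
  case 0
  then show ?case
    by (simp add: space_prob_algebra prob_space_return history_space_def space_pair_measure space_PiM)
next
  case (Suc n)
  have N: "next_kernel T n (borel_version (history_law \<pi> x n) (\<pi> n)) \<in>
      history_space n \<rightarrow>\<^sub>M prob_algebra (history_space (Suc n))"
    using borel_version(1)[OF Suc] by (rule next_kernel_measurable[OF T])
  then show ?case
    using prob_space_bind'[OF Suc N] sets_bind'[OF Suc N] by (simp add: space_prob_algebra)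
qed

text \<open>Depends on the initial state, because the exceptional null sets do.\<close>

definition borel_policy :: "'x \<Rightarrow> ('x, 'u) policy" where
  "borel_policy x n = borel_version (history_law \<pi> x n) (\<pi> n)"

lemma borel_policy_measurable: "borel_policy x n \<in> history_space n \<rightarrow>\<^sub>M prob_algebra borel"
  unfolding borel_policy_def by (rule borel_version(1)[OF history_law])

text \<open>Applied to \<open>\<pi>' = \<pi>\<close> and to \<open>\<pi>' = borel_policy x\<close>, this shows that both policies have the
  same path laws.\<close>

lemma distr_history:
  assumes P: "path_law T \<pi>' x P" and eq: "\<And>n. AE h in history_law \<pi> x n. \<pi>' n h = borel_policy x n h"
  shows "distr P (history_space n) (history n) = history_law \<pi> x n"
    "AE \<omega> in P. \<pi>' n (history n \<omega>) = borel_policy x n (history n \<omega>)"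
proof -
  have H: "history n \<in> P \<rightarrow>\<^sub>M history_space n" for n
    by (rule path_law_measurable[OF P]) measurable
  have AE: "AE \<omega> in P. \<pi>' n (history n \<omega>) = borel_policy x n (history n \<omega>)"
    if "distr P (history_space n) (history n) = history_law \<pi> x n" for n
    using eq[of n] unfolding that[symmetric] by (rule AE_distrD[OF H])
  show *: "distr P (history_space n) (history n) = history_law \<pi> x n" for n
  proof (induction n)
    case 0
    then show ?case using distr_history_0[OF P] by simp
  next
    case (Suc n)
    then show ?case
      using distr_history_Suc[OF P borel_policy_measurable AE[OF Suc]] by (simp add: borel_policy_def)
  qed
  show "AE \<omega> in P. \<pi>' n (history n \<omega>) = borel_policy x n (history n \<omega>)" by (rule AE[OF *])
qed

lemma AE_borel_policy:
  assumes P: "path_law T \<pi> x P"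
  shows "AE \<omega> in P. \<pi> n (history n \<omega>) = borel_policy x n (history n \<omega>)"
  using borel_version(2)[OF history_law] by (intro distr_history(2)[OF P]) (simp add: borel_policy_def)

text \<open>Under every path law of \<open>\<pi>\<close> the histories have the laws
  \<open>history_law\<close>; cylinder sets are events about histories and generate the path
  space.\<close>

lemma path_law_unique:
  assumes P: "path_law T \<pi> x P" and Q: "path_law T \<pi> x Q"
  shows "P = Q"
proof -
  have eq: "AE h in history_law \<pi> x n. \<pi> n h = borel_policy x n h" for n
    using borel_version(2)[OF history_law] by (simp add: borel_policy_def)
  have H: "history n \<in> R \<rightarrow>\<^sub>M history_space n" if "path_law T \<pi> x R" for n R
    by (rule path_law_measurable[OF that]) measurable
  show ?thesis
  proof (rule measure_eqI_generator_eq[OF Int_stable_prod_algebra prod_algebra_sets_into_space])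
    show "sets P = sigma_sets (\<Pi>\<^sub>E i\<in>UNIV. space borel) (prod_algebra (UNIV :: nat set) (\<lambda>_. borel :: ('x \<times> 'u) measure))"
      "sets Q = sigma_sets (\<Pi>\<^sub>E i\<in>UNIV. space borel) (prod_algebra (UNIV :: nat set) (\<lambda>_. borel :: ('x \<times> 'u) measure))"
      using path_lawD(2)[OF P] path_lawD(2)[OF Q] by (simp_all only: path_space_def sets_PiM)
    fix X assume "X \<in> prod_algebra (UNIV :: nat set) (\<lambda>_. borel :: ('x \<times> 'u) measure)"
    then obtain J E where J: "finite J" and X: "X = prod_emb UNIV (\<lambda>_. borel) J (Pi\<^sub>E J E)"
      and E: "\<And>i. i \<in> J \<Longrightarrow> E i \<in> sets (borel :: ('x \<times> 'u) measure)"
      by (rule prod_algebraE) metis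
    \<comment> \<open>A time beyond all coordinates in \<open>J\<close>, so that the cylinder
      concerns only completed pairs of the history at \<open>n\<close>.\<close>
    obtain n where n: "\<forall>i\<in>J. i < n" using J finite_nat_set_iff_bounded[of J] by blast
    define A where "A = {h \<in> space (history_space n :: ('x, 'u) history measure). \<forall>i\<in>J. fst h i \<in> E i}"
    have "(\<lambda>h. fst h i) \<in> (history_space n :: ('x, 'u) history measure) \<rightarrow>\<^sub>M borel" if "i \<in> J" for i
      unfolding history_space_def
      by (rule measurable_compose[OF measurable_fst], rule measurable_component_singleton) (use n that in simp)
    then have A: "A \<in> sets (history_space n)"
      unfolding A_def using J E by (intro sets.sets_Collect_finite_All) (auto simp: measurable_sets_Collect)
    have "X = history n -` A \<inter> space R" if "path_law T \<pi> x R" for R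
      using n path_law_space[OF that]
      by (auto simp: X A_def history_def prod_emb_def PiE_iff history_space_def space_pair_measure space_PiM)
    then have "emeasure R X = emeasure (history_law \<pi> x n) A" if R: "path_law T \<pi> x R" for R
      using R A by (simp add: emeasure_distr[OF H[OF R] A, symmetric] distr_history(1)[OF R eq])
    then show "emeasure P X = emeasure Q X" using P Q by simp
  next
    show "range (\<lambda>_::nat. (\<Pi>\<^sub>E i\<in>UNIV. space borel)) \<subseteq> prod_algebra (UNIV :: nat set) (\<lambda>_. borel :: ('x \<times> 'u) measure)"
      by (intro image_subsetI space_in_prod_algebra)
    show "emeasure P (\<Pi>\<^sub>E i\<in>UNIV. space borel) \<noteq> \<infinity>"
      using finite_measure.emeasure_finite[OF prob_space.finite_measure[OF path_lawD(1)[OF P]]] by simp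
  qed simp
qed

text \<open>A path law of the Borel policy gives the histories the laws \<open>history_law\<close>,
  under which the two policies agree almost surely; hence it is a path law of \<open>\<pi>\<close>
  as well.\<close>

lemma path_law_exists: "\<exists>P. path_law T \<pi> x P"
proof -
  obtain P where P: "path_law T (borel_policy x) x P"
    using path_law_exists_borel[OF T, of "borel_policy x"] borel_policy_measurable by blast
  have H: "history n \<in> P \<rightarrow>\<^sub>M history_space n" for n
    by (rule path_law_measurable[OF P]) measurable
  have "AE \<omega> in P. borel_policy x n (history n \<omega>) = \<pi> n (history n \<omega>)" for n
  proof -
    have "AE h in history_law \<pi> x n. borel_policy x n h = \<pi> n h"
      unfolding borel_policy_def by (rule eventually_mono[OF borel_version(2)[OF history_law]]) (rule sym)
    also have "history_law \<pi> x n = distr P (history_space n) (history n)"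
      by (rule distr_history(1)[OF P, symmetric]) simp
    finally show ?thesis by (rule AE_distrD[OF H])
  qed
  then have "path_law T \<pi> x P" by (rule path_law_cong_AE[OF P])
  then show ?thesis ..
qed

lemma path_law_path_measure: "path_law T \<pi> x (path_measure T \<pi> x)"
  unfolding path_measure_def by (rule theI', rule ex_ex1I[OF path_law_exists path_law_unique])

end

end

section \<open>The probability of staying in a set\<close>

context cdt
begin

text \<open>\<open>A\<close> is only universally measurable, so it is enclosed in a Borel set
  \<open>A2\<close> that exceeds it by a null set for the law of \<open>\<omega> n\<close>.
  Enclosing from outside keeps the sections of full measure. Applied to the constraint
  \<open>K\<close> and to a set of near-optimal pairs.\<close>

lemma AE_control:
  fixes \<pi> :: "('x, 'u) policy"
  assumes \<pi>: "\<And>n. \<pi> n \<in> univ_completion (history_space n) \<rightarrow>\<^sub>M prob_algebra borel"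
    and P: "path_law T \<pi> x P"
    and A: "A \<in> sets (univ_completion borel)"
    and ctrl: "\<And>h. h \<in> space (history_space n) \<Longrightarrow> emeasure (completion (\<pi> n h)) {u. (snd h, u) \<in> A} = 1"
  shows "AE \<omega> in P. \<omega> n \<in> A"
proof -
  interpret P: prob_space P by (rule path_lawD(1)[OF P])
  have X: "(\<lambda>\<omega>. \<omega> n) \<in> P \<rightarrow>\<^sub>M borel" by (rule path_law_measurable[OF P]) measurable
  have H: "history n \<in> P \<rightarrow>\<^sub>M history_space n" by (rule path_law_measurable[OF P]) measurable
  define L where "L = distr P borel (\<lambda>\<omega>. \<omega> n)"
  have "A \<in> sets (completion L)"
    using A prob_space.finite_measure[OF P.prob_space_distr[OF X]]
    by (intro sets_univ_completionD) (auto simp: L_def)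
  then obtain B N N' where AB: "A = B \<union> N" "N \<subseteq> N'" "N' \<in> null_sets L" "B \<in> sets L"
    by (rule sets_completionE)
  define A2 where "A2 = B \<union> N'"
  have A2: "A2 \<in> sets borel" using AB by (auto simp: A2_def L_def null_sets_def)
  define f where "f z = (indicator A2 (snd (fst z), snd z) :: ennreal)" for z :: "('x, 'u) history \<times> 'u"
  have "(\<lambda>z :: ('x, 'u) history \<times> 'u. (snd (fst z), snd z)) \<in> history_space n \<Otimes>\<^sub>M borel \<rightarrow>\<^sub>M borel"
    by measurable
  from measurable_compose[OF this borel_measurable_indicator[OF A2]]
  have f: "f \<in> borel_measurable (history_space n \<Otimes>\<^sub>M borel)" by (simp add: f_def[abs_def])
  have ge: "1 \<le> (\<integral>\<^sup>+u. f (h, u) \<partial>\<pi> n h)" if h: "h \<in> space (history_space n)" for h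
  proof -
    have \<pi>h: "sets (\<pi> n h) = sets borel"
      using measurable_space[OF \<pi>, of h n] h by (simp add: space_prob_algebra)
    have "Pair (snd h) \<in> borel \<rightarrow>\<^sub>M (borel :: ('x \<times> 'u) measure)" by measurable
    from measurable_sets[OF this A2] have s: "{u. (snd h, u) \<in> A2} \<in> sets (\<pi> n h)"
      by (simp add: \<pi>h vimage_def)
    have "1 = emeasure (completion (\<pi> n h)) {u. (snd h, u) \<in> A}" using ctrl[OF h] by simp
    also have "\<dots> \<le> emeasure (completion (\<pi> n h)) {u. (snd h, u) \<in> A2}"
      using s AB by (intro emeasure_mono) (auto simp: A2_def)
    also have "\<dots> = (\<integral>\<^sup>+u. indicator {u. (snd h, u) \<in> A2} u \<partial>\<pi> n h)" using s by simp
    also have "\<dots> = (\<integral>\<^sup>+u. f (h, u) \<partial>\<pi> n h)"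
      by (intro nn_integral_cong) (simp add: f_def indicator_def)
    finally show ?thesis .
  qed
  have "(\<integral>\<^sup>+\<omega>. 1 \<partial>P) \<le> (\<integral>\<^sup>+\<omega>. \<integral>\<^sup>+u. f (history n \<omega>, u) \<partial>\<pi> n (history n \<omega>) \<partial>P)"
    using ge measurable_space[OF H] by (intro nn_integral_mono) blast
  also have "\<dots> = (\<integral>\<^sup>+\<omega>. \<integral>\<^sup>+u. f (history n \<omega>, u) \<partial>borel_policy T \<pi> x n (history n \<omega>) \<partial>P)"
    using AE_borel_policy[OF T_kernel \<pi> P, of n]
    by (intro nn_integral_cong_AE) (auto elim!: eventually_mono)
  also have "\<dots> = (\<integral>\<^sup>+\<omega>. f (history n \<omega>, snd (\<omega> n)) \<partial>P)"
    using nn_integral_control[OF T_kernel P borel_policy_measurable[OF T_kernel \<pi>] AE_borel_policy[OF T_kernel \<pi> P] f]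
    by simp
  also have "\<dots> = (\<integral>\<^sup>+\<omega>. indicator {\<omega> \<in> space P. \<omega> n \<in> A2} \<omega> \<partial>P)"
    by (intro nn_integral_cong) (simp add: f_def history_def indicator_def)
  also have "\<dots> = emeasure P {\<omega> \<in> space P. \<omega> n \<in> A2}"
    using measurable_sets[OF X A2] by (intro nn_integral_indicator) (simp add: vimage_def Int_def conj_commute)
  finally have "emeasure P {\<omega> \<in> space P. \<omega> n \<in> A2} = 1"
    using P.emeasure_space_1 P.measure_le_1 by (intro antisym) simp_all
  then have "P.prob {\<omega> \<in> space P. \<omega> n \<in> A2} = 1" by (simp add: measure_def)
  moreover have "{\<omega> \<in> space P. \<omega> n \<in> A2} \<in> P.events"
    using measurable_sets[OF X A2] by (simp add: vimage_def Int_def conj_commute)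
  ultimately have "AE \<omega> in P. \<omega> \<in> {\<omega> \<in> space P. \<omega> n \<in> A2}"
    using P.AE_in_set_eq_1 by blast
  then have "AE \<omega> in P. \<omega> n \<in> A2" by eventually_elim simp
  moreover have "AE \<omega> in P. \<omega> n \<notin> N'"
    using AE_not_in[OF AB(3)] unfolding L_def by (rule AE_distrD[OF X])
  ultimately show ?thesis
    by eventually_elim (use AB in \<open>auto simp: A2_def\<close>)
qed

text \<open>The conditional law of the next state speaks about Borel functions, while
  \<open>f\<close> is only semi-analytic. It is replaced by a Borel version \<open>w\<close>, whose
  exceptional set \<open>N\<close> is null for the law of the next state and therefore, along almost
  every path, for \<open>T (\<omega> n)\<close>.\<close>

lemma nn_integral_always_Suc:
  fixes \<pi> :: "('x, 'u) policy"
  assumes P: "path_law T \<pi> x P" and f: "f \<in> bA_up S" "\<And>y. y \<in> S \<Longrightarrow> 0 \<le> f y"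
  shows "(\<integral>\<^sup>+\<omega>. indicator (event_always (enat (Suc n)) S) \<omega> * ennreal (f (fst (\<omega> (Suc n)))) \<partial>P) =
    (\<integral>\<^sup>+\<omega>. indicator (event_always (enat n) S) \<omega> * ennreal (T_int T S (snd (\<omega> n)) f (fst (\<omega> n))) \<partial>P)"
proof -
  interpret P: prob_space P by (rule path_lawD(1)[OF P])
  have Y: "(\<lambda>\<omega>. fst (\<omega> (Suc n))) \<in> P \<rightarrow>\<^sub>M borel" by (rule path_law_measurable[OF P]) measurable
  define \<mu> where "\<mu> = distr P borel (\<lambda>\<omega>. fst (\<omega> (Suc n)))"
  define F where "F y = indicator S y * f y" for y
  have F_nonneg: "0 \<le> F y" for y using f(2) by (simp add: F_def indicator_def)
  have F: "F \<in> borel_measurable (completion \<mu>)"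
    unfolding F_def[abs_def] \<mu>_def
    using prob_space.finite_measure[OF P.prob_space_distr[OF Y]]
    by (intro borel_measurable_completion_bA_up f(1) S) simp_all
  obtain w where w: "w \<in> borel_measurable \<mu>" "AE y in \<mu>. F y = w y"
    using completion_ex_borel_measurable_real[OF F] by blast
  then obtain N where N: "N \<in> null_sets \<mu>" "{y \<in> space \<mu>. F y \<noteq> w y} \<subseteq> N"
    by (auto elim!: AE_E)
  have wb: "w \<in> borel_measurable borel" using w(1) by (simp add: \<mu>_def)
  have Nb: "N \<in> sets borel" using N(1) by (auto simp: \<mu>_def null_sets_def)
  have FN: "F y = w y" if "y \<notin> N" for y using N(2) that by (auto simp: \<mu>_def)
  have AE_N: "AE \<omega> in P. fst (\<omega> (Suc n)) \<notin> N"
    using AE_not_in[OF N(1)] unfolding \<mu>_def by (rule AE_distrD[OF Y])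
  \<comment> \<open>The mean of the mass that \<open>T (\<omega> n)\<close> gives to
    \<open>N\<close> is the probability that the next state lies in \<open>N\<close>, which is
    \<open>0\<close>.\<close>
  have TN: "AE \<omega> in P. emeasure (T (\<omega> n)) N = 0"
  proof -
    have "(\<integral>\<^sup>+\<omega>. emeasure (T (\<omega> n)) N \<partial>P) =
        (\<integral>\<^sup>+\<omega>. indicator (space (history_space n \<Otimes>\<^sub>M borel)) (history n \<omega>, snd (\<omega> n)) * emeasure (T (\<omega> n)) N \<partial>P)"
      by (intro nn_integral_cong) (simp add: space_pair_measure history_space_def space_PiM history_def)
    also have "\<dots> = emeasure P {\<omega>. (history n \<omega>, snd (\<omega> n)) \<in> space (history_space n \<Otimes>\<^sub>M borel) \<and> fst (\<omega> (Suc n)) \<in> N}"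
      using path_lawD(5)[OF P sets.top Nb] by simp
    also have "\<dots> = emeasure \<mu> N"
      unfolding \<mu>_def emeasure_distr[OF Y Nb]
      by (intro arg_cong[where f = "emeasure P"])
        (auto simp: path_law_space[OF P] space_pair_measure history_space_def space_PiM history_def)
    also have "\<dots> = 0" using N(1) by auto
    finally have "(\<integral>\<^sup>+\<omega>. emeasure (T (\<omega> n)) N \<partial>P) = 0" .
    moreover have "(\<lambda>\<omega>. \<omega> n) \<in> P \<rightarrow>\<^sub>M borel" by (rule path_law_measurable[OF P]) measurable
    from measurable_compose[OF this measurable_compose[OF measurable_prob_algebraD[OF T_kernel] measurable_emeasure_subprob_algebra[OF Nb]]]
    have "(\<lambda>\<omega>. emeasure (T (\<omega> n)) N) \<in> borel_measurable P" .
    ultimately show ?thesis using nn_integral_0_iff_AE by blast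
  qed
  have T_eq: "(\<integral>\<^sup>+y. ennreal (w y) \<partial>T (\<omega> n)) = ennreal (T_int T S (snd (\<omega> n)) f (fst (\<omega> n)))"
    if "emeasure (T (\<omega> n)) N = 0" for \<omega>
  proof -
    have "N \<in> null_sets (T (\<omega> n))" using that Nb sets_T by (simp add: null_sets_def)
    then have "AE y in T (\<omega> n). ennreal (w y) = ennreal (F y)"
      by (rule AE_not_in[THEN eventually_mono]) (simp add: FN)
    then have "(\<integral>\<^sup>+y. ennreal (w y) \<partial>T (\<omega> n)) = (\<integral>\<^sup>+y. ennreal (F y) \<partial>completion (T (\<omega> n)))"
      unfolding nn_integral_completion by (rule nn_integral_cong_AE)
    also have "\<dots> = ennreal (\<integral>y. F y \<partial>completion (T (\<omega> n)))"
      using integrable_T[OF f(1), of "\<omega> n"] F_nonneg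
      by (intro nn_integral_eq_integral) (auto simp: set_integrable_def F_def)
    finally show ?thesis by (simp add: T_int_def set_lebesgue_integral_def F_def)
  qed
  \<comment> \<open>Staying in \<open>S\<close> up to time \<open>n\<close> as a measurable set of
    histories, the form in which conditioning applies.\<close>
  define D where "D = {h \<in> space (history_space n :: ('x, 'u) history measure). (\<forall>i\<in>{..<n}. fst (fst h i) \<in> S) \<and> snd h \<in> S}"
  have D: "D \<in> sets (history_space n)"
  proof -
    have "(\<lambda>h. fst h i) \<in> (history_space n :: ('x, 'u) history measure) \<rightarrow>\<^sub>M borel" if "i < n" for i
      unfolding history_space_def
      by (rule measurable_compose[OF measurable_fst], rule measurable_component_singleton) (use that in simp)
    from measurable_compose[OF this measurable_fst_borel]
    have m: "(\<lambda>h. fst (fst h i)) \<in> (history_space n :: ('x, 'u) history measure) \<rightarrow>\<^sub>M borel" if "i < n" for i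
      using that by blast
    show ?thesis
      unfolding D_def
      by (intro sets.sets_Collect_conj sets.sets_Collect_finite_All)
        (use S m in \<open>auto intro: measurable_sets_Collect\<close>)
  qed
  have alw: "\<omega> \<in> event_always (enat n) S \<longleftrightarrow> history n \<omega> \<in> D" for \<omega> :: "nat \<Rightarrow> 'x \<times> 'u"
    by (auto simp: event_always_def D_def history_def history_space_def space_pair_measure space_PiM le_less)
  have alw_Suc: "\<omega> \<in> event_always (enat (Suc n)) S \<longleftrightarrow> history n \<omega> \<in> D \<and> fst (\<omega> (Suc n)) \<in> S" for \<omega> :: "nat \<Rightarrow> 'x \<times> 'u"
    unfolding alw[symmetric] by (auto simp: event_always_def le_Suc_eq)
  have "(\<integral>\<^sup>+\<omega>. indicator (event_always (enat (Suc n)) S) \<omega> * ennreal (f (fst (\<omega> (Suc n)))) \<partial>P) =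
      (\<integral>\<^sup>+\<omega>. indicator D (history n \<omega>) * ennreal (F (fst (\<omega> (Suc n)))) \<partial>P)"
    by (intro nn_integral_cong) (auto simp: indicator_def alw_Suc F_def)
  also have "\<dots> = (\<integral>\<^sup>+\<omega>. indicator D (history n \<omega>) * ennreal (w (fst (\<omega> (Suc n)))) \<partial>P)"
    using AE_N by (intro nn_integral_cong_AE) (auto elim!: eventually_mono simp: FN)
  also have "\<dots> = (\<integral>\<^sup>+\<omega>. \<integral>\<^sup>+x'. indicator D (history n \<omega>) * ennreal (w x') \<partial>T (\<omega> n) \<partial>P)"
  proof -
    have "(\<lambda>z. indicator D (fst (fst z)) * ennreal (w (snd z))) \<in>
        borel_measurable ((history_space n \<Otimes>\<^sub>M borel) \<Otimes>\<^sub>M borel)"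
      using D wb by measurable
    from nn_integral_next_state[OF T_kernel P this] show ?thesis by simp
  qed
  also have "\<dots> = (\<integral>\<^sup>+\<omega>. indicator D (history n \<omega>) * (\<integral>\<^sup>+x'. ennreal (w x') \<partial>T (\<omega> n)) \<partial>P)"
  proof (intro nn_integral_cong nn_integral_cmult)
    fix \<omega> :: "nat \<Rightarrow> 'x \<times> 'u"
    have "w \<in> borel_measurable (T (\<omega> n))"
      unfolding measurable_cong_sets[OF sets_T refl] by (rule wb)
    then show "(\<lambda>x'. ennreal (w x')) \<in> borel_measurable (T (\<omega> n))" by simp
  qed
  also have "\<dots> = (\<integral>\<^sup>+\<omega>. indicator (event_always (enat n) S) \<omega> * ennreal (T_int T S (snd (\<omega> n)) f (fst (\<omega> n))) \<partial>P)"
    using TN by (intro nn_integral_cong_AE) (auto elim!: eventually_mono simp: T_eq alw indicator_def)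
  finally show ?thesis .
qed

section \<open>The maximal probability of staying for finitely many steps\<close>

lemma policies_measurable:
  "\<pi> \<in> policies K \<Longrightarrow> \<pi> n \<in> univ_completion (history_space n) \<rightarrow>\<^sub>M prob_algebra borel"
  by (simp add: policies_def)

lemma path_law_policy: "\<pi> \<in> policies K \<Longrightarrow> path_law T \<pi> x (path_measure T \<pi> x)"
  using path_law_path_measure[OF T_kernel] policies_measurable by blast

lemma event_always_measurable: "(event_always n S :: (nat \<Rightarrow> 'x \<times> 'u) set) \<in> sets path_space"
proof -
  have "{\<omega> \<in> space (path_space :: (nat \<Rightarrow> 'x \<times> 'u) measure). \<forall>k. enat k \<le> n \<longrightarrow> fst (\<omega> k) \<in> S} \<in> sets path_space"
    using S by measurable
  then show ?thesis by (simp add: event_always_def)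
qed

lemma nn_integral_always_0:
  assumes P: "path_law T \<pi> x P" and x: "x \<in> S"
  shows "(\<integral>\<^sup>+\<omega>. indicator (event_always (enat 0) S) \<omega> * ennreal (f (fst (\<omega> 0))) \<partial>P) = ennreal (f x)"
proof -
  interpret prob_space P by (rule path_lawD(1)[OF P])
  have "AE \<omega> in P. indicator (event_always (enat 0) S) \<omega> * ennreal (f (fst (\<omega> 0))) = ennreal (f x)"
    using path_lawD(3)[OF P]
    by eventually_elim (use x in \<open>auto simp: event_always_def enat_0_iff indicator_def\<close>)
  then have "(\<integral>\<^sup>+\<omega>. indicator (event_always (enat 0) S) \<omega> * ennreal (f (fst (\<omega> 0))) \<partial>P) = (\<integral>\<^sup>+\<omega>. ennreal (f x) \<partial>P)"
    by (rule nn_integral_cong_AE)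
  then show ?thesis using emeasure_space_1 by simp
qed

lemma nn_integral_always_stay_0:
  assumes P: "path_law T \<pi> x P"
  shows "(\<integral>\<^sup>+\<omega>. indicator (event_always (enat n) S) \<omega> * ennreal (stay 0 (fst (\<omega> n))) \<partial>P) =
    ennreal (measure P (event_always (enat n) S))"
proof -
  interpret prob_space P by (rule path_lawD(1)[OF P])
  have "(\<integral>\<^sup>+\<omega>. indicator (event_always (enat n) S) \<omega> * ennreal (stay 0 (fst (\<omega> n))) \<partial>P) =
      (\<integral>\<^sup>+\<omega>. indicator (event_always (enat n) S) \<omega> \<partial>P)"
    by (intro nn_integral_cong) (auto simp: indicator_def stay_0 event_always_def)
  also have "\<dots> = emeasure P (event_always (enat n) S)"
    using event_always_measurable path_lawD(2)[OF P] by simp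
  finally show ?thesis by (simp add: emeasure_eq_measure)
qed

text \<open>A supermartingale argument: \<open>?e n j\<close> is the expected value of staying up to
  time \<open>n\<close> and then optimally for \<open>j\<close> more steps. With
  \<open>n + j\<close> fixed it does not increase with \<open>n\<close>; its two ends are
  \<open>stay\<close> at the initial state and the probability in question.\<close>

lemma measure_always_le_stay:
  assumes \<pi>: "\<pi> \<in> policies K" and x: "x \<in> S"
  shows "measure (path_measure T \<pi> x) (event_always (enat n) S) \<le> stay n x"
proof -
  let ?P = "path_measure T \<pi> x"
  note P = path_law_policy[OF \<pi>]
  let ?e = "\<lambda>n j. \<integral>\<^sup>+\<omega>. indicator (event_always (enat n) S) \<omega> * ennreal (stay j (fst (\<omega> n))) \<partial>?P"
  have step: "?e (Suc n) j \<le> ?e n (Suc j)" for n j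
  proof -
    have "K \<in> sets (univ_completion borel)"
      using mdp by (intro analytic_set_in_univ_completion) (simp add: cdt_MP_def)
    then have "AE \<omega> in ?P. \<omega> n \<in> K"
      using \<pi> by (intro AE_control[OF policies_measurable[OF \<pi>] P]) (simp_all add: policies_def)
    then have "AE \<omega> in ?P. indicator (event_always (enat n) S) \<omega> * ennreal (T_int T S (snd (\<omega> n)) (stay j) (fst (\<omega> n)))
        \<le> indicator (event_always (enat n) S) \<omega> * ennreal (stay (Suc j) (fst (\<omega> n)))"
      by eventually_elim (auto simp: indicator_def event_always_def intro!: ennreal_leI T_int_stay_le)
    then have "(\<integral>\<^sup>+\<omega>. indicator (event_always (enat n) S) \<omega> * ennreal (T_int T S (snd (\<omega> n)) (stay j) (fst (\<omega> n))) \<partial>?P)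
        \<le> ?e n (Suc j)"
      by (rule nn_integral_mono_AE)
    then show ?thesis
      using nn_integral_always_Suc[OF P stay_bA_up] stay_bounds by simp
  qed
  have "?e n j \<le> ?e 0 (n + j)" for j
  proof (induction n arbitrary: j)
    case (Suc n)
    have "?e n (Suc j) \<le> ?e 0 (Suc n + j)" using Suc[of "Suc j"] by simp
    with step show ?case by (rule order_trans)
  qed simp
  from this[of 0] have "ennreal (measure ?P (event_always (enat n) S)) \<le> ennreal (stay n x)"
    using nn_integral_always_0[OF P x] nn_integral_always_stay_0[OF P] by simp
  then show ?thesis using stay_bounds[OF x] by simp
qed

lemma ex_control_selector:
  "\<exists>\<phi>\<in>univ_completion borel \<rightarrow>\<^sub>M borel. \<forall>x. (x, \<phi> x) \<in> K"
proof -
  have "analytic_set K" using mdp by (simp add: cdt_MP_def)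
  from jankov_von_neumann[OF this, of "\<lambda>_. undefined"]
  obtain \<phi> where \<phi>: "\<phi> \<in> univ_completion borel \<rightarrow>\<^sub>M borel"
    "\<And>x. if x \<in> fst ` K then (x, \<phi> x) \<in> K else \<phi> x = undefined" by auto
  moreover have "x \<in> fst ` K" for x using K_nonempty[of x] by force
  ultimately show ?thesis by (intro bexI[of _ \<phi>]) auto
qed

text \<open>An \<open>\<epsilon>\<close>-optimal selector is built by truncating at the levels \<open>i * \<epsilon>\<close>: from one level to the
  next, the selector changes only where some control reaches more than \<open>i * \<epsilon>\<close>, which is an
  analytic condition.\<close>

lemma ex_optimal_selector:
  assumes \<epsilon>: "\<epsilon> > 0"
  shows "\<exists>\<phi>\<in>univ_completion borel \<rightarrow>\<^sub>M borel. \<forall>x. (x, \<phi> x) \<in> K \<and>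
    (x \<in> S \<longrightarrow> stay (Suc j) x \<le> T_int T S (\<phi> x) (stay j) x + \<epsilon>)"
proof -
  let ?g = "\<lambda>x u. T_int T S u (stay j) x"
  have "\<exists>\<phi>\<in>univ_completion borel \<rightarrow>\<^sub>M borel. \<forall>x. (x, \<phi> x) \<in> K \<and>
    (x \<in> S \<longrightarrow> min (stay (Suc j) x) (real i * \<epsilon>) \<le> ?g x (\<phi> x) + \<epsilon>)" for i
  proof (induction i)
    case 0
    obtain \<phi> where \<phi>: "\<phi> \<in> univ_completion borel \<rightarrow>\<^sub>M borel" "\<forall>x. (x, \<phi> x) \<in> K"
      using ex_control_selector by blast
    have "0 \<le> ?g x u" for x u using stay_bounds by (intro T_int_nonneg) blast
    then have "min (stay (Suc j) x) (real 0 * \<epsilon>) \<le> ?g x (\<phi> x) + \<epsilon>" for x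
      using \<epsilon> by (simp add: min.coboundedI2 add_nonneg_nonneg)
    then show ?case using \<phi> by blast
  next
    case (Suc i)
    then obtain \<phi> where \<phi>: "\<phi> \<in> univ_completion borel \<rightarrow>\<^sub>M borel" "\<And>x. (x, \<phi> x) \<in> K"
      "\<And>x. x \<in> S \<Longrightarrow> min (stay (Suc j) x) (real i * \<epsilon>) \<le> ?g x (\<phi> x) + \<epsilon>" by blast
    define A where "A = K \<inter> {z. real i * \<epsilon> < (case z of (x, u) \<Rightarrow> ?g x u)}"
    have "analytic_set A"
      unfolding A_def using mdp upper_semianalytic_T_int[OF stay_bA_up, of j]
      by (intro analytic_set_Int) (auto simp: cdt_MP_def upper_semianalytic_def)
    from jankov_von_neumann[OF this \<phi>(1)]
    obtain \<psi> where \<psi>: "\<psi> \<in> univ_completion borel \<rightarrow>\<^sub>M borel"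
      "\<And>x. if x \<in> fst ` A then (x, \<psi> x) \<in> A else \<psi> x = \<phi> x" by blast
    have "(x, \<psi> x) \<in> K \<and> (x \<in> S \<longrightarrow> min (stay (Suc j) x) (real (Suc i) * \<epsilon>) \<le> ?g x (\<psi> x) + \<epsilon>)" for x
    proof (cases "x \<in> fst ` A")
      case True
      then have "(x, \<psi> x) \<in> A" using \<psi>(2)[of x] by simp
      then have "(x, \<psi> x) \<in> K" "real i * \<epsilon> < ?g x (\<psi> x)" by (auto simp: A_def)
      then show ?thesis by (auto simp: algebra_simps intro!: min.coboundedI2)
    next
      case False
      then have eq: "\<psi> x = \<phi> x" using \<psi>(2)[of x] by simp
      have "min (stay (Suc j) x) (real (Suc i) * \<epsilon>) \<le> ?g x (\<phi> x) + \<epsilon>" if x: "x \<in> S"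
      proof -
        have "?g x u \<le> real i * \<epsilon>" if "(x, u) \<in> K" for u
        proof (rule ccontr)
          assume "\<not> ?g x u \<le> real i * \<epsilon>"
          then have "(x, u) \<in> A" using that by (simp add: A_def)
          then show False using False by force
        qed
        \<comment> \<open>No control exceeds level \<open>i\<close> here, so truncating at the next
          level changes nothing and the old selector still suffices.\<close>
        then have "stay (Suc j) x \<le> real i * \<epsilon>"
          unfolding stay_Suc[OF x] using K_nonempty by (intro cSUP_least) auto
        then show ?thesis using \<phi>(3)[OF x] by simp
      qed
      then show ?thesis using \<phi>(2) by (simp add: eq)
    qed
    then show ?case using \<psi>(1) by blast
  qed
  \<comment> \<open>As \<open>stay\<close> is at most \<open>1\<close>, truncation at a level
    \<open>i * \<epsilon>\<close> of at least \<open>1\<close> has no effect.\<close>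
  moreover obtain i where "1 / \<epsilon> \<le> real i" using real_arch_simple by blast
  then have "1 \<le> real i * \<epsilon>" using \<epsilon> by (simp add: field_simps)
  then have "min (stay (Suc j) x) (real i * \<epsilon>) = stay (Suc j) x" if "x \<in> S" for x
    using stay_bounds[OF that, of "Suc j"] by simp
  ultimately show ?thesis by metis
qed

text \<open>The complement of the point is null for the point mass, so every set is measurable in
  the completion. This admits the sections of \<open>K\<close> and of universally measurable sets as
  \<open>B\<close>.\<close>

lemma emeasure_completion_return:
  fixes u :: "'a::t1_space"
  assumes "u \<in> B"
  shows "emeasure (completion (return borel u)) B = 1"
proof -
  have "- {u} \<in> null_sets (return borel u)" by (simp add: null_sets_def)
  then have B: "B \<in> sets (completion (return borel u))"
    using assms by (intro sets_completionI[of _ "{u}" "B - {u}" "- {u}"]) auto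
  have "1 = emeasure (completion (return borel u)) {u}" by simp
  also have "\<dots> \<le> emeasure (completion (return borel u)) B"
    using B assms by (intro emeasure_mono) auto
  finally have "1 \<le> emeasure (completion (return borel u)) B" .
  moreover have "emeasure (completion (return borel u)) B \<le> emeasure (completion (return borel u)) UNIV"
    by (intro emeasure_mono) auto
  ultimately show ?thesis by (simp add: antisym)
qed

end

context cdt
begin

lemma selector_policy:
  assumes \<phi>: "\<And>n. \<phi> n \<in> univ_completion borel \<rightarrow>\<^sub>M borel" "\<And>n x. (x, \<phi> n x) \<in> K"
  shows "(\<lambda>n h. return borel (\<phi> n (snd h))) \<in> policies K"
  unfolding policies_def
proof (intro CollectI allI conjI ballI)
  fix n
  have "snd \<in> univ_completion (history_space n :: ('x, 'u) history measure) \<rightarrow>\<^sub>M univ_completion borel"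
    by (rule measurable_univ_completion) measurable
  from measurable_compose[OF this \<phi>(1)]
  have "(\<lambda>h. \<phi> n (snd h)) \<in> univ_completion (history_space n :: ('x, 'u) history measure) \<rightarrow>\<^sub>M borel" .
  from measurable_compose[OF this measurable_return_prob_space]
  show "(\<lambda>h. return borel (\<phi> n (snd h))) \<in>
      univ_completion (history_space n :: ('x, 'u) history measure) \<rightarrow>\<^sub>M prob_algebra borel" .
  show "emeasure (completion (return borel (\<phi> n (snd h)))) {u. (snd h, u) \<in> K} = 1" for h :: "('x, 'u) history"
    using \<phi>(2) by (intro emeasure_completion_return) simp
qed

text \<open>Makes the real suprema and infima over policies meaningful; it rests on a universally
  measurable selector of \<open>K\<close>.\<close>

lemma policies_nonempty: "policies K \<noteq> {}"
proof -
  obtain \<phi> where "\<phi> \<in> univ_completion borel \<rightarrow>\<^sub>M borel" "\<forall>x. (x, \<phi> x) \<in> K"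
    using ex_control_selector by blast
  then show ?thesis using selector_policy[of "\<lambda>_. \<phi>"] by blast
qed

lemma measure_path_le_1: "\<pi> \<in> policies K \<Longrightarrow> measure (path_measure T \<pi> x) A \<le> 1"
  using prob_space.prob_le_1[OF path_lawD(1)[OF path_law_policy]] .

lemma bdd_above_policies: "bdd_above ((\<lambda>\<pi>. measure (path_measure T \<pi> x) A) ` policies K)"
  using measure_path_le_1 by (auto intro!: bdd_aboveI[of _ 1])

lemma measure_le_max_prob: "\<pi> \<in> policies K \<Longrightarrow> measure (path_measure T \<pi> x) A \<le> max_prob K T x A"
  unfolding max_prob_def using bdd_above_policies by (rule cSUP_upper[rotated])

lemma max_prob_bounds: "0 \<le> max_prob K T x A" "max_prob K T x A \<le> 1"
proof -
  obtain \<pi> where "\<pi> \<in> policies K" using policies_nonempty by blast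
  then show "0 \<le> max_prob K T x A"
    using measure_le_max_prob measure_nonneg order_trans by blast
  show "max_prob K T x A \<le> 1"
    unfolding max_prob_def using policies_nonempty measure_path_le_1 by (intro cSUP_least)
qed

text \<open>The steps of \<open>measure_always_le_stay\<close> with reversed inequality: a
  near-optimal control at each time loses at most \<open>\<epsilon>\<close>, hence
  \<open>m * \<epsilon>\<close> in total.\<close>

lemma ex_policy_always_ge:
  fixes \<epsilon> :: real
  assumes \<epsilon>: "\<epsilon> > 0" and x: "x \<in> S"
  shows "\<exists>\<pi>\<in>policies K. stay m x \<le> measure (path_measure T \<pi> x) (event_always (enat m) S) + m * \<epsilon>"
proof -
  obtain \<phi> where \<phi>: "\<And>j. \<phi> j \<in> univ_completion borel \<rightarrow>\<^sub>M borel" "\<And>j x. (x, \<phi> j x) \<in> K"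
    "\<And>j x. x \<in> S \<Longrightarrow> stay (Suc j) x \<le> T_int T S (\<phi> j x) (stay j) x + \<epsilon>"
    using ex_optimal_selector[OF \<epsilon>] by metis
  \<comment> \<open>After the control at time \<open>n\<close> there remain \<open>m - Suc n\<close>
    steps, so the selector for that horizon is used. From time \<open>m\<close> on the truncated
    index is \<open>0\<close>, still an admissible selector.\<close>
  define \<pi> :: "('x, 'u) policy" where "\<pi> n h = return borel (\<phi> (m - Suc n) (snd h))" for n h
  have \<pi>: "\<pi> \<in> policies K"
    unfolding \<pi>_def[abs_def] using \<phi> by (intro selector_policy)
  let ?P = "path_measure T \<pi> x"
  note P = path_law_policy[OF \<pi>]
  interpret prob_space ?P by (rule path_lawD(1)[OF P])
  let ?e = "\<lambda>n j. \<integral>\<^sup>+\<omega>. indicator (event_always (enat n) S) \<omega> * ennreal (stay j (fst (\<omega> n))) \<partial>?P"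
  have step: "?e n (Suc j) \<le> ?e (Suc n) j + ennreal \<epsilon>" if j: "m = Suc (n + j)" for n j
  proof -
    let ?t = "\<lambda>\<omega>. indicator (event_always (enat n) S) \<omega> *
      ennreal (T_int T S (snd (\<omega> n)) (stay j) (fst (\<omega> n)))"
    \<comment> \<open>The factor \<open>indicator S\<close> makes the condition hold trivially off
      \<open>S\<close>, so that the selector meets \<open>A\<close> at every state, as
      \<open>AE_control\<close> demands.\<close>
    define A where "A = {z. indicator S (fst z) * stay (Suc j) (fst z) \<le> (case z of (x, u) \<Rightarrow> T_int T S u (stay j) x) + \<epsilon>}"
    have g: "(\<lambda>(x, u). T_int T S u (stay j) x) \<in> borel_measurable (univ_completion (borel :: ('x \<times> 'u) measure))"
      by (intro borel_measurable_univ_completion_upper_semianalytic upper_semianalytic_T_int stay_bA_up)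
    have "fst \<in> univ_completion (borel :: ('x \<times> 'u) measure) \<rightarrow>\<^sub>M univ_completion borel"
      by (rule measurable_univ_completion) measurable
    from measurable_compose[OF this borel_measurable_univ_completion_bA_up[OF stay_bA_up S]]
    have "(\<lambda>z. indicator S (fst z) * stay (Suc j) (fst z)) \<in> borel_measurable (univ_completion (borel :: ('x \<times> 'u) measure))" .
    from borel_measurable_le[OF this borel_measurable_add[OF g borel_measurable_const[of \<epsilon>]]]
    have "A \<in> sets (univ_completion borel)" by (simp add: A_def)
    moreover have "(y, \<phi> j y) \<in> A" for y
    proof (cases "y \<in> S")
      case False
      have "0 \<le> T_int T S (\<phi> j y) (stay j) y" using stay_bounds by (intro T_int_nonneg) blast
      then show ?thesis using False \<epsilon> by (simp add: A_def)
    qed (simp add: A_def \<phi>(3))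
    then have "emeasure (completion (\<pi> n h)) {u. (snd h, u) \<in> A} = 1" for h
      unfolding \<pi>_def using j by (intro emeasure_completion_return) simp
    ultimately have "AE \<omega> in ?P. \<omega> n \<in> A"
      by (intro AE_control[OF policies_measurable[OF \<pi>] P])
    then have "AE \<omega> in ?P. indicator (event_always (enat n) S) \<omega> * ennreal (stay (Suc j) (fst (\<omega> n)))
      \<le> ?t \<omega> + ennreal \<epsilon>"
    proof eventually_elim
      fix \<omega> assume \<omega>: "\<omega> n \<in> A"
      have nonneg: "0 \<le> T_int T S (snd (\<omega> n)) (stay j) (fst (\<omega> n))" using stay_bounds by (intro T_int_nonneg) blast
      show "indicator (event_always (enat n) S) \<omega> * ennreal (stay (Suc j) (fst (\<omega> n)))
        \<le> ?t \<omega> + ennreal \<epsilon>"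
      proof (cases "\<omega> \<in> event_always (enat n) S")
        case True
        then have "fst (\<omega> n) \<in> S" by (simp add: event_always_def)
        then have "stay (Suc j) (fst (\<omega> n)) \<le> T_int T S (snd (\<omega> n)) (stay j) (fst (\<omega> n)) + \<epsilon>"
          using \<omega> by (simp add: A_def split_beta)
        then show ?thesis
          using True nonneg \<epsilon> by (simp add: ennreal_plus[symmetric] ennreal_leI del: ennreal_plus)
      qed simp
    qed
    then have "?e n (Suc j) \<le> (\<integral>\<^sup>+\<omega>. ?t \<omega> + ennreal \<epsilon> \<partial>?P)"
      by (rule nn_integral_mono_AE)
    \<comment> \<open>Additivity of the integral asks for measurable integrands, and
      \<open>?t\<close> is known to be measurable only for the completed measure.\<close>
    also have "\<dots> = (\<integral>\<^sup>+\<omega>. ?t \<omega> + ennreal \<epsilon> \<partial>completion ?P)"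
      by (rule nn_integral_completion[symmetric])
    also have "\<dots> = (\<integral>\<^sup>+\<omega>. ?t \<omega> \<partial>completion ?P) + (\<integral>\<^sup>+\<omega>. ennreal \<epsilon> \<partial>completion ?P)"
    proof (rule nn_integral_add)
      have "(\<lambda>\<omega>. \<omega> n) \<in> univ_completion path_space \<rightarrow>\<^sub>M univ_completion (borel :: ('x \<times> 'u) measure)"
        by (rule measurable_univ_completion) measurable
      from measurable_compose[OF this g]
      have "(\<lambda>\<omega>. T_int T S (snd (\<omega> n)) (stay j) (fst (\<omega> n))) \<in> borel_measurable (univ_completion path_space)"
        by (simp add: split_beta)
      then have "(\<lambda>\<omega>. T_int T S (snd (\<omega> n)) (stay j) (fst (\<omega> n))) \<in> borel_measurable (completion ?P)"
        using path_lawD(2)[OF P] finite_measure_axioms by (rule measurable_univ_completionD)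
      moreover have "event_always (enat n) S \<in> sets (completion ?P)"
        using event_always_measurable path_lawD(2)[OF P] by simp
      ultimately show "(\<lambda>\<omega>. ?t \<omega>) \<in> borel_measurable (completion ?P)"
        by measurable
    qed simp
    also have "\<dots> = ?e (Suc n) j + ennreal \<epsilon>"
      unfolding nn_integral_completion
      using nn_integral_always_Suc[OF P stay_bA_up[of j], where n = n] stay_bounds emeasure_space_1 by simp
    finally show ?thesis .
  qed
  have "?e 0 m \<le> ?e n (m - n) + ennreal (n * \<epsilon>)" if "n \<le> m" for n
    using that
  proof (induction n)
    case (Suc n)
    have "?e 0 m \<le> ?e n (Suc (m - Suc n)) + ennreal (n * \<epsilon>)" using Suc by (simp add: Suc_diff_Suc)
    also have "\<dots> \<le> (?e (Suc n) (m - Suc n) + ennreal \<epsilon>) + ennreal (n * \<epsilon>)"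
      using Suc.prems by (intro add_right_mono step) simp
    also have "\<dots> = ?e (Suc n) (m - Suc n) + ennreal (Suc n * \<epsilon>)"
      using \<epsilon> by (simp add: add.assoc ennreal_plus[symmetric] algebra_simps del: ennreal_plus)
    finally show ?case .
  qed simp
  from this[of m] have "ennreal (stay m x) \<le> ennreal (measure ?P (event_always (enat m) S)) + ennreal (m * \<epsilon>)"
    using nn_integral_always_0[OF P x] nn_integral_always_stay_0[OF P] by simp
  then have "stay m x \<le> measure ?P (event_always (enat m) S) + m * \<epsilon>"
    using \<epsilon> by (simp add: ennreal_plus[symmetric] ennreal_le_iff del: ennreal_plus)
  with \<pi> show ?thesis by blast
qed

lemma stay_le_max_prob:
  assumes x: "x \<in> S"
  shows "stay m x \<le> max_prob K T x (event_always (enat m) S)"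
proof (rule field_le_epsilon)
  fix e :: real assume e: "e > 0"
  \<comment> \<open>\<open>Suc m\<close> avoids a division by zero for \<open>m = 0\<close>; the
    total loss \<open>m * (e / Suc m)\<close> remains at most \<open>e\<close>.\<close>
  then have "e / Suc m > 0" by simp
  from ex_policy_always_ge[OF this x, of m] obtain \<pi> where \<pi>: "\<pi> \<in> policies K"
    "stay m x \<le> measure (path_measure T \<pi> x) (event_always (enat m) S) + m * (e / Suc m)" by blast
  have "m * (e / Suc m) \<le> e" using e by (simp add: field_simps)
  then show "stay m x \<le> max_prob K T x (event_always (enat m) S) + e"
    using \<pi>(2) measure_le_max_prob[OF \<pi>(1), of x "event_always (enat m) S"] by linarith
qed

lemma max_prob_le_beta: "max_prob K T x (event_always (enat m) S) \<le> beta K T S m"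
  unfolding beta_def using max_prob_bounds(2) by (intro cSUP_upper) (auto intro!: bdd_aboveI[of _ 1])

lemma beta_nonneg: "0 \<le> beta K T S m"
  using max_prob_bounds(1) max_prob_le_beta by (rule order_trans)

lemma stay_le_beta: "x \<in> S \<Longrightarrow> stay m x \<le> beta K T S m"
  using stay_le_max_prob max_prob_le_beta by (rule order_trans)

text \<open>\<open>stay (m * Suc n)\<close> is the \<open>m\<close>-fold operator applied to
  \<open>stay (m * n)\<close>, which is at most \<open>\<beta> ^ n\<close>. Comparison with the zero
  function, a fixpoint for reward \<open>0\<close>, contributes another factor
  \<open>stay m\<close>.\<close>

lemma stay_mult_le:
  assumes \<beta>: "0 \<le> \<beta>" "\<And>x. x \<in> S \<Longrightarrow> stay m x \<le> \<beta>" and x: "x \<in> S"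
  shows "stay (m * n) x \<le> \<beta> ^ n"
  using x
proof (induction n arbitrary: x)
  case (Suc n)
  let ?L = "dp_op K T S (\<lambda>_. 0)"
  have zero: "?L (\<lambda>x\<in>S. 0) = (\<lambda>x\<in>S. 0)"
  proof -
    have "\<bar>T_int T S u (\<lambda>x\<in>S. 0) x\<bar> \<le> 0" for u x
      by (rule T_int_bound[OF const_bA_up[OF S]]) auto
    then show ?thesis using K_nonempty by (simp add: dp_op_def fun_eq_iff)
  qed
  have "(?L ^^ m) (\<lambda>x\<in>S. 0) = (\<lambda>x\<in>S. 0)" by (induction m) (simp_all only: funpow.simps comp_apply id_apply zero)
  moreover have "(?L ^^ m) (stay (m * n)) x \<le> (?L ^^ m) (\<lambda>x\<in>S. 0) x + \<beta> ^ n * stay m x"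
    using Suc \<beta>(1) by (intro dp_op_iter_le[where C = 0] stay_bA_up const_bA_up S) auto
  moreover have "stay (m * Suc n) = (?L ^^ m) (stay (m * n))"
    by (simp add: stay_def T_up_eq_dp_op funpow_add)
  ultimately have "stay (m * Suc n) x \<le> \<beta> ^ n * stay m x" using Suc.prems by simp
  also have "\<dots> \<le> \<beta> ^ n * \<beta>" using \<beta> Suc.prems by (intro mult_left_mono) auto
  finally show ?case by (simp add: mult.commute)
qed (simp add: stay_0)

section \<open>Reaching \<open>G\<close> with and without a horizon\<close>

lemma event_until_measurable:
  "G \<in> sets borel \<Longrightarrow> (event_until S n G :: (nat \<Rightarrow> 'x \<times> 'u) set) \<in> sets path_space"
proof -
  assume G: "G \<in> sets borel"
  have "{\<omega> \<in> space (path_space :: (nat \<Rightarrow> 'x \<times> 'u) measure).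
      \<exists>i. enat i \<le> n \<and> fst (\<omega> i) \<in> G \<and> (\<forall>j\<in>{..<i}. fst (\<omega> j) \<in> S)} \<in> sets path_space"
    using S G by measurable
  moreover have "{\<omega> \<in> space (path_space :: (nat \<Rightarrow> 'x \<times> 'u) measure).
      \<exists>i. enat i \<le> n \<and> fst (\<omega> i) \<in> G \<and> (\<forall>j\<in>{..<i}. fst (\<omega> j) \<in> S)} = event_until S n G"
    by (auto simp: event_until_def)
  ultimately show ?thesis by simp
qed

text \<open>A path that reaches \<open>G\<close> through \<open>S\<close>, but not within \<open>k\<close> steps, stays in \<open>S\<close> for \<open>k\<close> steps.\<close>

lemma measure_until_le:
  assumes \<pi>: "\<pi> \<in> policies K" and G: "G \<in> sets borel" and x: "x \<in> S"
  shows "measure (path_measure T \<pi> x) (event_until S (enat k) G)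
      \<le> measure (path_measure T \<pi> x) (event_until S \<infinity> G)"
    "measure (path_measure T \<pi> x) (event_until S \<infinity> G)
      \<le> measure (path_measure T \<pi> x) (event_until S (enat k) G) + stay k x"
proof -
  note P = path_law_policy[OF \<pi>]
  interpret prob_space "path_measure T \<pi> x" by (rule path_lawD(1)[OF P])
  have ev: "event_until S n G \<in> events" "event_always n S \<in> events" for n
    using event_until_measurable[OF G] event_always_measurable path_lawD(2)[OF P] by simp_all
  show "prob (event_until S (enat k) G) \<le> prob (event_until S \<infinity> G)"
    by (rule finite_measure_mono[OF _ ev(1)]) (auto simp: event_until_def)
  have "(event_until S \<infinity> G :: (nat \<Rightarrow> 'x \<times> 'u) set) \<subseteq> event_until S (enat k) G \<union> event_always (enat k) S"
  proof
    fix \<omega> :: "nat \<Rightarrow> 'x \<times> 'u" assume "\<omega> \<in> event_until S \<infinity> G"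
    then obtain i where "fst (\<omega> i) \<in> G" "\<forall>j<i. fst (\<omega> j) \<in> S" by (auto simp: event_until_def)
    then show "\<omega> \<in> event_until S (enat k) G \<union> event_always (enat k) S"
      by (cases "i \<le> k") (auto simp: event_until_def event_always_def)
  qed
  then have "prob (event_until S \<infinity> G) \<le> prob (event_until S (enat k) G \<union> event_always (enat k) S)"
    by (rule finite_measure_mono) (use ev in simp)
  also have "\<dots> \<le> prob (event_until S (enat k) G) + prob (event_always (enat k) S)"
    using ev by (intro measure_Un_le)
  also have "\<dots> \<le> prob (event_until S (enat k) G) + stay k x"
    using measure_always_le_stay[OF \<pi> x] by simp
  finally show "prob (event_until S \<infinity> G) \<le> prob (event_until S (enat k) G) + stay k x" .
qed

text \<open>The bound on the difference is uniform over policies and hence passes to the supremum;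
  for the infimum the argument is the same.\<close>

lemma max_prob_until_diff:
  assumes G: "G \<in> sets borel" and x: "x \<in> S"
  shows "\<bar>max_prob K T x (event_until S \<infinity> G) - max_prob K T x (event_until S (enat k) G)\<bar> \<le> stay k x"
proof -
  have "max_prob K T x (event_until S (enat k) G) \<le> max_prob K T x (event_until S \<infinity> G)"
    unfolding max_prob_def[of K T x "event_until S (enat k) G"]
    using policies_nonempty order_trans[OF measure_until_le(1)[OF _ G x] measure_le_max_prob]
    by (intro cSUP_least) auto
  moreover have "max_prob K T x (event_until S \<infinity> G) \<le> max_prob K T x (event_until S (enat k) G) + stay k x"
    unfolding max_prob_def[of K T x "event_until S \<infinity> G"]
    using policies_nonempty
      order_trans[OF measure_until_le(2)[OF _ G x] add_right_mono[OF measure_le_max_prob]]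
    by (intro cSUP_least) auto
  ultimately show ?thesis using stay_bounds[OF x, of k] by linarith
qed

lemma min_prob_until_diff:
  assumes G: "G \<in> sets borel" and x: "x \<in> S"
  shows "\<bar>min_prob K T x (event_until S \<infinity> G) - min_prob K T x (event_until S (enat k) G)\<bar> \<le> stay k x"
proof -
  have le: "min_prob K T x A \<le> measure (path_measure T \<pi> x) A" if "\<pi> \<in> policies K" for A \<pi>
    unfolding min_prob_def using that by (intro cINF_lower) (auto intro!: bdd_belowI[of _ 0])
  have "min_prob K T x (event_until S (enat k) G) \<le> min_prob K T x (event_until S \<infinity> G)"
    unfolding min_prob_def[of K T x "event_until S \<infinity> G"]
    using policies_nonempty order_trans[OF le measure_until_le(1)[OF _ G x]]
    by (intro cINF_greatest) auto
  moreover have "min_prob K T x (event_until S \<infinity> G) - stay k x \<le> min_prob K T x (event_until S (enat k) G)"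
    unfolding min_prob_def[of K T x "event_until S (enat k) G"]
  proof (rule cINF_greatest[OF policies_nonempty])
    fix \<pi> assume \<pi>: "\<pi> \<in> policies K"
    then show "min_prob K T x (event_until S \<infinity> G) - stay k x \<le> measure (path_measure T \<pi> x) (event_until S (enat k) G)"
      using le[OF \<pi>, of "event_until S \<infinity> G"] measure_until_le(2)[OF \<pi> G x, of k] by linarith
  qed
  ultimately show ?thesis using stay_bounds[OF x, of k] by linarith
qed

text \<open>Staying forever implies staying for \<open>m * n\<close> steps for each
  \<open>n\<close>, and \<open>\<beta> ^ n\<close> tends to \<open>0\<close>.\<close>

lemma measure_always_infinity:
  assumes \<beta>: "0 \<le> \<beta>" "\<beta> < 1" "\<And>x. x \<in> S \<Longrightarrow> stay m x \<le> \<beta>"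
    and \<pi>: "\<pi> \<in> policies K" and x: "x \<in> S"
  shows "measure (path_measure T \<pi> x) (event_always \<infinity> S) = 0"
proof -
  note P = path_law_policy[OF \<pi>]
  interpret prob_space "path_measure T \<pi> x" by (rule path_lawD(1)[OF P])
  have "prob (event_always \<infinity> S) \<le> \<beta> ^ n" for n
  proof -
    have "prob (event_always \<infinity> S) \<le> prob (event_always (enat (m * n)) S)"
    proof (rule finite_measure_mono)
      show "event_always (enat (m * n)) S \<in> events"
        using event_always_measurable path_lawD(2)[OF P] by simp
    qed (auto simp: event_always_def)
    also have "\<dots> \<le> stay (m * n) x" by (rule measure_always_le_stay[OF \<pi> x])
    also have "\<dots> \<le> \<beta> ^ n" using \<beta> x by (intro stay_mult_le)
    finally show ?thesis .
  qed
  moreover have "(\<lambda>n. \<beta> ^ n) \<longlonglongrightarrow> 0" using \<beta> by (intro LIMSEQ_realpow_zero)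
  ultimately have "prob (event_always \<infinity> S) \<le> 0" by (intro LIMSEQ_le_const) auto
  then show ?thesis using measure_nonneg antisym by blast
qed

end

text \<open>A finite infimum of extended naturals is attained: the set is nonempty and the order is
  a well-order.\<close>

lemma contraction_index_beta_less_1:
  assumes "contraction_index K T S = enat m"
  shows "beta K T S m < 1"
proof -
  let ?A = "{enat n |n. beta K T S n < 1}"
  have Inf: "Inf ?A = enat m" using assms by (simp add: contraction_index_def)
  have "?A \<noteq> {}" using Inf by (metis Inf_enat_def enat.distinct(1))
  then have "Inf ?A \<in> ?A" by (auto simp: Inf_enat_def intro: LeastI)
  then show ?thesis unfolding Inf by simp
qed

theorem theorem4:
  fixes K :: "('x::borel_space \<times> 'u::borel_space) set"
    and T :: "'x \<times> 'u \<Rightarrow> 'x measure"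
    and S G :: "'x set" and m :: nat and \<beta> :: real
  assumes "cdt_MP K T"
    and "S \<in> sets borel" and "G \<in> sets borel" and "S \<inter> G = {}"
    and "contraction_index K T S = enat m"
    and "\<beta> = beta K T S m"
  shows "contraction_on (bA_up S) S \<beta> (R_up K T S G ^^ m) \<and>
         contraction_on (bA_low S) S \<beta> (R_low K T S G ^^ m) \<and>
         (\<exists>!f. f \<in> bA_up S \<and> (R_up K T S G ^^ m) f = f) \<and>
         (\<exists>!f. f \<in> bA_low S \<and> (R_low K T S G ^^ m) f = f) \<and>
         (\<forall>n::nat. sup_dist S (W_up K T S G \<infinity>) (W_up K T S G (enat (m * n))) \<le> \<beta> ^ n) \<and>
         (\<forall>n::nat. sup_dist S (W_low K T S G \<infinity>) (W_low K T S G (enat (m * n))) \<le> \<beta> ^ n) \<and>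
         contraction_on (bA_up S) S \<beta> (T_up K T S ^^ m) \<and>
         contraction_on (bA_low S) S \<beta> (T_low K T S ^^ m) \<and>
         V_up K T S \<infinity> = (\<lambda>x\<in>S. 0) \<and>
         V_low K T S \<infinity> = (\<lambda>x\<in>S. 0)"
proof -
  interpret cdt K T S using assms(1,2) by unfold_locales
  have \<beta>: "0 \<le> \<beta>" "\<beta> < 1" and stay: "\<And>x. x \<in> S \<Longrightarrow> stay m x \<le> \<beta>"
    using beta_nonneg stay_le_beta contraction_index_beta_less_1[OF assms(5)] by (simp_all add: assms(6))
  \<comment> \<open>The reward of \<open>R_up\<close> is a Borel function bounded by
    \<open>1\<close>, as it is a probability.\<close>
  have G: "(\<lambda>z. measure (T z) G) \<in> borel_measurable borel" "\<bar>measure (T z) G\<bar> \<le> 1" for z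
    using measurable_compose[OF T_kernel measurable_measure_prob_algebra[OF assms(3)]]
      prob_space.prob_le_1[OF prob_space_T] by simp_all
  have up: "contraction_on (bA_up S) S \<beta> (dp_op K T S c ^^ m)"
    if "c \<in> borel_measurable borel" "\<And>z. \<bar>c z\<bar> \<le> 1" for c
    using that \<beta> stay by (rule contraction_on_dp_op)
  have low: "contraction_on (bA_low S) S \<beta> (F ^^ m)" "\<exists>!f. f \<in> bA_low S \<and> (F ^^ m) f = f"
    if c: "c \<in> borel_measurable borel" "\<And>z. \<bar>c z\<bar> \<le> 1"
      and F: "\<And>f. F f = (\<lambda>x\<in>S. INF u\<in>{u. (x, u) \<in> K}. - c (x, u) + T_int T S u f x)" for c F
    using contraction_on_conjugate_neg[OF S up[OF c] INF_iter_conjugate[OF c F]] by blast+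
  have R_up: "R_up K T S G = dp_op K T S (\<lambda>z. measure (T z) G)"
    by (simp add: R_up_def dp_op_def fun_eq_iff)
  have W: "stay (m * n) x \<le> \<beta> ^ n" if "x \<in> S" for x n
    using \<beta>(1) stay that by (rule stay_mult_le)
  have W_up: "sup_dist S (W_up K T S G \<infinity>) (W_up K T S G (enat (m * n))) \<le> \<beta> ^ n" for n
    using \<beta> order_trans[OF max_prob_until_diff[OF assms(3)] W]
    by (intro sup_dist_le) (simp_all add: W_up_def)
  have W_low: "sup_dist S (W_low K T S G \<infinity>) (W_low K T S G (enat (m * n))) \<le> \<beta> ^ n" for n
    using \<beta> order_trans[OF min_prob_until_diff[OF assms(3)] W]
    by (intro sup_dist_le) (simp_all add: W_low_def)
  have zero: "measure (path_measure T \<pi> x) (event_always \<infinity> S) = 0" if "\<pi> \<in> policies K" "x \<in> S" for \<pi> x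
    using \<beta> stay that by (rule measure_always_infinity)
  have V: "V_up K T S \<infinity> = (\<lambda>x\<in>S. 0)" "V_low K T S \<infinity> = (\<lambda>x\<in>S. 0)"
    using zero policies_nonempty
    by (auto simp: V_up_def V_low_def max_prob_def min_prob_def fun_eq_iff)
  \<comment> \<open>The reward enters the infimum operators as \<open>- c\<close>, so
    \<open>R_low\<close> comes from the negative of the transition probability into
    \<open>G\<close>; reward \<open>0\<close> gives \<open>T_up\<close> and
    \<open>T_low\<close>.\<close>
  show ?thesis
    using up[of "\<lambda>z. measure (T z) G"] up[of "\<lambda>_. 0"] G W_up W_low V
      contraction_on_bA_up_fixpoint[OF S up[of "\<lambda>z. measure (T z) G"]]
      low[of "\<lambda>z. - measure (T z) G" "R_low K T S G"] low(1)[of "\<lambda>_. 0" "T_low K T S"]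
    by (simp add: R_up T_up_eq_dp_op R_low_def T_low_def)
qed

end
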